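(* Let $A$ be a separable infinite-dimensional unital abelian $C^*$-algebra such that the fundamental group $\pi_1(\mathcal{U}_0(A))$ is finitely generated. Then $\mathcal{U}_0(A)$ is quasi-isometric to the Banach space $C([0,1])$. In particular, all identity components $\mathcal{U}_0(A)$ of unitary groups of such algebras are quasi-isometric to each other.
   Context: For a unital $C^*$-algebra $A$, $\mathcal{U}(A)$ is the unitary group with the norm topology and $\mathcal{U}_0(A)$ is its connected component of the identity. $C([0,1])$ is the Banach space of real continuous functions on $[0,1]$ with its norm metric. The quasi-isometry type of $\mathcal{U}_0(A)$ is that of any maximal compatible left-invariant metric $d$, i.e. such that every continuous left-invariant pseudometric $p$ satisfies $p\le Kd+L$ for some constants $K,L>0$. Such a metric exists, e.g. $d(u,v)=\mathrm{cel}(u^{-1}v)$ with $\mathrm{cel}(u)=\inf\{\sum_{j=1}^n\|a_j\| : a_j\in A \text{ self-adjoint},\ u=\exp(\mathrm{i}a_1)\cdots\exp(\mathrm{i}a_n)\}$. A map $f:(X,d_X)\to(Y,d_Y)$ is a quasi-isometry if there are $K,L>0$ with $\frac1K d_X(x,y)-L\le d_Y(f(x),f(y))\le Kd_X(x,y)+L$ for all $x,y$, and there is $\varepsilon>0$ such that every point of $Y$ is within distance less than $\varepsilon$ of $f[X]$. *)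

theory Defs
  imports "HOL-Analysis.Analysis" "HOL-Algebra.Generated_Groups"
begin

section \<open>Unital C*-algebras\<close>

text \<open>The norm, the real vector space structure and the ring structure are those of the
  library class of unital real normed algebras; the complex scalar multiplication
  extends the real one. The axiom \<open>norm 1 = 1\<close> inherited from that class
  excludes only the zero algebra.\<close>

class unital_cstar_algebra = real_normed_algebra_1 + complete_space +
  fixes scaleC :: "complex \<Rightarrow> 'a \<Rightarrow> 'a"
    and star :: "'a \<Rightarrow> 'a"
  assumes scaleC_add_right: "scaleC c (x + y) = scaleC c x + scaleC c y"
    and scaleC_add_left: "scaleC (b + c) x = scaleC b x + scaleC c x"
    and scaleC_scaleC: "scaleC b (scaleC c x) = scaleC (b * c) x"
    and scaleC_of_real: "scaleC (complex_of_real r) x = r *\<^sub>R x"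
    and mult_scaleC_left: "scaleC c x * y = scaleC c (x * y)"
    and mult_scaleC_right: "x * scaleC c y = scaleC c (x * y)"
    and norm_scaleC: "norm (scaleC c x) = cmod c * norm x"
    and star_add: "star (x + y) = star x + star y"
    and star_scaleC: "star (scaleC c x) = scaleC (cnj c) (star x)"
    and star_mult: "star (x * y) = star y * star x"
    and star_star: "star (star x) = x"
    and cstar_identity: "norm (star x * x) = (norm x)\<^sup>2"

lemma vector_space_scaleC:
  "vector_space (scaleC :: complex \<Rightarrow> 'a \<Rightarrow> 'a::unital_cstar_algebra)"
proof
  show "scaleC 1 x = x" for x :: 'a
    using scaleC_of_real[of 1 x] by simp
qed (simp_all add: scaleC_add_right scaleC_add_left scaleC_scaleC)

definition infinite_dimensional :: "'a::unital_cstar_algebra itself \<Rightarrow> bool" where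
  "infinite_dimensional _ \<longleftrightarrow>
     \<not> (\<exists>B :: 'a set. finite B \<and> module.span scaleC B = UNIV)"

definition unitary_group :: "'a::unital_cstar_algebra set" where
  "unitary_group = {u. star u * u = 1 \<and> u * star u = 1}"

definition unitary_identity_component :: "'a::unital_cstar_algebra set" where
  "unitary_identity_component = connected_component_set unitary_group 1"


section \<open>The fundamental group\<close>

definition loops_at :: "'a::topological_space set \<Rightarrow> 'a \<Rightarrow> (real \<Rightarrow> 'a) set" where
  "loops_at S a = {p. path p \<and> path_image p \<subseteq> S \<and> pathstart p = a \<and> pathfinish p = a}"

text \<open>The product of two classes is the class of the concatenation; it is written
  as the union over all representatives, which avoids a choice.\<close>

definition fundamental_group ::
    "'a::topological_space set \<Rightarrow> 'a \<Rightarrow> (real \<Rightarrow> 'a) set monoid" where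
  "fundamental_group S a =
     \<lparr>carrier = {{q. homotopic_paths S p q} | p. p \<in> loops_at S a},
      mult = (\<lambda>P Q. \<Union>p\<in>P. \<Union>q\<in>Q. {r. homotopic_paths S (p +++ q) r}),
      one = {q. homotopic_paths S (\<lambda>_. a) q}\<rparr>"

lemma fundamental_group_mult:
  assumes p: "p \<in> loops_at S a" and q: "q \<in> loops_at S a"
  shows "{r. homotopic_paths S p r} \<otimes>\<^bsub>fundamental_group S a\<^esub> {r. homotopic_paths S q r}
           = {r. homotopic_paths S (p +++ q) r}"
proof -
  have pq: "pathfinish p = pathstart q" "homotopic_paths S p p" "homotopic_paths S q q"
    using p q by (simp_all add: loops_at_def)
  have "homotopic_paths S (p +++ q) r"
    if "homotopic_paths S p p'" "homotopic_paths S q q'" "homotopic_paths S (p' +++ q') r" for p' q' r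
    using homotopic_paths_join[OF that(1,2) pq(1)] that(3) by (rule homotopic_paths_trans)
  then have "(\<Union>p'\<in>{r. homotopic_paths S p r}. \<Union>q'\<in>{r. homotopic_paths S q r}.
               {r. homotopic_paths S (p' +++ q') r}) = {r. homotopic_paths S (p +++ q) r}"
    using pq(2,3) by blast
  then show ?thesis
    by (simp add: fundamental_group_def)
qed

lemma group_fundamental_group:
  fixes S :: "'a::real_normed_vector set"
  assumes a: "a \<in> S"
  shows "group (fundamental_group S a)"
proof -
  let ?G = "fundamental_group S a" and ?c = "\<lambda>p. {r. homotopic_paths S p r}"
  have carr: "carrier ?G = ?c ` loops_at S a"
    by (auto simp: fundamental_group_def)
  have eqI: "?c p = ?c q" if "homotopic_paths S p q" for p q
    using that homotopic_paths_sym[OF that] by (blast intro: homotopic_paths_trans)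
  have one: "\<one>\<^bsub>?G\<^esub> = ?c (linepath a a)"
    by (simp add: fundamental_group_def linepath_refl)
  have one_in: "linepath a a \<in> loops_at S a"
    using a by (simp add: loops_at_def)
  have join_in: "p +++ q \<in> loops_at S a" if "p \<in> loops_at S a" "q \<in> loops_at S a" for p q
    using that by (auto simp: loops_at_def path_image_join)
  show ?thesis
  proof (rule groupI)
    fix x y z assume "x \<in> carrier ?G" "y \<in> carrier ?G" "z \<in> carrier ?G"
    then obtain p q r where
      p: "p \<in> loops_at S a" "x = ?c p" and q: "q \<in> loops_at S a" "y = ?c q"
      and r: "r \<in> loops_at S a" "z = ?c r"
      unfolding carr by blast
    have "homotopic_paths S ((p +++ q) +++ r) (p +++ (q +++ r))"
      by (rule homotopic_paths_sym, rule homotopic_paths_assoc)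
        (use p q r in \<open>auto simp: loops_at_def\<close>)
    then have "?c ((p +++ q) +++ r) = ?c (p +++ (q +++ r))"
      by (rule eqI)
    then show "x \<otimes>\<^bsub>?G\<^esub> y \<otimes>\<^bsub>?G\<^esub> z = x \<otimes>\<^bsub>?G\<^esub> (y \<otimes>\<^bsub>?G\<^esub> z)"
      using p q r by (simp add: fundamental_group_mult join_in)
  next
    fix x y assume "x \<in> carrier ?G" "y \<in> carrier ?G"
    then obtain p q where pq: "p \<in> loops_at S a" "x = ?c p" "q \<in> loops_at S a" "y = ?c q"
      unfolding carr by blast
    show "x \<otimes>\<^bsub>?G\<^esub> y \<in> carrier ?G"
      unfolding pq(2,4) fundamental_group_mult[OF pq(1,3)] carr
      using join_in[OF pq(1,3)] by (rule imageI)
  next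
    show "\<one>\<^bsub>?G\<^esub> \<in> carrier ?G"
      using one one_in carr by blast
  next
    fix x assume "x \<in> carrier ?G"
    then obtain p where p: "p \<in> loops_at S a" "x = ?c p"
      unfolding carr by blast
    have "homotopic_paths S (linepath a a +++ p) p"
      using p by (auto simp: loops_at_def intro: homotopic_paths_lid')
    then have "?c (linepath a a +++ p) = ?c p"
      by (rule eqI)
    then show "\<one>\<^bsub>?G\<^esub> \<otimes>\<^bsub>?G\<^esub> x = x"
      unfolding one p(2) fundamental_group_mult[OF one_in p(1)] .
    have rev: "reversepath p \<in> loops_at S a"
      using p by (auto simp: loops_at_def)
    have "homotopic_paths S (reversepath p +++ p) (linepath a a)"
      using p homotopic_paths_linv[of p S] by (auto simp: loops_at_def)
    then have "?c (reversepath p +++ p) = ?c (linepath a a)"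
      by (rule eqI)
    then have "?c (reversepath p) \<otimes>\<^bsub>?G\<^esub> x = \<one>\<^bsub>?G\<^esub>"
      unfolding one p(2) fundamental_group_mult[OF rev p(1)] .
    then show "\<exists>y\<in>carrier ?G. y \<otimes>\<^bsub>?G\<^esub> x = \<one>\<^bsub>?G\<^esub>"
      using rev carr by blast
  qed
qed

definition finitely_generated_group :: "('a, 'b) monoid_scheme \<Rightarrow> bool" where
  "finitely_generated_group G \<longleftrightarrow>
     (\<exists>H. finite H \<and> H \<subseteq> carrier G \<and> generate G H = carrier G)"


section \<open>Quasi-isometries and maximal metrics\<close>

definition quasi_isometry :: "'a metric \<Rightarrow> 'b metric \<Rightarrow> ('a \<Rightarrow> 'b) \<Rightarrow> bool" where
  "quasi_isometry X Y f \<longleftrightarrow>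
     f \<in> mspace X \<rightarrow> mspace Y \<and>
     (\<exists>K>0. \<exists>L>0. \<forall>x\<in>mspace X. \<forall>y\<in>mspace X.
        1 / K * mdist X x y - L \<le> mdist Y (f x) (f y) \<and>
        mdist Y (f x) (f y) \<le> K * mdist X x y + L) \<and>
     (\<exists>\<epsilon>>0. \<forall>y\<in>mspace Y. \<exists>x\<in>mspace X. mdist Y y (f x) < \<epsilon>)"

definition quasi_isometric :: "'a metric \<Rightarrow> 'b metric \<Rightarrow> bool" where
  "quasi_isometric X Y \<longleftrightarrow> (\<exists>f. quasi_isometry X Y f)"

text \<open>In the following, \<open>G\<close> is a subset of the ambient type that is a topological group
  under the ambient multiplication and the subspace topology.\<close>

definition left_invariant :: "'a::times set \<Rightarrow> ('a \<Rightarrow> 'a \<Rightarrow> real) \<Rightarrow> bool" where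
  "left_invariant G d \<longleftrightarrow> (\<forall>g\<in>G. \<forall>x\<in>G. \<forall>y\<in>G. d (g * x) (g * y) = d x y)"

definition pseudometric_on :: "'a set \<Rightarrow> ('a \<Rightarrow> 'a \<Rightarrow> real) \<Rightarrow> bool" where
  "pseudometric_on G p \<longleftrightarrow>
     (\<forall>x\<in>G. \<forall>y\<in>G. 0 \<le> p x y \<and> p x y = p y x) \<and> (\<forall>x\<in>G. p x x = 0) \<and>
     (\<forall>x\<in>G. \<forall>y\<in>G. \<forall>z\<in>G. p x z \<le> p x y + p y z)"

definition maximal_metric :: "'a::{times,topological_space} set \<Rightarrow> 'a metric \<Rightarrow> bool" where
  "maximal_metric G m \<longleftrightarrow>
     mspace m = G \<and> mtopology_of m = top_of_set G \<and> left_invariant G (mdist m) \<and>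
     (\<forall>p. pseudometric_on G p \<and> continuous_on (G \<times> G) (\<lambda>(x, y). p x y) \<and> left_invariant G p \<longrightarrow>
        (\<exists>K>0. \<exists>L>0. \<forall>x\<in>G. \<forall>y\<in>G. p x y \<le> K * mdist m x y + L))"

text \<open>Any two maximal metrics are quasi-isometric through the identity, so the quasi-isometry
  type of \<open>G\<close> may be tested on any maximal metric; existence of one is part of saying that
  \<open>G\<close> has a quasi-isometry type.\<close>

definition group_quasi_isometric_to_space ::
    "'a::{times,topological_space} set \<Rightarrow> 'b metric \<Rightarrow> bool" where
  "group_quasi_isometric_to_space G Y \<longleftrightarrow>
     (\<exists>m. maximal_metric G m) \<and> (\<forall>m. maximal_metric G m \<longrightarrow> quasi_isometric m Y)"

definition groups_quasi_isometric ::
    "'a::{times,topological_space} set \<Rightarrow> 'b::{times,topological_space} set \<Rightarrow> bool" where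
  "groups_quasi_isometric G H \<longleftrightarrow>
     (\<exists>m. maximal_metric G m) \<and> (\<exists>n. maximal_metric H n) \<and>
     (\<forall>m n. maximal_metric G m \<and> maximal_metric H n \<longrightarrow> quasi_isometric m n)"

text \<open>Real continuous functions on the unit interval with the supremum metric.\<close>

definition C01 :: "(real \<Rightarrow> real) metric" where
  "C01 = cfunspace (top_of_set {0..1}) euclidean_metric"

end

theory Submission
  imports Defs "HOL-Complex_Analysis.Winding_Numbers"
begin

text \<open>By Gelfand duality the algebra is \<open>C(X)\<close> for a compact metrizable \<open>X\<close>, and its unitary identity
  component is \<open>{exp (i f)}\<close> with \<open>f\<close> real valued. Winding numbers map the fundamental group to
  integer valued functions on \<open>X\<close> that separate the clopen sets, so finite generation forces \<open>X\<close> to have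
  finitely many components. After fixing a base point in each of them, \<open>u\<close> has a unique logarithm that
  vanishes at the base points, up to a finite-dimensional torus; hence the group is quasi-isometric to
  the functions in \<open>C(X)\<close> that vanish on the finite set of base points.

  It remains to identify this space with \<open>C([0,1])\<close>, for which a Lipschitz version of Milutin's theorem
  suffices: a linear contraction with a Lipschitz right inverse splits off its kernel, so nonlinear
  extension operators can replace linear ones. Both spaces contain the Cantor space as a closed part, both are
  split off from the functions on the Cantor space by averaging over random digits, and Pelczynski's
  decomposition method identifies them with the \<open>c\<^sub>0\<close>-sum of copies of the functions on the Cantor space.\<close>

section \<open>Lipschitz equivalence of pointed metric spaces\<close>

text \<open>Quasi-isometries forgive bounded errors and do not see linearity. Over finitely many
  components the multiples of 2 pi by which logarithms differ can be chosen component by component,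
  so the values at the base points can be brought into [0, 2 pi]; the torus therefore has bounded
  diameter and disappears on the large scale. Only restriction and averaging are linear; their right
  inverses are nonlinear but nonexpansive. Pelczynski's argument manipulates nothing but products
  and null sequences, so it survives for maps that fix base points and have one global Lipschitz
  constant. The model is a c0-sum rather than the functions on the Cantor space themselves because
  its self-absorption is a mere reindexing. Functions that vanish on \<open>F\<close> are carried
  along throughout, since the spectrum comes with its base points and the interval with the empty
  set. The Cantor set used must avoid \<open>F\<close>; it is found in an infinite component, which
  is perfect because it is connected. On the algebraic side, spectra are replaced by square roots
  obtained from a contraction, which give an order and then the characters.\<close>

text \<open>A pointed metric space is encoded by the relations \<open>near P B x y\<close>, to be read as
  "the distance of x and y is at most B"; this makes products and \<open>c\<^sub>0\<close>-sums available
  without suprema.\<close>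

datatype 'a gspace = GSpace (pts: "'a set") (near: "real \<Rightarrow> 'a \<Rightarrow> 'a \<Rightarrow> bool") (base: 'a)

definition gauge_ok :: "'a gspace \<Rightarrow> bool" where
  "gauge_ok P \<longleftrightarrow> base P \<in> pts P \<and> (\<forall>x\<in>pts P. near P 0 x x) \<and>
     (\<forall>B B' x y. near P B x y \<longrightarrow> B \<le> B' \<longrightarrow> near P B' x y)"

text \<open>Base points are fixed so that coordinatewise application respects null sequences. The
  slack between \<open>K * B\<close> and \<open>B'\<close> builds in monotonicity, so that
  composition goes through without \<open>gauge_ok\<close>.\<close>

definition lip_map :: "'a gspace \<Rightarrow> 'b gspace \<Rightarrow> ('a \<Rightarrow> 'b) \<Rightarrow> bool" where
  "lip_map P Q h \<longleftrightarrow> h (base P) = base Q \<and> h ` pts P \<subseteq> pts Q \<and>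
     (\<exists>K>0. \<forall>x\<in>pts P. \<forall>y\<in>pts P. \<forall>B B'. 0 \<le> B \<longrightarrow> near P B x y \<longrightarrow> K * B \<le> B'
        \<longrightarrow> near Q B' (h x) (h y))"

definition lipeq :: "'a gspace \<Rightarrow> 'b gspace \<Rightarrow> bool" where
  "lipeq P Q \<longleftrightarrow> (\<exists>h k. lip_map P Q h \<and> lip_map Q P k \<and>
     (\<forall>x\<in>pts P. k (h x) = x) \<and> (\<forall>y\<in>pts Q. h (k y) = y))"

definition gprod :: "'a gspace \<Rightarrow> 'b gspace \<Rightarrow> ('a \<times> 'b) gspace" where
  "gprod P Q = GSpace (pts P \<times> pts Q)
     (\<lambda>B x y. near P B (fst x) (fst y) \<and> near Q B (snd x) (snd y)) (base P, base Q)"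

definition gc0 :: "'a gspace \<Rightarrow> (nat \<Rightarrow> 'a) gspace" where
  "gc0 P = GSpace {x. (\<forall>n. x n \<in> pts P) \<and> (\<forall>e>0. finite {n. \<not> near P e (x n) (base P)})}
     (\<lambda>B x y. \<forall>n. near P B (x n) (y n)) (\<lambda>_. base P)"

lemma gprod_sel [simp]:
  "pts (gprod P Q) = pts P \<times> pts Q" "base (gprod P Q) = (base P, base Q)"
  "near (gprod P Q) B x y \<longleftrightarrow> near P B (fst x) (fst y) \<and> near Q B (snd x) (snd y)"
  by (simp_all add: gprod_def)

lemma gc0_sel [simp]:
  "pts (gc0 P) = {x. (\<forall>n. x n \<in> pts P) \<and> (\<forall>e>0. finite {n. \<not> near P e (x n) (base P)})}"
  "base (gc0 P) = (\<lambda>_. base P)"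
  "near (gc0 P) B x y \<longleftrightarrow> (\<forall>n. near P B (x n) (y n))"
  by (simp_all add: gc0_def)

lemma gauge_mono: "gauge_ok P \<Longrightarrow> near P B x y \<Longrightarrow> B \<le> B' \<Longrightarrow> near P B' x y"
  by (auto simp: gauge_ok_def)

lemma gauge_base: "gauge_ok P \<Longrightarrow> base P \<in> pts P"
  by (auto simp: gauge_ok_def)

lemma gauge_ok_gprod: "gauge_ok P \<Longrightarrow> gauge_ok Q \<Longrightarrow> gauge_ok (gprod P Q)"
  by (auto simp: gauge_ok_def)

lemma gauge_ok_gc0: "gauge_ok P \<Longrightarrow> gauge_ok (gc0 P)"
  unfolding gauge_ok_def by auto (metis (no_types, lifting) less_imp_le finite.emptyI Collect_empty_eq)

lemma lip_mapI:
  assumes "h (base P) = base Q" "\<And>x. x \<in> pts P \<Longrightarrow> h x \<in> pts Q" "gauge_ok Q" "K > 0"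
    and "\<And>x y B. x \<in> pts P \<Longrightarrow> y \<in> pts P \<Longrightarrow> 0 \<le> B \<Longrightarrow> near P B x y \<Longrightarrow> near Q (K * B) (h x) (h y)"
  shows "lip_map P Q h"
  unfolding lip_map_def using assms by (blast intro: gauge_mono)

lemma lip_mapE:
  assumes "lip_map P Q h"
  obtains K where "K > 0" "\<And>x y B B'. x \<in> pts P \<Longrightarrow> y \<in> pts P \<Longrightarrow> 0 \<le> B \<Longrightarrow> near P B x y \<Longrightarrow>
    K * B \<le> B' \<Longrightarrow> near Q B' (h x) (h y)"
  using assms unfolding lip_map_def by metis

lemma lip_map_pts: "lip_map P Q h \<Longrightarrow> x \<in> pts P \<Longrightarrow> h x \<in> pts Q"
  by (auto simp: lip_map_def)

lemma lip_map_base: "lip_map P Q h \<Longrightarrow> h (base P) = base Q"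
  by (auto simp: lip_map_def)

lemma lip_map_comp:
  assumes h: "lip_map P Q h" and k: "lip_map Q R k"
  shows "lip_map P R (k \<circ> h)"
proof -
  obtain K where K: "K > 0" "\<And>x y B B'. x \<in> pts P \<Longrightarrow> y \<in> pts P \<Longrightarrow> 0 \<le> B \<Longrightarrow> near P B x y \<Longrightarrow>
    K * B \<le> B' \<Longrightarrow> near Q B' (h x) (h y)" using h by (metis lip_mapE)
  obtain L where L: "L > 0" "\<And>x y B B'. x \<in> pts Q \<Longrightarrow> y \<in> pts Q \<Longrightarrow> 0 \<le> B \<Longrightarrow> near Q B x y \<Longrightarrow>
    L * B \<le> B' \<Longrightarrow> near R B' (k x) (k y)" using k by (metis lip_mapE)
  have "near R B' (k (h x)) (k (h y))"
    if "x \<in> pts P" "y \<in> pts P" "0 \<le> B" "near P B x y" "(L * K) * B \<le> B'" for x y B B'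
    using that L(2)[of "h x" "h y" "K * B" B'] K(2)[of x y B "K * B"] K(1) lip_map_pts[OF h]
    by (simp add: mult.assoc)
  moreover have "L * K > 0" using K L by simp
  ultimately show ?thesis
    using h k unfolding lip_map_def by (auto simp: image_subset_iff intro!: exI[of _ "L * K"])
qed

lemma lipeq_sym: "lipeq P Q \<Longrightarrow> lipeq Q P"
  unfolding lipeq_def by blast

lemma lipeq_trans [trans]:
  assumes "lipeq P Q" "lipeq Q R"
  shows "lipeq P R"
proof -
  obtain h k where hk: "lip_map P Q h" "lip_map Q P k" "\<forall>x\<in>pts P. k (h x) = x" "\<forall>y\<in>pts Q. h (k y) = y"
    using assms(1) unfolding lipeq_def by blast
  obtain h' k' where hk': "lip_map Q R h'" "lip_map R Q k'" "\<forall>x\<in>pts Q. k' (h' x) = x" "\<forall>y\<in>pts R. h' (k' y) = y"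
    using assms(2) unfolding lipeq_def by blast
  show ?thesis
    unfolding lipeq_def
    by (rule exI[of _ "h' \<circ> h"], rule exI[of _ "k \<circ> k'"])
      (use hk hk' in \<open>auto intro: lip_map_comp dest: lip_map_pts\<close>)
qed

lemma lipeq_refl: "gauge_ok P \<Longrightarrow> lipeq P P"
  unfolding lipeq_def
  by (rule exI[of _ id], rule exI[of _ id]) (auto intro!: lip_mapI[where K = 1])

lemma lip_map_gprod:
  assumes h: "lip_map P Q h" and k: "lip_map P' Q' k"
  shows "lip_map (gprod P P') (gprod Q Q') (map_prod h k)"
proof -
  obtain K where K: "K > 0" "\<And>x y B B'. x \<in> pts P \<Longrightarrow> y \<in> pts P \<Longrightarrow> 0 \<le> B \<Longrightarrow> near P B x y \<Longrightarrow>
    K * B \<le> B' \<Longrightarrow> near Q B' (h x) (h y)" using h by (metis lip_mapE)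
  obtain L where L: "L > 0" "\<And>x y B B'. x \<in> pts P' \<Longrightarrow> y \<in> pts P' \<Longrightarrow> 0 \<le> B \<Longrightarrow> near P' B x y \<Longrightarrow>
    L * B \<le> B' \<Longrightarrow> near Q' B' (k x) (k y)" using k by (metis lip_mapE)
  have *: "K * B \<le> B' \<and> L * B \<le> B'" if "0 \<le> B" "(max K L) * B \<le> B'" for B B'
    using mult_right_mono[of K "max K L" B] mult_right_mono[of L "max K L" B] that by auto
  show ?thesis
    unfolding lip_map_def
  proof (intro conjI exI[of _ "max K L"] ballI allI impI)
    show "0 < max K L" using K by auto
    fix x y B B'
    assume "x \<in> pts (gprod P P')" "y \<in> pts (gprod P P')" "0 \<le> B" "near (gprod P P') B x y" "max K L * B \<le> B'"
    then show "near (gprod Q Q') B' (map_prod h k x) (map_prod h k y)"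
      using *[of B B'] by (auto intro: K(2) L(2))
  qed (use h k in \<open>auto simp: lip_map_def\<close>)
qed

lemma lipeq_gprod:
  assumes "lipeq P Q" "lipeq P' Q'"
  shows "lipeq (gprod P P') (gprod Q Q')"
proof -
  obtain h k where hk: "lip_map P Q h" "lip_map Q P k" "\<forall>x\<in>pts P. k (h x) = x" "\<forall>y\<in>pts Q. h (k y) = y"
    using assms(1) unfolding lipeq_def by blast
  obtain h' k' where hk': "lip_map P' Q' h'" "lip_map Q' P' k'" "\<forall>x\<in>pts P'. k' (h' x) = x" "\<forall>y\<in>pts Q'. h' (k' y) = y"
    using assms(2) unfolding lipeq_def by blast
  show ?thesis
    unfolding lipeq_def
    by (rule exI[of _ "map_prod h h'"], rule exI[of _ "map_prod k k'"])
      (use hk hk' in \<open>auto intro: lip_map_gprod\<close>)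
qed

text \<open>A coordinate within \<open>e / K\<close> of the base point is sent within
  \<open>e\<close> of the base point, because \<open>h\<close> preserves base points; so the
  exceptional index sets stay finite.\<close>

lemma lip_map_gc0:
  assumes h: "lip_map P Q h" and P: "gauge_ok P"
  shows "lip_map (gc0 P) (gc0 Q) (\<lambda>x. h \<circ> x)"
proof -
  obtain K where K: "K > 0" "\<And>x y B B'. x \<in> pts P \<Longrightarrow> y \<in> pts P \<Longrightarrow> 0 \<le> B \<Longrightarrow> near P B x y \<Longrightarrow>
    K * B \<le> B' \<Longrightarrow> near Q B' (h x) (h y)" using h by (metis lip_mapE)
  have fin: "finite {n. \<not> near Q e (h (x n)) (base Q)}"
    if x: "\<forall>n. x n \<in> pts P" "\<forall>e>0. finite {n. \<not> near P e (x n) (base P)}" and e: "e > 0" for x and e :: real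
  proof (rule finite_subset)
    have "near Q e (h (x n)) (base Q)" if "near P (e / K) (x n) (base P)" for n
      using K(2)[of "x n" "base P" "e / K" e] that x e K(1) gauge_base[OF P] lip_map_base[OF h] by simp
    then show "{n. \<not> near Q e (h (x n)) (base Q)} \<subseteq> {n. \<not> near P (e / K) (x n) (base P)}" by blast
    show "finite {n. \<not> near P (e / K) (x n) (base P)}" using x e K by simp
  qed
  show ?thesis
    unfolding lip_map_def
  proof (intro conjI exI[of _ K] ballI allI impI)
    show "(\<lambda>x. h \<circ> x) ` pts (gc0 P) \<subseteq> pts (gc0 Q)"
      using fin lip_map_pts[OF h] by auto
  qed (use K lip_map_base[OF h] in \<open>auto simp: o_def intro!: K(2)\<close>)
qed

lemma lipeq_gc0:
  assumes "lipeq P Q" "gauge_ok P" "gauge_ok Q"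
  shows "lipeq (gc0 P) (gc0 Q)"
proof -
  obtain h k where hk: "lip_map P Q h" "lip_map Q P k" "\<forall>x\<in>pts P. k (h x) = x" "\<forall>y\<in>pts Q. h (k y) = y"
    using assms(1) unfolding lipeq_def by blast
  show ?thesis
    unfolding lipeq_def
    by (rule exI[of _ "\<lambda>x. h \<circ> x"], rule exI[of _ "\<lambda>x. k \<circ> x"])
      (use hk assms in \<open>auto intro!: lip_map_gc0 simp: fun_eq_iff\<close>)
qed

lemma lipeq_gprod_comm:
  assumes "gauge_ok P" "gauge_ok Q"
  shows "lipeq (gprod P Q) (gprod Q P)"
  unfolding lipeq_def
  by (rule exI[of _ prod.swap], rule exI[of _ prod.swap])
    (use assms in \<open>auto intro!: lip_mapI[where K = 1] gauge_ok_gprod\<close>)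

lemma lipeq_gprod_assoc:
  assumes "gauge_ok P" "gauge_ok Q" "gauge_ok R"
  shows "lipeq (gprod (gprod P Q) R) (gprod P (gprod Q R))"
  unfolding lipeq_def
  by (rule exI[of _ "\<lambda>((x, y), z). (x, (y, z))"], rule exI[of _ "\<lambda>(x, (y, z)). ((x, y), z)"])
    (use assms in \<open>auto intro!: lip_mapI[where K = 1] gauge_ok_gprod\<close>)

lemma lipeq_gc0_gprod:
  assumes P: "gauge_ok P" and Q: "gauge_ok Q"
  shows "lipeq (gc0 (gprod P Q)) (gprod (gc0 P) (gc0 Q))"
proof -
  have fin: "finite {n. \<not> (A n \<and> B n)} \<longleftrightarrow> finite {n. \<not> A n} \<and> finite {n. \<not> B n}" for A B :: "nat \<Rightarrow> bool"
  proof -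
    have "{n. \<not> (A n \<and> B n)} = {n. \<not> A n} \<union> {n. \<not> B n}" by auto
    then show ?thesis by simp
  qed
  show ?thesis
    unfolding lipeq_def
    by (rule exI[of _ "\<lambda>x. (fst \<circ> x, snd \<circ> x)"], rule exI[of _ "\<lambda>(x, y) n. (x n, y n)"])
      (use fin P Q in \<open>auto intro!: lip_mapI[where K = 1] gauge_ok_gprod gauge_ok_gc0 simp: mem_Times_iff\<close>)
qed

lemma lipeq_gc0_split:
  assumes P: "gauge_ok P"
  shows "lipeq (gc0 P) (gprod P (gc0 P))"
proof -
  have fin1: "finite {n. R (x (Suc n))}" if "finite {n. R (x n)}" for R and x :: "nat \<Rightarrow> 'a"
    using finite_vimageI[OF that, of Suc] by (simp add: vimage_def)
  have fin2: "finite {n. R (case_nat a x n)}" if "finite {n. R (x n)}" for R a and x :: "nat \<Rightarrow> 'a"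
  proof (rule finite_subset)
    show "{n. R (case_nat a x n)} \<subseteq> insert 0 (Suc ` {n. R (x n)})"
    proof
      fix n assume "n \<in> {n. R (case_nat a x n)}"
      then show "n \<in> insert 0 (Suc ` {n. R (x n)})" by (cases n) auto
    qed
    show "finite (insert 0 (Suc ` {n. R (x n)}))" using that by simp
  qed
  show ?thesis
    unfolding lipeq_def
  proof (intro exI conjI)
    show "lip_map (gc0 P) (gprod P (gc0 P)) (\<lambda>x. (x 0, x \<circ> Suc))"
      by (rule lip_mapI[where K = 1])
        (use P in \<open>auto intro!: gauge_ok_gprod gauge_ok_gc0 fin1[where R = "\<lambda>y. \<not> near P _ y (base P)"]\<close>)
    show "lip_map (gprod P (gc0 P)) (gc0 P) (\<lambda>(a, x). case_nat a x)"
      by (rule lip_mapI[where K = 1])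
        (use P in \<open>auto intro!: gauge_ok_gc0 fin2[where R = "\<lambda>y. \<not> near P _ y (base P)"] split: nat.splits\<close>)
  qed (auto split: nat.splits)
qed

text \<open>Reindexing along \<open>prod_encode\<close>. All but finitely many rows of the double
  sequence are within \<open>e\<close> of the base point as a whole, and each of the others has only
  finitely many exceptional entries.\<close>

lemma lipeq_gc0_gc0:
  assumes P: "gauge_ok P"
  shows "lipeq (gc0 (gc0 P)) (gc0 P)"
proof -
  have fin1: "finite {n. R (x (fst (prod_decode n)) (snd (prod_decode n)))}"
    if fin: "finite {i. \<not> (\<forall>j. \<not> R (x i j))}" "\<And>i. finite {j. R (x i j)}" for R and x :: "nat \<Rightarrow> nat \<Rightarrow> 'a"
  proof (rule finite_subset)
    show "{n. R (x (fst (prod_decode n)) (snd (prod_decode n)))} \<subseteq>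
            prod_encode ` (SIGMA i:{i. \<not> (\<forall>j. \<not> R (x i j))}. {j. R (x i j)})"
    proof
      fix n assume n: "n \<in> {n. R (x (fst (prod_decode n)) (snd (prod_decode n)))}"
      obtain i j where ij: "prod_decode n = (i, j)" by (cases "prod_decode n")
      then have "n = prod_encode (i, j)" by (metis prod_decode_inverse)
      then show "n \<in> prod_encode ` (SIGMA i:{i. \<not> (\<forall>j. \<not> R (x i j))}. {j. R (x i j)})"
        using n by auto
    qed
    show "finite (prod_encode ` (SIGMA i:{i. \<not> (\<forall>j. \<not> R (x i j))}. {j. R (x i j)}))"
      using fin by (intro finite_imageI finite_SigmaI)
  qed
  have fin2: "finite {j. R (y (prod_encode (i, j)))}" "finite {i. \<exists>j. R (y (prod_encode (i, j)))}"
    if fin: "finite {n. R (y n)}" for R i and y :: "nat \<Rightarrow> 'a"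
  proof -
    show "finite {j. R (y (prod_encode (i, j)))}"
      using finite_vimageI[OF fin, of "\<lambda>j. prod_encode (i, j)"] by (simp add: vimage_def inj_on_def)
    show "finite {i. \<exists>j. R (y (prod_encode (i, j)))}"
    proof (rule finite_subset)
      show "{i. \<exists>j. R (y (prod_encode (i, j)))} \<subseteq> (\<lambda>n. fst (prod_decode n)) ` {n. R (y n)}"
        by (force simp: image_iff)
    qed (use fin in simp)
  qed
  show ?thesis
    unfolding lipeq_def
  proof (intro exI conjI)
    show "lip_map (gc0 (gc0 P)) (gc0 P) (\<lambda>x n. x (fst (prod_decode n)) (snd (prod_decode n)))"
      by (rule lip_mapI[where K = 1])
        (use P in \<open>auto intro!: gauge_ok_gc0 fin1[where R = "\<lambda>y. \<not> near P _ y (base P)"]\<close>)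
    show "lip_map (gc0 P) (gc0 (gc0 P)) (\<lambda>y i j. y (prod_encode (i, j)))"
      by (rule lip_mapI[where K = 1])
        (use P in \<open>auto intro!: gauge_ok_gc0 fin2[where R = "\<lambda>y. \<not> near P _ y (base P)"]\<close>)
  qed (auto simp: fun_eq_iff)
qed

text \<open>Write U for \<open>gc0 P\<close>. Then U = c0(U) = c0(X) x c0(V), and splitting one term
  off c0(X) gives U = X x U. On the other side X = U x W = U x U x W = U x X. The two products
  coincide, so no factor ever has to be cancelled.\<close>

lemma lipeq_pelczynski:
  assumes P: "gauge_ok P" and X: "gauge_ok X" and V: "gauge_ok V" and W: "gauge_ok W"
    and XV: "lipeq (gprod X V) (gc0 P)" and UW: "lipeq X (gprod (gc0 P) W)"
  shows "lipeq X (gc0 P)"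
proof -
  let ?U = "gc0 P"
  note ok = P X V W gauge_ok_gprod gauge_ok_gc0
  have UU: "lipeq ?U (gprod ?U ?U)"
    using lipeq_trans[OF lipeq_sym[OF lipeq_gc0_gc0[OF P]]
      lipeq_trans[OF lipeq_gc0_split[OF gauge_ok_gc0[OF P]]
        lipeq_gprod[OF lipeq_refl[OF gauge_ok_gc0[OF P]] lipeq_gc0_gc0[OF P]]]] .
  have c0: "lipeq ?U (gprod (gc0 X) (gc0 V))"
  proof -
    have "lipeq ?U (gc0 ?U)" by (intro lipeq_sym[OF lipeq_gc0_gc0] ok)
    also have "lipeq (gc0 ?U) (gc0 (gprod X V))"
      by (intro lipeq_gc0 lipeq_sym[OF XV] ok)
    also have "lipeq (gc0 (gprod X V)) (gprod (gc0 X) (gc0 V))"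
      by (intro lipeq_gc0_gprod ok)
    finally show ?thesis .
  qed
  have "lipeq ?U (gprod (gprod X (gc0 X)) (gc0 V))"
    using c0 by (rule lipeq_trans) (intro lipeq_gprod lipeq_gc0_split lipeq_refl ok)
  also have "lipeq \<dots> (gprod X (gprod (gc0 X) (gc0 V)))"
    by (intro lipeq_gprod_assoc ok)
  also have "lipeq \<dots> (gprod X ?U)"
    by (intro lipeq_gprod lipeq_refl lipeq_sym[OF c0] ok)
  finally have U: "lipeq ?U (gprod X ?U)" .
  have "lipeq X (gprod (gprod ?U ?U) W)"
    using UW by (rule lipeq_trans) (intro lipeq_gprod UU lipeq_refl ok)
  also have "lipeq \<dots> (gprod ?U (gprod ?U W))"
    by (intro lipeq_gprod_assoc ok)
  also have "lipeq \<dots> (gprod ?U X)"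
    by (intro lipeq_gprod lipeq_sym[OF UW] lipeq_refl ok)
  also have "lipeq \<dots> (gprod X ?U)"
    by (intro lipeq_gprod_comm ok)
  also have "lipeq \<dots> ?U"
    by (rule lipeq_sym[OF U])
  finally show ?thesis .
qed

section \<open>Spaces of continuous functions\<close>

definition fsp :: "('i \<Rightarrow> real) set \<Rightarrow> ('i \<Rightarrow> real) gspace" where
  "fsp S = GSpace S (\<lambda>B f g. \<forall>i. \<bar>f i - g i\<bar> \<le> B) (\<lambda>_. 0)"

lemma fsp_sel [simp]: "pts (fsp S) = S" "base (fsp S) = (\<lambda>_. 0)"
  "near (fsp S) B f g \<longleftrightarrow> (\<forall>i. \<bar>f i - g i\<bar> \<le> B)"
  by (simp_all add: fsp_def)

lemma gauge_ok_fsp: "(\<lambda>_. 0) \<in> S \<Longrightarrow> gauge_ok (fsp S)"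
  by (auto simp: gauge_ok_def intro: order_trans)

text \<open>Extension by zero outside \<open>K\<close> makes the functions honest values of a function type, so that neither
  equality nor the distance has to be relativized to \<open>K\<close>.\<close>

definition CF :: "'x::topological_space set \<Rightarrow> 'x set \<Rightarrow> ('x \<Rightarrow> real) set" where
  "CF K F = {f. continuous_on K f \<and> (\<forall>x. x \<notin> K - F \<longrightarrow> f x = 0)}"

lemma zero_in_CF [simp]: "(\<lambda>_. 0) \<in> CF K F"
  by (auto simp: CF_def)

lemma gauge_ok_CF [simp]: "gauge_ok (fsp (CF K F))"
  by (simp add: gauge_ok_fsp)

lemma CF_add: "f \<in> CF K F \<Longrightarrow> g \<in> CF K F \<Longrightarrow> (\<lambda>x. f x + g x) \<in> CF K F"
  and CF_diff: "f \<in> CF K F \<Longrightarrow> g \<in> CF K F \<Longrightarrow> (\<lambda>x. f x - g x) \<in> CF K F"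
  by (auto simp: CF_def intro!: continuous_intros)

text \<open>A linear contraction with a Lipschitz, not necessarily linear, right inverse already
  splits off its kernel.\<close>

lemma lipeq_split:
  fixes E :: "('i \<Rightarrow> real) set" and Y :: "('j \<Rightarrow> real) set"
  assumes E0: "(\<lambda>_. 0) \<in> E"
    and E_add: "\<And>f g. f \<in> E \<Longrightarrow> g \<in> E \<Longrightarrow> (\<lambda>i. f i + g i) \<in> E"
    and E_diff: "\<And>f g. f \<in> E \<Longrightarrow> g \<in> E \<Longrightarrow> (\<lambda>i. f i - g i) \<in> E"
    and PY: "\<And>f. f \<in> E \<Longrightarrow> P f \<in> Y"
    and P_diff: "\<And>f g. f \<in> E \<Longrightarrow> g \<in> E \<Longrightarrow> P (\<lambda>i. f i - g i) = (\<lambda>j. P f j - P g j)"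
    and P_le: "\<And>f B j. f \<in> E \<Longrightarrow> \<forall>i. \<bar>f i\<bar> \<le> B \<Longrightarrow> \<bar>P f j\<bar> \<le> B"
    and sE: "\<And>y. y \<in> Y \<Longrightarrow> s y \<in> E"
    and Ps: "\<And>y. y \<in> Y \<Longrightarrow> P (s y) = y"
    and s_lip: "\<And>y y' B i. y \<in> Y \<Longrightarrow> y' \<in> Y \<Longrightarrow> 0 \<le> B \<Longrightarrow> \<forall>j. \<bar>y j - y' j\<bar> \<le> B \<Longrightarrow> \<bar>s y i - s y' i\<bar> \<le> B"
    and s0: "s (\<lambda>_. 0) = (\<lambda>_. 0)"
  shows "lipeq (fsp E) (gprod (fsp Y) (fsp {f \<in> E. P f = (\<lambda>_. 0)}))"
proof -
  let ?Z = "{f \<in> E. P f = (\<lambda>_. 0)}"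
  have P0: "P (\<lambda>_. 0) = (\<lambda>_. 0)"
    using P_diff[OF E0 E0] by simp
  have Y0: "(\<lambda>_. 0) \<in> Y" using PY[OF E0] P0 by simp
  have P_lip: "\<bar>P f j - P g j\<bar> \<le> B" if "f \<in> E" "g \<in> E" "\<forall>i. \<bar>f i - g i\<bar> \<le> B" for f g B j
    using P_le[OF E_diff[OF that(1,2)] that(3), of j] P_diff[OF that(1,2)] by simp
  \<comment> \<open>Subtracting the kernel element \<open>k\<close> inside \<open>P\<close> reduces
    this to \<open>Ps\<close>.\<close>
  have P_add: "P (\<lambda>i. s y i + k i) = y" if "y \<in> Y" "k \<in> ?Z" for y k
    using P_diff[of "\<lambda>i. s y i + k i" k] E_add[of "s y" k] sE[of y] Ps[of y] that by auto
  have okY: "gauge_ok (gprod (fsp Y) (fsp ?Z))"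
    using Y0 E0 P0 by (intro gauge_ok_gprod gauge_ok_fsp) auto
  show ?thesis
    unfolding lipeq_def
  proof (intro exI conjI)
    show "lip_map (fsp E) (gprod (fsp Y) (fsp ?Z)) (\<lambda>f. (P f, \<lambda>i. f i - s (P f) i))"
    \<comment> \<open>The kernel component is \<open>f\<close> minus \<open>s (P f)\<close>, and
      each of the two terms moves by at most \<open>B\<close>.\<close>
    proof (rule lip_mapI[where K = 2])
      fix f g B assume fg: "f \<in> pts (fsp E)" "g \<in> pts (fsp E)" "0 \<le> B" "near (fsp E) B f g"
      then have P: "\<bar>P f j - P g j\<bar> \<le> B" for j using P_lip[of f g B] by simp
      then have "\<bar>s (P f) i - s (P g) i\<bar> \<le> B" for i
        using s_lip[of "P f" "P g" B i] PY fg by simp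
      with fg(4) have "\<bar>f i - s (P f) i - (g i - s (P g) i)\<bar> \<le> 2 * B" for i
        by (smt (verit, best) fsp_sel(3))
      moreover have "\<bar>P f j - P g j\<bar> \<le> 2 * B" for j using P[of j] fg(3) by linarith
      ultimately show "near (gprod (fsp Y) (fsp ?Z)) (2 * B) (P f, \<lambda>i. f i - s (P f) i) (P g, \<lambda>i. g i - s (P g) i)"
        by simp
    qed (use okY P0 s0 PY E_diff sE P_diff Ps in auto)
    show "lip_map (gprod (fsp Y) (fsp ?Z)) (fsp E) (\<lambda>(y, k) i. s y i + k i)"
    proof (rule lip_mapI[where K = 2])
      fix u v B assume uv: "u \<in> pts (gprod (fsp Y) (fsp ?Z))" "v \<in> pts (gprod (fsp Y) (fsp ?Z))" "0 \<le> B"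
        "near (gprod (fsp Y) (fsp ?Z)) B u v"
      obtain y k y' k' where uv': "u = (y, k)" "v = (y', k')" by (cases u, cases v) 
      have *: "\<bar>s y i - s y' i\<bar> \<le> B" "\<bar>k i - k' i\<bar> \<le> B" for i
        using s_lip[of y y' B i] uv uv' by auto
      then have "\<bar>s y i + k i - (s y' i + k' i)\<bar> \<le> 2 * B" for i
        using *[of i] by linarith
      then show "near (fsp E) (2 * B) ((\<lambda>(y, k) i. s y i + k i) u) ((\<lambda>(y, k) i. s y i + k i) v)"
        by (simp add: uv')
    qed (use E0 s0 sE E_add in \<open>auto intro: gauge_ok_fsp\<close>)
    show "\<forall>y\<in>pts (gprod (fsp Y) (fsp ?Z)).
       (P ((\<lambda>(y, k) i. s y i + k i) y), \<lambda>i. (\<lambda>(y, k) i. s y i + k i) y i - s (P ((\<lambda>(y, k) i. s y i + k i) y)) i) = y"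
      using P_add by auto
  qed auto
qed

text \<open>Hausdorff's formula for the Tietze extension: unlike an arbitrary extension, it depends on
  \<open>g\<close> in a nonexpansive way.\<close>

definition hext :: "'x::metric_space set \<Rightarrow> ('x \<Rightarrow> real) \<Rightarrow> 'x \<Rightarrow> real" where
  "hext F g x = (if x \<in> F then g x else if F = {} then 0
     else (INF a\<in>F. g a + dist x a / infdist x F) - 1)"

lemma infdist_compact_attained:
  assumes "compact F" "F \<noteq> {}"
  obtains b where "b \<in> F" "infdist x F = dist x b"
proof -
  have "continuous_on F (dist x)" by (intro continuous_intros)
  then obtain b where b: "b \<in> F" "\<forall>a\<in>F. dist x b \<le> dist x a"
    using continuous_attains_inf[OF assms] by blast
  then have "infdist x F = dist x b"
    unfolding infdist_notempty[OF assms(2)] by (intro cInf_eq_minimum) auto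
  then show ?thesis using that b by blast
qed

text \<open>Compactness turns the infimum into a minimum, so that two extensions can be compared by
  inserting the minimizer of one into the formula of the other.\<close>

lemma hext_attained:
  assumes F: "compact F" "F \<noteq> {}" and g: "continuous_on F g" and x: "x \<notin> F"
  obtains a where "a \<in> F" "hext F g x = g a + dist x a / infdist x F - 1"
    "\<And>b. b \<in> F \<Longrightarrow> hext F g x \<le> g b + dist x b / infdist x F - 1"
proof -
  have "infdist x F > 0"
    using infdist_pos_not_in_closed[of F x] F x compact_imp_closed by blast
  then have "continuous_on F (\<lambda>a. g a + dist x a / infdist x F)"
    using g by (intro continuous_intros) auto
  then obtain a where a: "a \<in> F" "\<forall>b\<in>F. g a + dist x a / infdist x F \<le> g b + dist x b / infdist x F"
    using continuous_attains_inf[OF F, of "\<lambda>a. g a + dist x a / infdist x F"] by blast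
  then have "(INF a\<in>F. g a + dist x a / infdist x F) = g a + dist x a / infdist x F"
    by (intro cInf_eq_minimum) auto
  then have "hext F g x = g a + dist x a / infdist x F - 1"
    using x F by (simp add: hext_def)
  then show ?thesis using that[of a] a by simp
qed

text \<open>The distance quotients are the same for both functions and cancel when each formula is
  evaluated at the minimizer of the other.\<close>

lemma hext_nonexpansive:
  assumes F: "compact F" and g: "continuous_on F g" "continuous_on F g'"
    and B: "0 \<le> B" "\<forall>a\<in>F. \<bar>g a - g' a\<bar> \<le> B"
  shows "\<bar>hext F g x - hext F g' x\<bar> \<le> B"
proof (cases "x \<in> F \<or> F = {}")
  case True
  then show ?thesis using B by (auto simp: hext_def)
next
  case False
  then have F': "F \<noteq> {}" "x \<notin> F" by auto
  obtain a where a: "a \<in> F" "hext F g x = g a + dist x a / infdist x F - 1"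
    "\<And>b. b \<in> F \<Longrightarrow> hext F g x \<le> g b + dist x b / infdist x F - 1"
    using hext_attained[OF F F'(1) g(1) F'(2)] by metis
  obtain a' where a': "a' \<in> F" "hext F g' x = g' a' + dist x a' / infdist x F - 1"
    "\<And>b. b \<in> F \<Longrightarrow> hext F g' x \<le> g' b + dist x b / infdist x F - 1"
    using hext_attained[OF F F'(1) g(2) F'(2)] by metis
  show ?thesis
    using a(2) a'(2) a(3)[OF a'(1)] a'(3)[OF a(1)] bspec[OF B(2) a(1)] bspec[OF B(2) a'(1)]
    by linarith
qed

text \<open>The quotient of \<open>dist\<close> by \<open>infdist\<close> is at least 1, with
  equality at a nearest point; the 1 subtracted in \<open>hext\<close> compensates for this
  minimum.\<close>

lemma hext_zero:
  assumes F: "compact F"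
  shows "hext F (\<lambda>_. 0) x = 0"
proof (cases "x \<in> F \<or> F = {}")
  case True
  then show ?thesis by (auto simp: hext_def)
next
  case False
  then have F': "F \<noteq> {}" "x \<notin> F" by auto
  have r: "infdist x F > 0"
    using infdist_pos_not_in_closed[of F x] F F' compact_imp_closed by blast
  obtain a where a: "a \<in> F" "hext F (\<lambda>_. 0) x = 0 + dist x a / infdist x F - 1"
    "\<And>b. b \<in> F \<Longrightarrow> hext F (\<lambda>_. 0) x \<le> 0 + dist x b / infdist x F - 1"
    using hext_attained[OF F F'(1) continuous_on_const F'(2)] by metis
  obtain b where b: "b \<in> F" "infdist x F = dist x b"
    using infdist_compact_attained[OF F F'(1)] by blast
  have "dist x a / infdist x F \<ge> 1" using infdist_le[OF a(1), of x] r by simp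
  moreover have "dist x b / infdist x F = 1" using b r by simp
  ultimately show ?thesis using a b by fastforce
qed

lemma hext_isCont_outside:
  assumes F: "compact F" "F \<noteq> {}" and g: "continuous_on F g" and x: "x \<notin> F"
  shows "isCont (hext F g) x"
proof -
  have cl: "closed F" using F compact_imp_closed by blast
  have r: "infdist y F > 0" if "y \<notin> F" for y
    using infdist_pos_not_in_closed[of F y] F that cl by blast
  obtain D where D: "\<And>a. a \<in> F \<Longrightarrow> dist x a \<le> D"
    using compact_imp_bounded[OF F(1)] by (metis bounded_any_center)
  have D0: "D \<ge> 0" using F(2) D zero_le_dist order_trans by (metis ex_in_conv)
  \<comment> \<open>Bounds the change of the quotient from \<open>x\<close> to \<open>y\<close>
    simultaneously for all points of \<open>F\<close>: the first term accounts for the numerator,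
    the second for the denominator. Exchanging minimizers then transfers the bound to the
    infima.\<close>
  define e where "e y = dist x y / infdist y F + D * \<bar>1 / infdist y F - 1 / infdist x F\<bar>" for y
  have u: "\<bar>dist y a / infdist y F - dist x a / infdist x F\<bar> \<le> e y" if a: "a \<in> F" and y: "y \<notin> F" for y a
  proof -
    have "dist y a / infdist y F - dist x a / infdist x F =
        (dist y a - dist x a) / infdist y F + dist x a * (1 / infdist y F - 1 / infdist x F)"
      using r[OF y] r[OF x] by (simp add: field_simps)
    moreover have "\<bar>(dist y a - dist x a) / infdist y F\<bar> \<le> dist x y / infdist y F"
      using r[OF y] abs_dist_diff_le[of y a x] by (simp add: divide_simps dist_commute)
    moreover have "\<bar>dist x a * (1 / infdist y F - 1 / infdist x F)\<bar> \<le> D * \<bar>1 / infdist y F - 1 / infdist x F\<bar>"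
      unfolding abs_mult using D[OF a] by (intro mult_right_mono) auto
    ultimately show ?thesis unfolding e_def by linarith
  qed
  have le: "\<bar>hext F g y - hext F g x\<bar> \<le> e y" if y: "y \<notin> F" for y
  proof -
    obtain a where a: "a \<in> F" "hext F g x = g a + dist x a / infdist x F - 1"
      "\<And>b. b \<in> F \<Longrightarrow> hext F g x \<le> g b + dist x b / infdist x F - 1"
      using hext_attained[OF F g x] by metis
    obtain a' where a': "a' \<in> F" "hext F g y = g a' + dist y a' / infdist y F - 1"
      "\<And>b. b \<in> F \<Longrightarrow> hext F g y \<le> g b + dist y b / infdist y F - 1"
      using hext_attained[OF F g y] by metis
    show ?thesis
      using a(2) a'(2) a(3)[OF a'(1)] a'(3)[OF a(1)] u[OF a(1) y] u[OF a'(1) y] by linarith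
  qed
  have "isCont e x"
    unfolding e_def using r[OF x] by (intro continuous_intros) auto
  then have "(e \<longlongrightarrow> 0) (at x)" using isContD[of x e] by (simp add: e_def)
  moreover have "eventually (\<lambda>y. y \<notin> F) (at x)"
    using cl x by (metis Compl_iff eventually_at_topological open_Compl)
  then have "eventually (\<lambda>y. norm (hext F g y - hext F g x) \<le> e y) (at x)"
    by eventually_elim (use le in simp)
  ultimately have "((\<lambda>y. hext F g y - hext F g x) \<longlongrightarrow> 0) (at x)"
    by (rule Lim_null_comparison[rotated])
  then show ?thesis unfolding isCont_def by (simp add: LIM_zero_iff)
qed

text \<open>A nearest point gives the upper estimate. For the lower one, a minimizer near
  \<open>x\<close> has a value close to \<open>g x\<close>, while one far from \<open>x\<close> pays
  a quotient large enough to outweigh the oscillation of \<open>g\<close>.\<close>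

lemma hext_isCont_inside:
  assumes F: "compact F" and g: "continuous_on F g" and x: "x \<in> F"
  shows "isCont (hext F g) x"
proof -
  have F': "F \<noteq> {}" and cl: "closed F" using x F compact_imp_closed by auto
  obtain M where M: "\<And>a. a \<in> F \<Longrightarrow> \<bar>g a\<bar> \<le> M"
    using compact_imp_bounded[OF compact_continuous_image[OF g F]] unfolding bounded_iff by auto
  have M0: "M \<ge> 0" using M[OF x] by linarith
  show ?thesis
    unfolding continuous_at_eps_delta
  proof (intro allI impI)
    fix e :: real assume e: "e > 0"
    obtain d where d: "d > 0" "\<And>a. a \<in> F \<Longrightarrow> dist a x < d \<Longrightarrow> \<bar>g a - g x\<bar> < e / 2"
      using g x e unfolding continuous_on_iff dist_real_def by (meson half_gt_zero)
    \<comment> \<open>Chosen so that \<open>d - h\<close> equals \<open>(2 * M + 1) * h\<close>: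
      points at distance at least \<open>d\<close> from \<open>x\<close> then have a quotient of at
      least \<open>2 * M + 1\<close>, which lifts any value of \<open>g\<close> above
      \<open>g x\<close>.\<close>
    define h where "h = d / (2 * M + 2)"
    have h: "h > 0" using d M0 by (simp add: h_def)
    have h2: "2 * h \<le> d" using d M0 by (simp add: h_def field_simps)
    have "\<bar>hext F g y - hext F g x\<bar> < e" if y: "dist y x < h" for y
    proof (cases "y \<in> F")
      case True
      then show ?thesis using d(2)[of y] y h2 h x e by (auto simp: hext_def)
    next
      case False
      have r: "infdist y F > 0"
        using infdist_pos_not_in_closed[of F y] False F' cl by blast
      have ry: "infdist y F \<le> dist y x" using infdist_le[OF x] .
      obtain a where a: "a \<in> F" "hext F g y = g a + dist y a / infdist y F - 1"
        "\<And>b. b \<in> F \<Longrightarrow> hext F g y \<le> g b + dist y b / infdist y F - 1"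
        using hext_attained[OF F F' g False] by metis
      obtain b where b: "b \<in> F" "infdist y F = dist y b"
        using infdist_compact_attained[OF F F'] by blast
      have "dist b x < d"
        using dist_triangle3[of b x y] b(2) ry y h2 by (simp add: dist_commute)
      then have "\<bar>g b - g x\<bar> < e / 2" using d(2) b(1) by blast
      moreover have "hext F g y \<le> g b"
        using a(3)[OF b(1)] b(2) r by simp
      ultimately have upper: "hext F g y < g x + e" using e by linarith
      have lower: "hext F g y > g x - e"
      proof (cases "dist a x < d")
        case True
        then have "\<bar>g a - g x\<bar> < e / 2" using d(2) a(1) by blast
        moreover have "dist y a / infdist y F \<ge> 1" using infdist_le[OF a(1), of y] r by simp
        ultimately show ?thesis using a(2) e by linarith
      next
        case False
        have "dist y a \<ge> d - h"
          using False dist_triangle3[of a x y] y by (simp add: dist_commute)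
        moreover have "d - h = (2 * M + 1) * h" using M0 by (simp add: h_def field_simps)
        ultimately have "dist y a \<ge> (2 * M + 1) * infdist y F"
          using mult_left_mono[of "infdist y F" h "2 * M + 1"] ry y M0 by linarith
        then have "dist y a / infdist y F \<ge> 2 * M + 1" using r by (simp add: pos_le_divide_eq)
        then show ?thesis using a(2) M[OF a(1)] M[OF x] e by linarith
      qed
      show ?thesis using upper lower x by (simp add: hext_def abs_less_iff)
    qed
    then show "\<exists>d>0. \<forall>x'. dist x' x < d \<longrightarrow> dist (hext F g x') (hext F g x) < e"
      using h unfolding dist_real_def by blast
  qed
qed

lemma continuous_on_hext:
  assumes "compact F" "continuous_on F g"
  shows "continuous_on S (hext F g)"
proof (cases "F = {}")
  case True
  then have "hext F g = (\<lambda>_. 0)" by (auto simp: hext_def)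
  then show ?thesis by simp
next
  case False
  then show ?thesis
    using hext_isCont_inside[OF assms] hext_isCont_outside[OF assms(1) False assms(2)]
    by (intro continuous_at_imp_continuous_on) blast
qed

text \<open>\<open>lipeq_split\<close> for the restriction to \<open>F\<close>, with Hausdorff's
  extension as right inverse. As \<open>L\<close> lies in \<open>F\<close>, the kernel of the
  restriction is all of \<open>CF K F\<close>.\<close>

lemma lipeq_CF_restrict:
  fixes K :: "'a::metric_space set"
  assumes K: "compact K" and F: "closed F" "F \<subseteq> K" and L: "L \<subseteq> F"
  shows "lipeq (fsp (CF K L)) (gprod (fsp (CF F L)) (fsp (CF K F)))"
proof -
  have cF: "compact F" using K F by (metis compact_Int_closed inf.absorb_iff2 inf_commute)
  define P where "P f = (\<lambda>x. if x \<in> F then f x else 0)" for f :: "'a \<Rightarrow> real"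
  define s where "s g = (\<lambda>x. if x \<in> K then hext F g x else 0)" for g :: "'a \<Rightarrow> real"
  have Z: "CF K F = {f \<in> CF K L. P f = (\<lambda>_. 0)}"
    using F L unfolding CF_def P_def fun_eq_iff by auto
  show ?thesis
    unfolding Z
  proof (rule lipeq_split[where s = s])
    fix f assume "f \<in> CF K L"
    then show "P f \<in> CF F L"
      using F by (auto simp: CF_def P_def intro: continuous_on_subset
          cong: continuous_on_cong)
  next
    fix g assume g: "g \<in> CF F L"
    then have "continuous_on K (hext F g)"
      using continuous_on_hext[OF cF] by (auto simp: CF_def)
    then have "continuous_on K (s g)" by (simp add: s_def cong: continuous_on_cong)
    then show "s g \<in> CF K L"
      using g L F by (auto simp: CF_def s_def hext_def)
    show "P (s g) = g"
      using g F by (auto simp: P_def s_def hext_def CF_def fun_eq_iff)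
  next
    fix y y' B i assume "y \<in> CF F L" "y' \<in> CF F L" "0 \<le> B" "\<forall>j. \<bar>y j - y' j\<bar> \<le> B"
    then show "\<bar>s y i - s y' i\<bar> \<le> B"
      using hext_nonexpansive[OF cF, of y y' B i] by (auto simp: s_def CF_def)
  next
    fix f :: "'a \<Rightarrow> real" and B j assume "\<forall>i. \<bar>f i\<bar> \<le> B"
    then show "\<bar>P f j\<bar> \<le> B" unfolding P_def by (smt (verit))
  qed (use hext_zero[OF cF] CF_add CF_diff in \<open>auto simp: P_def s_def\<close>)
qed

lemma lipeq_CF_homeomorphism:
  fixes A :: "'a::topological_space set" and D :: "'b::topological_space set"
  assumes "homeomorphism A D e e'"
  shows "lipeq (fsp (CF A {})) (fsp (CF D {}))"
proof -
  have e: "\<And>x. x \<in> A \<Longrightarrow> e' (e x) = x" "\<And>y. y \<in> D \<Longrightarrow> e (e' y) = y" "e ` A = D" "e' ` D = A"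
    "continuous_on A e" "continuous_on D e'"
    using assms unfolding homeomorphism_def by auto
  have "(\<lambda>y. if y \<in> D then f (e' y) else 0) \<in> CF D {}" if "f \<in> CF A {}" for f
  proof -
    have "continuous_on D (f \<circ> e')"
      using e that by (intro continuous_on_compose) (auto simp: CF_def)
    then show ?thesis by (auto simp: CF_def o_def cong: continuous_on_cong)
  qed
  moreover have "(\<lambda>x. if x \<in> A then f (e x) else 0) \<in> CF A {}" if "f \<in> CF D {}" for f
  proof -
    have "continuous_on A (f \<circ> e)"
      using e that by (intro continuous_on_compose) (auto simp: CF_def)
    then show ?thesis by (auto simp: CF_def o_def cong: continuous_on_cong)
  qed
  moreover have "f x = 0" if "f \<in> CF A {}" "x \<notin> A" for f x
    using that by (auto simp: CF_def)
  moreover have "f x = 0" if "f \<in> CF D {}" "x \<notin> D" for f x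
    using that by (auto simp: CF_def)
  moreover have "\<And>x. x \<in> A \<Longrightarrow> e x \<in> D" "\<And>y. y \<in> D \<Longrightarrow> e' y \<in> A"
    using e(3,4) by auto
  ultimately show ?thesis
    unfolding lipeq_def
    by (intro exI[of _ "\<lambda>f y. if y \<in> D then f (e' y) else 0"] exI[of _ "\<lambda>f x. if x \<in> A then f (e x) else 0"] conjI)
      (use e(1,2) in \<open>auto intro!: lip_mapI[where K = 1] simp: fun_eq_iff\<close>)
qed

text \<open>Zero on \<open>F\<close> and a function on \<open>D\<close> glue continuously because
  both sets are closed. This identifies the first factor of a restriction to the union with the
  functions on a Cantor set that avoids \<open>F\<close>.\<close>

lemma CF_Un_disjoint:
  assumes "closed F" "closed D" "F \<inter> D = {}"
  shows "CF (F \<union> D) F = CF D {}"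
proof
  show "CF (F \<union> D) F \<subseteq> CF D {}"
    by (auto simp: CF_def intro: continuous_on_subset)
  show "CF D {} \<subseteq> CF (F \<union> D) F"
  proof
    fix f assume f: "f \<in> CF D {}"
    have "continuous_on F f" 
      by (rule continuous_on_eq[OF continuous_on_const[of _ 0]]) (use f assms in \<open>auto simp: CF_def\<close>)
    then show "f \<in> CF (F \<union> D) F"
      using f assms by (auto simp: CF_def intro: continuous_on_closed_Un)
  qed
qed

section \<open>The Cantor space\<close>

definition cantor :: "(nat \<Rightarrow> real) set" where
  "cantor = {s. \<forall>n. s n = 0 \<or> s n = 1}"

text \<open>Tychonoff's theorem for function types; it serves both the Cantor space and the space of
  characters.\<close>

lemma compact_coordinatewise_bounded:
  fixes S :: "'i \<Rightarrow> 'b::topological_space set"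
  assumes "\<And>i. compact (S i)"
  shows "compact {f. \<forall>i. f i \<in> S i}"
proof -
  have "compactin (product_topology (\<lambda>_. euclidean) UNIV) (PiE UNIV S)"
    using assms by (simp add: compactin_PiE)
  moreover have "PiE UNIV S = {f. \<forall>i. f i \<in> S i}" by (auto simp: PiE_def Pi_def extensional_def)
  ultimately show ?thesis by (simp add: euclidean_product_topology)
qed

lemma compact_cantor: "compact cantor"
proof -
  have "cantor = {f. \<forall>i. f i \<in> {0, 1}}" by (auto simp: cantor_def)
  moreover have "compact {f :: nat \<Rightarrow> real. \<forall>i. f i \<in> {0, 1}}"
    by (rule compact_coordinatewise_bounded) simp
  ultimately show ?thesis by argo
qed

lemma zero_in_cantor [simp]: "(\<lambda>_. 0) \<in> cantor"
  by (simp add: cantor_def)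

lemma dist_lt_of_prefix:
  assumes "d > 0"
  shows "\<exists>n. \<forall>s t :: nat \<Rightarrow> real. (\<forall>i<n. s i = t i) \<longrightarrow> dist s t < d"
proof -
  obtain N where N: "(1 / 2 :: real) ^ N < d" using real_arch_pow_inv[of d "1/2"] assms by auto
  \<comment> \<open>The metric on functions weights the coordinates along \<open>from_nat\<close>.
    This is treated as an arbitrary enumeration, so the prefix must reach beyond the largest of its
    first values.\<close>
  define n where "n = Suc (Max ((from_nat :: nat \<Rightarrow> nat) ` {..N}))"
  have "dist s t < d" if st: "\<forall>i<n. s i = t i" for s t :: "nat \<Rightarrow> real"
  proof -
    have eq: "dist (s (from_nat k)) (t (from_nat k)) = 0" if "k \<le> N" for k
      using st that Max_ge[of "(from_nat :: nat \<Rightarrow> nat) ` {..N}" "from_nat k"] by (auto simp: n_def less_Suc_eq_le)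
    have "{dist (s (from_nat k)) (t (from_nat k)) | k. k \<le> N} = (\<lambda>k. dist (s (from_nat k)) (t (from_nat k))) ` {..N}"
      by auto
    also have "\<dots> = (\<lambda>_. 0) ` {..N}"
      using eq by (intro image_cong) auto
    also have "\<dots> = {0}" by auto
    finally have "{dist (s (from_nat k)) (t (from_nat k)) | k. k \<le> N} = {0}" .
    then show ?thesis using dist_fun_le_dist_first_terms[of s t N] N by simp
  qed
  then show ?thesis by blast
qed

text \<open>Uniform continuity without the metric: finitely many digits determine the value up to
  \<open>e\<close>.\<close>

lemma cantor_oscillation:
  assumes g: "continuous_on cantor g" and e: "(e :: real) > 0"
  shows "\<exists>n. \<forall>s\<in>cantor. \<forall>t\<in>cantor. (\<forall>i<n. s i = t i) \<longrightarrow> \<bar>g s - g t\<bar> < e"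
proof -
  have "uniformly_continuous_on cantor g"
    using compact_uniformly_continuous[OF g compact_cantor] .
  then obtain d where d: "d > 0" "\<And>s t. s \<in> cantor \<Longrightarrow> t \<in> cantor \<Longrightarrow> dist s t < d \<Longrightarrow> \<bar>g s - g t\<bar> < e"
    using e unfolding uniformly_continuous_on_def dist_real_def by (metis dist_commute)
  then show ?thesis using dist_lt_of_prefix[OF d(1)] by blast
qed

text \<open>Digits are 0 or 1, so convergence of a coordinate means that it is eventually equal to
  its limit.\<close>

lemma cantor_eventually_prefix:
  assumes s: "s \<in> cantor"
  shows "eventually (\<lambda>t. \<forall>i<n. t i = s i) (at s within cantor)"
proof -
  have "eventually (\<lambda>t. t i = s i) (at s within cantor)" for i
  proof -
    have "((\<lambda>t :: nat \<Rightarrow> real. t i) \<longlongrightarrow> s i) (at s within cantor)"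
      using continuous_on_subset[OF continuous_on_product_coordinates, of cantor i] s unfolding continuous_on_def by auto
    then have "eventually (\<lambda>t. dist (t i) (s i) < 1 / 2) (at s within cantor)"
      by (rule tendstoD) simp
    moreover have "eventually (\<lambda>t. t \<in> cantor) (at s within cantor)"
      by (simp add: eventually_at_filter)
    ultimately show ?thesis
    proof eventually_elim
      case (elim t)
      then have "t i = 0 \<or> t i = 1" "s i = 0 \<or> s i = 1" using s by (auto simp: cantor_def)
      then show ?case using elim(1) by (auto simp: dist_real_def)
    qed
  qed
  then have "eventually (\<lambda>t. \<forall>i\<in>{..<n}. t i = s i) (at s within cantor)"
    by (intro eventually_ball_finite) auto
  then show ?thesis by (simp add: Ball_def)
qed

text \<open>Parametrizes the clopen branch of the sequences whose first 1 has index
  \<open>n\<close>; on this branch \<open>cshift n\<close> is the inverse.\<close>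

definition ccons :: "nat \<Rightarrow> (nat \<Rightarrow> real) \<Rightarrow> nat \<Rightarrow> real" where
  "ccons n y = (\<lambda>i. if i < n then 0 else if i = n then 1 else y (i - Suc n))"

definition cshift :: "nat \<Rightarrow> (nat \<Rightarrow> real) \<Rightarrow> nat \<Rightarrow> real" where
  "cshift n s = (\<lambda>i. s (i + Suc n))"

lemma ccons_in: "y \<in> cantor \<Longrightarrow> ccons n y \<in> cantor"
  and cshift_in: "y \<in> cantor \<Longrightarrow> cshift n y \<in> cantor"
  by (auto simp: cantor_def ccons_def cshift_def)

lemma continuous_ccons: "continuous_on S (ccons n)"
proof (rule continuous_on_coordinatewise_then_product)
  fix i
  show "continuous_on S (\<lambda>y. ccons n y i)"
    using continuous_on_subset[OF continuous_on_product_coordinates, of S "i - Suc n"]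
    by (cases "i < n"; cases "i = n") (simp_all add: ccons_def)
qed

lemma continuous_cshift: "continuous_on S (cshift n)"
  unfolding cshift_def
  by (rule continuous_on_coordinatewise_then_product)
    (rule continuous_on_subset[OF continuous_on_product_coordinates subset_UNIV])

lemma cshift_ccons: "cshift n (ccons n y) = y"
  by (auto simp: cshift_def ccons_def)

lemma ccons_cshift:
  assumes "s \<in> cantor" "s n = 1" "\<And>i. i < n \<Longrightarrow> s i = 0"
  shows "ccons n (cshift n s) = s"
  using assms by (auto simp: cshift_def ccons_def fun_eq_iff)

text \<open>The complement of a point in the Cantor space is a countable disjoint union of clopen
  copies of the Cantor space.\<close>

lemma lipeq_cantor_gc0: "lipeq (fsp (CF cantor {\<lambda>_. 0})) (gc0 (fsp (CF cantor {})))"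
proof -
  define h where "h f = (\<lambda>n y. if y \<in> cantor then f (ccons n y) else 0)" for f :: "(nat \<Rightarrow> real) \<Rightarrow> real"
  define L where "L s = (LEAST n. s n \<noteq> 0)" for s :: "nat \<Rightarrow> real"
  define k where "k g = (\<lambda>s. if s \<in> cantor \<and> s \<noteq> (\<lambda>_. 0) then g (L s) (cshift (L s) s) else 0)"
    for g :: "nat \<Rightarrow> (nat \<Rightarrow> real) \<Rightarrow> real"
  have L1: "s (L s) \<noteq> 0" if s: "s \<noteq> (\<lambda>_. 0)" for s
  proof -
    obtain i where "s i \<noteq> 0" using s by auto
    then show ?thesis unfolding L_def by (rule LeastI)
  qed
  have L2: "s i = 0" if "i < L s" for s i
    using not_less_Least that unfolding L_def by blast
  have L_cong: "L t = L s" if s: "s \<noteq> (\<lambda>_. 0)" and t: "\<forall>i<Suc (L s). t i = s i" for s t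
    unfolding L_def[of t]
  proof (rule Least_equality)
    show "t (L s) \<noteq> 0" using t L1[OF s] by auto
    show "L s \<le> i" if "t i \<noteq> 0" for i
      using that t L2[of i s] by (metis less_SucI not_less)
  qed
  have L_ccons: "L (ccons n y) = n" for n y
    unfolding L_def by (intro Least_equality) (auto simp: ccons_def split: if_splits)
  have ccons_ne: "ccons n y \<noteq> (\<lambda>_. 0)" for n y
    unfolding ccons_def fun_eq_iff not_all by (intro exI[of _ n]) simp
  have hcont: "h f n \<in> CF cantor {}" if f: "f \<in> CF cantor {\<lambda>_. 0}" for f n
  proof -
    have "continuous_on cantor (f \<circ> ccons n)"
    proof (rule continuous_on_compose[OF continuous_ccons])
      show "continuous_on (ccons n ` cantor) f"
        using f ccons_in by (auto simp: CF_def intro: continuous_on_subset)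
    qed
    then have "continuous_on cantor (h f n)"
      by (simp add: h_def o_def cong: continuous_on_cong)
    then show ?thesis by (auto simp: CF_def h_def)
  qed
  \<comment> \<open>On branches with large \<open>n\<close> the points share a long prefix with the
    zero sequence, where \<open>f\<close> vanishes; this is exactly the decay demanded by the
    c0-sum.\<close>
  have hfin: "finite {n. \<not> (\<forall>y. \<bar>h f n y\<bar> \<le> e)}" if f: "f \<in> CF cantor {\<lambda>_. 0}" and e: "e > 0" for f and e :: real
  proof -
    have f0: "f (\<lambda>_. 0) = 0" using f by (auto simp: CF_def)
    obtain N where N: "\<forall>s\<in>cantor. \<forall>t\<in>cantor. (\<forall>i<N. s i = t i) \<longrightarrow> \<bar>f s - f t\<bar> < e"
      using cantor_oscillation[of f e] f e by (auto simp: CF_def)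
    have "\<bar>h f n y\<bar> \<le> e" if "n \<ge> N" for n y
    proof (cases "y \<in> cantor")
      case True
      then have "\<bar>f (ccons n y) - f (\<lambda>_. 0)\<bar> < e"
        using N[rule_format, of "ccons n y" "\<lambda>_. 0"] ccons_in[OF True] that by (auto simp: ccons_def)
      then show ?thesis using True f0 by (simp add: h_def)
    qed (use e in \<open>auto simp: h_def\<close>)
    then have "{n. \<not> (\<forall>y. \<bar>h f n y\<bar> \<le> e)} \<subseteq> {..<N}" by (auto simp: not_less[symmetric])
    then show ?thesis by (rule finite_subset) simp
  qed
  have kcont: "k g \<in> CF cantor {\<lambda>_. 0}"
    if g: "\<And>n. g n \<in> CF cantor {}" "\<And>e. e > 0 \<Longrightarrow> finite {n. \<not> (\<forall>y. \<bar>g n y\<bar> \<le> e)}" for g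
  proof -
    have "(k g \<longlongrightarrow> k g s) (at s within cantor)" if s: "s \<in> cantor" for s
    proof (cases "s = (\<lambda>_. 0)")
      case True
      have "eventually (\<lambda>t. dist (k g t) 0 < e) (at s within cantor)" if e: "e > 0" for e
      proof -
        \<comment> \<open>A point that begins with \<open>N\<close> zeros lies in a branch of index
          at least \<open>N\<close>, where the null sequence \<open>g\<close> is already small. This
          gives continuity at the exceptional point.\<close>
        obtain N where "\<forall>n\<in>{n. \<not> (\<forall>y. \<bar>g n y\<bar> \<le> e / 2)}. n < N"
          using g(2)[of "e / 2"] e unfolding finite_nat_set_iff_bounded by auto
        then have "\<not> n < N \<Longrightarrow> \<forall>y. \<bar>g n y\<bar> \<le> e / 2" for n by blast
        then have N: "\<bar>g n y\<bar> \<le> e / 2" if "n \<ge> N" for n y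
          using that by (simp add: not_less)
        show ?thesis using cantor_eventually_prefix[OF s, of N]
        proof eventually_elim
          case (elim t)
          show ?case
          proof (cases "t \<in> cantor \<and> t \<noteq> (\<lambda>_. 0)")
            case True
            then have "L t \<ge> N" using L1[of t] elim[rule_format, of "L t"] \<open>s = (\<lambda>_. 0)\<close> by (cases "L t < N") auto
            then show ?thesis using N[of "L t" "cshift (L t) t"] e True by (simp add: k_def)
          qed (use e in \<open>auto simp: k_def\<close>)
        qed
      qed
      moreover have "k g s = 0" using True by (simp add: k_def)
      ultimately show ?thesis by (simp add: tendsto_iff)
    next
      case False
      let ?n = "L s"
      have "continuous_on cantor (g ?n \<circ> cshift ?n)"
      proof (rule continuous_on_compose[OF continuous_cshift])
        show "continuous_on (cshift ?n ` cantor) (g ?n)"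
          using g(1)[of ?n] cshift_in by (auto simp: CF_def intro: continuous_on_subset)
      qed
      then have "((g ?n \<circ> cshift ?n) \<longlongrightarrow> k g s) (at s within cantor)"
        using s False by (auto simp: continuous_on_def k_def o_def)
      \<comment> \<open>Away from zero the branch index \<open>L\<close> is locally constant, so
        near \<open>s\<close> only one term of \<open>g\<close> is involved.\<close>
      moreover have "eventually (\<lambda>t. (g ?n \<circ> cshift ?n) t = k g t) (at s within cantor)"
      proof -
        have "eventually (\<lambda>t. t \<in> cantor) (at s within cantor)"
          by (simp add: eventually_at_filter)
        with cantor_eventually_prefix[OF s, of "Suc ?n"] show ?thesis
        proof eventually_elim
          case (elim t)
          have "L t = ?n" using L_cong[OF False elim(1)] .
          moreover have "t \<noteq> (\<lambda>_. 0)" using elim(1) L1[OF False] by auto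
          ultimately show ?case using elim(2) by (simp add: k_def)
        qed
      qed
      ultimately show ?thesis by (rule Lim_transform_eventually)
    qed
    then have "continuous_on cantor (k g)" by (simp add: continuous_on_def)
    then show ?thesis by (auto simp: CF_def k_def)
  qed
  have kh: "k (h f) = f" if f: "f \<in> CF cantor {\<lambda>_. 0}" for f
  proof
    fix s show "k (h f) s = f s"
    proof (cases "s \<in> cantor \<and> s \<noteq> (\<lambda>_. 0)")
      case True
      then have "s (L s) = 1" using L1[of s] by (auto simp: cantor_def)
      then have "ccons (L s) (cshift (L s) s) = s"
        using True L2[of _ s] by (intro ccons_cshift) auto
      then show ?thesis using True cshift_in by (simp add: k_def h_def)
    next
      case False
      then show ?thesis using f by (auto simp: k_def CF_def)
    qed
  qed
  have hk: "h (k g) = g" if g: "\<And>n. g n \<in> CF cantor {}" for g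
  proof (intro ext)
    fix n y show "h (k g) n y = g n y"
      using g[of n] ccons_in[of y n] by (auto simp: h_def k_def L_ccons ccons_ne cshift_ccons CF_def)
  qed
  have h_near: "\<bar>h f n y - h f' n y\<bar> \<le> B" if "0 \<le> B" "\<forall>s. \<bar>f s - f' s\<bar> \<le> B" for f f' B n y
    using that by (simp add: h_def)
  have k_near: "\<bar>k g s - k g' s\<bar> \<le> B" if "0 \<le> B" "\<forall>n y. \<bar>g n y - g' n y\<bar> \<le> B" for g g' B s
    using that by (simp add: k_def)
  have h0: "h (\<lambda>_. 0) = (\<lambda>_ _. 0)" and k0: "k (\<lambda>_ _. 0) = (\<lambda>_. 0)"
    by (simp_all add: h_def k_def fun_eq_iff)
  show ?thesis
    unfolding lipeq_def
  proof (intro exI[of _ h] exI[of _ k] conjI ballI)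
    show "lip_map (fsp (CF cantor {\<lambda>_. 0})) (gc0 (fsp (CF cantor {}))) h"
    proof (rule lip_mapI[where K = 1])
      fix f assume "f \<in> pts (fsp (CF cantor {\<lambda>_. 0}))"
      then show "h f \<in> pts (gc0 (fsp (CF cantor {})))" using hcont[of f] hfin[of f] by simp
    qed (simp_all add: gauge_ok_gc0 h0 h_near)
    show "lip_map (gc0 (fsp (CF cantor {}))) (fsp (CF cantor {\<lambda>_. 0})) k"
    proof (rule lip_mapI[where K = 1])
      fix g assume "g \<in> pts (gc0 (fsp (CF cantor {})))"
      then show "k g \<in> pts (fsp (CF cantor {\<lambda>_. 0}))" using kcont[of g] by simp
    qed (simp_all add: k0 k_near)
  next
    fix f assume "f \<in> pts (fsp (CF cantor {\<lambda>_. 0}))"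
    then show "k (h f) = f" using kh by simp
  next
    fix g assume "g \<in> pts (gc0 (fsp (CF cantor {})))"
    then show "h (k g) = g" using hk[of g] by simp
  qed
qed

text \<open>\<open>node s n\<close> is the centre and the radius of the \<open>n\<close>-th ball of a Cantor scheme: the digit 1 moves to a
  close neighbour, and the radius is a third of the distance to it, which keeps the two successor
  balls disjoint.\<close>

context
  fixes Q :: "'x::metric_space set" and x0 :: 'x and r0 :: real
begin

definition neighbour :: "'x \<Rightarrow> real \<Rightarrow> 'x" where
  "neighbour x r = (SOME y. y \<in> Q \<and> y \<noteq> x \<and> dist y x < r / 2)"

primrec node :: "(nat \<Rightarrow> real) \<Rightarrow> nat \<Rightarrow> 'x \<times> real" where
  "node s 0 = (x0, r0)"
| "node s (Suc n) = (let (x, r) = node s n; y = neighbour x r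
     in (if s n = 1 then y else x, dist y x / 3))"

end

lemma node_cong: "(\<And>i. i < n \<Longrightarrow> s i = t i) \<Longrightarrow> node Q x0 r0 s n = node Q x0 r0 t n"
  by (induction n) (auto simp: Let_def split: prod.splits)

text \<open>Nested balls shrink to a point for each digit sequence. The initial radius confines the
  copy to a prescribed ball, which later keeps it away from the base points.\<close>

lemma cantor_embedding:
  fixes Q :: "'x::metric_space set"
  assumes Q: "compact Q" and perfect: "\<And>x. x \<in> Q \<Longrightarrow> x islimpt Q"
    and x0: "x0 \<in> Q" and r0: "r0 > 0"
  obtains e e' D where "homeomorphism cantor D e e'" "D \<subseteq> Q" "D \<subseteq> cball x0 r0"
proof -
  let ?n = "node Q x0 r0"
  define c where "c s n = fst (?n s n)" for s n
  define r where "r s n = snd (?n s n)" for s n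
  define y where "y s n = neighbour Q (c s n) (r s n)" for s n
  have c0: "c s 0 = x0" "r s 0 = r0" for s by (simp_all add: c_def r_def)
  have cSuc: "c s (Suc n) = (if s n = 1 then y s n else c s n)" "r s (Suc n) = dist (y s n) (c s n) / 3" for s n
    by (simp_all add: c_def r_def y_def Let_def split: prod.splits)
  have y_props: "y s n \<in> Q \<and> y s n \<noteq> c s n \<and> dist (y s n) (c s n) < r s n / 2"
    if "c s n \<in> Q" "r s n > 0" for s n
  proof -
    have "\<exists>z. z \<in> Q \<and> z \<noteq> c s n \<and> dist z (c s n) < r s n / 2"
      using perfect[OF that(1)] that(2) unfolding islimpt_approachable by (metis half_gt_zero)
    then show ?thesis unfolding y_def neighbour_def by (rule someI_ex)
  qed
  have inv: "c s n \<in> Q \<and> r s n > 0" for s n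
  proof (induction n)
    case (Suc n)
    then show ?case using y_props[of s n] by (auto simp: cSuc)
  qed (use x0 r0 in \<open>simp add: c0\<close>)
  note yp = y_props[OF conjunct1[OF inv] conjunct2[OF inv]]
  \<comment> \<open>A centre moves by less than half the radius and the new radius is less than a
    sixth of the old one, so the balls are nested.\<close>
  have nest: "dist (c s (Suc n)) (c s n) + r s (Suc n) \<le> r s n" "r s (Suc n) \<le> r s n / 2" for s n
    using yp[of s n] inv[of s n] by (auto simp: cSuc)
  have r_le: "r s n \<le> r0 * (1 / 2) ^ n" for s n
  proof (induction n)
    case (Suc n)
    then show ?case using nest(2)[of s n] by simp
  qed (simp add: c0)
  have ball: "dist (c s (n + m)) (c s n) + r s (n + m) \<le> r s n" for s n m
  proof (induction m)
    case (Suc m)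
    then show ?case using nest(1)[of s "n + m"] dist_triangle[of "c s (n + Suc m)" "c s n" "c s (n + m)"] by simp
  qed simp
  have ball': "dist (c s m) (c s n) \<le> r s n" if "n \<le> m" for s n m
    using ball[of s n "m - n"] inv[of s m] that by simp
  have lim: "\<exists>l\<in>Q. c s \<longlonglongrightarrow> l" for s
  proof -
    have "Cauchy (c s)"
    proof (rule metric_CauchyI)
      fix e :: real assume e: "e > 0"
      obtain N where N: "(1 / 2 :: real) ^ N < e / (2 * r0)"
        using real_arch_pow_inv[of "e / (2 * r0)" "1/2"] e r0 by auto
      have "2 * (r0 * (1 / 2) ^ N) < e" using N r0 by (simp add: field_simps)
      then have rN: "2 * r s N < e" using r_le[of s N] by linarith
      have "dist (c s m) (c s n) < e" if "m \<ge> N" "n \<ge> N" for m n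
        using ball'[OF that(1), of s] ball'[OF that(2), of s] rN dist_triangle2[of "c s m" "c s n" "c s N"] by linarith
      then show "\<exists>N. \<forall>m\<ge>N. \<forall>n\<ge>N. dist (c s m) (c s n) < e" by blast
    qed
    then show ?thesis
      using compact_imp_complete[OF Q] inv unfolding complete_def by blast
  qed
  define e where "e s = lim (c s)" for s
  have e_lim: "c s \<longlonglongrightarrow> e s" and eQ: "e s \<in> Q" for s
    using lim[of s] limI unfolding e_def by (metis, metis)
  have e_ball: "dist (c s n) (e s) \<le> r s n" for s n
  proof (rule Lim_dist_ubound[OF sequentially_bot e_lim])
    show "\<forall>\<^sub>F m in sequentially. dist (c s n) (c s m) \<le> r s n"
      using ball'[of n _ s] unfolding eventually_sequentially by (metis dist_commute)
  qed
  have cong: "c s n = c t n \<and> r s n = r t n" if "\<And>i. i < n \<Longrightarrow> s i = t i" for s t n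
    using node_cong[of n s t Q x0 r0] that by (simp add: c_def r_def)
  have inj: "inj_on e cantor"
  proof (rule inj_onI, rule ccontr)
    fix s t assume st: "s \<in> cantor" "t \<in> cantor" "e s = e t" "s \<noteq> t"
    \<comment> \<open>At the first differing digit both sequences have the same node, and one of
      them moves to the neighbour. A common limit would put the two new centres within two thirds of
      their own distance.\<close>
    define n where "n = (LEAST n. s n \<noteq> t n)"
    have n: "s n \<noteq> t n" using st(4) unfolding n_def fun_eq_iff not_all by (rule LeastI_ex)
    have "s i = t i" if "i < n" for i
      using not_less_Least[OF that[unfolded n_def]] by simp
    then have c: "c s n = c t n" "r s n = r t n" using cong[of n s t] by simp_all
    then have "y s n = y t n" by (simp add: y_def)
    moreover have "s n = 0 \<or> s n = 1" "t n = 0 \<or> t n = 1" using st by (simp_all add: cantor_def)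
    with n have "s n = 1 \<and> t n = 0 \<or> s n = 0 \<and> t n = 1" by auto
    ultimately have "dist (c s (Suc n)) (c t (Suc n)) = dist (y s n) (c s n)"
      unfolding cSuc c by (auto simp: dist_commute)
    moreover have "r s (Suc n) = dist (y s n) (c s n) / 3" "r t (Suc n) = dist (y s n) (c s n) / 3"
      using c \<open>y s n = y t n\<close> by (simp_all add: cSuc)
    then have "dist (c s (Suc n)) (c t (Suc n)) \<le> 2 * (dist (y s n) (c s n) / 3)"
      using e_ball[of s "Suc n"] e_ball[of t "Suc n", folded st(3)]
        dist_triangle2[of "c s (Suc n)" "c t (Suc n)" "e s"] by linarith
    moreover have "dist (y s n) (c s n) > 0" using yp[of s n] by simp
    ultimately show False by linarith
  qed
  have cont: "continuous_on cantor e"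
    unfolding continuous_on_def
  proof
    fix s assume s: "s \<in> cantor"
    show "(e \<longlongrightarrow> e s) (at s within cantor)"
    proof (rule tendstoI)
      fix d :: real assume d: "d > 0"
      obtain N where N: "(1 / 2 :: real) ^ N < d / (2 * r0)"
        using real_arch_pow_inv[of "d / (2 * r0)" "1/2"] d r0 by auto
      have "2 * (r0 * (1 / 2) ^ N) < d" using N r0 by (simp add: field_simps)
      then have rN: "2 * r s N < d" using r_le[of s N] by linarith
      show "eventually (\<lambda>t. dist (e t) (e s) < d) (at s within cantor)"
        using cantor_eventually_prefix[OF s, of N]
      proof eventually_elim
        case (elim t)
        then have "c t N = c s N \<and> r t N = r s N" by (intro cong) auto
        then show ?case using e_ball[of s N] e_ball[of t N] rN dist_triangle3[of "e t" "e s" "c s N"] by auto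
      qed
    qed
  qed
  obtain e' where "homeomorphism cantor (e ` cantor) e e'"
    using homeomorphism_compact[OF compact_cantor cont refl inj] by blast
  moreover have "e ` cantor \<subseteq> Q" using eQ by blast
  moreover have "e ` cantor \<subseteq> cball x0 r0"
    using e_ball[of _ 0] unfolding c0 by auto
  ultimately show ?thesis using that by blast
qed

section \<open>Averaging over the Cantor space\<close>

text \<open>The mean of \<open>G\<close> over the random set of all \<open>i < n\<close> that are picked independently with
  probabilities \<open>p i\<close>\<close>

primrec avg :: "(nat \<Rightarrow> real) \<Rightarrow> nat \<Rightarrow> (nat set \<Rightarrow> real) \<Rightarrow> real" where
  "avg p 0 G = G {}"
| "avg p (Suc n) G = (1 - p n) * avg p n G + p n * avg p n (\<lambda>S. G (insert n S))"

lemma avg_diff: "avg p n (\<lambda>S. G S - H S) = avg p n G - avg p n H"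
proof (induction n arbitrary: G H)
  case (Suc n)
  show ?case unfolding avg.simps Suc.IH by (simp add: algebra_simps)
qed simp

text \<open>A value that enters with weight 0 may be arbitrary, whence the conditional
  bounds.\<close>

lemma convex_abs_diff_le:
  fixes p a b c e :: real
  assumes "0 \<le> p" "p \<le> 1" "p < 1 \<Longrightarrow> \<bar>a - c\<bar> \<le> e" "p > 0 \<Longrightarrow> \<bar>b - c\<bar> \<le> e"
  shows "\<bar>(1 - p) * a + p * b - c\<bar> \<le> e"
proof -
  have "\<bar>(1 - p) * (a - c)\<bar> \<le> (1 - p) * e" "\<bar>p * (b - c)\<bar> \<le> p * e"
    unfolding abs_mult using assms by (auto intro!: mult_mono simp: le_less)
  moreover have "(1 - p) * a + p * b - c = (1 - p) * (a - c) + p * (b - c)"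
    by (simp add: algebra_simps)
  moreover have "(1 - p) * e + p * e = e" by (simp add: algebra_simps)
  ultimately show ?thesis by linarith
qed

text \<open>Only sets of positive probability have to be tested: they contain no index of
  probability 0 and omit none of probability 1. This is how inadmissible digits drop out of the
  average.\<close>

lemma avg_near:
  assumes p: "\<And>i. 0 \<le> p i \<and> p i \<le> 1"
    and G: "\<And>S. S \<subseteq> {..<n} \<Longrightarrow> (\<And>i. i \<in> S \<Longrightarrow> 0 < p i) \<Longrightarrow> (\<And>i. i < n \<Longrightarrow> i \<notin> S \<Longrightarrow> p i < 1) \<Longrightarrow> \<bar>G S - c\<bar> \<le> e"
  shows "\<bar>avg p n G - c\<bar> \<le> e"
  using G
proof (induction n arbitrary: G)
  case (Suc n)
  show ?case
    unfolding avg.simps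
  proof (rule convex_abs_diff_le)
    assume lt: "p n < 1"
    show "\<bar>avg p n G - c\<bar> \<le> e"
    proof (rule Suc.IH)
      fix S assume "S \<subseteq> {..<n}" "\<And>i. i \<in> S \<Longrightarrow> 0 < p i" "\<And>i. i < n \<Longrightarrow> i \<notin> S \<Longrightarrow> p i < 1"
      then show "\<bar>G S - c\<bar> \<le> e" using lt by (intro Suc.prems) (auto simp: less_Suc_eq)
    qed
  next
    assume gt: "p n > 0"
    show "\<bar>avg p n (\<lambda>S. G (insert n S)) - c\<bar> \<le> e"
    proof (rule Suc.IH)
      fix S assume "S \<subseteq> {..<n}" "\<And>i. i \<in> S \<Longrightarrow> 0 < p i" "\<And>i. i < n \<Longrightarrow> i \<notin> S \<Longrightarrow> p i < 1"
      then show "\<bar>G (insert n S) - c\<bar> \<le> e" using gt by (intro Suc.prems) (auto simp: less_Suc_eq)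
    qed
  qed (use p in auto)
qed simp

lemma avg_prefix:
  assumes "m \<le> n" "\<And>k S. m \<le> k \<Longrightarrow> G (insert k S) = G S"
  shows "avg p n G = avg p m G"
  using assms(1)
proof (induction n rule: dec_induct)
  case (step n)
  then show ?case using assms(2)[of n] by (simp add: algebra_simps)
qed simp

text \<open>Digits from \<open>m\<close> on change \<open>G\<close> by at most \<open>e\<close>,
  hence also its mean, while the mean of the truncated function does not depend on them at
  all.\<close>

lemma avg_truncate:
  assumes p: "\<And>i. 0 \<le> p i \<and> p i \<le> 1" and "m \<le> n"
    and G: "\<And>S. \<bar>G S - G (S \<inter> {..<m})\<bar> \<le> e"
  shows "\<bar>avg p n G - avg p m G\<bar> \<le> e"
proof -
  let ?G = "\<lambda>S. G (S \<inter> {..<m})"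
  have "\<bar>avg p n (\<lambda>S. G S - ?G S) - 0\<bar> \<le> e"
    using p G by (intro avg_near) auto
  moreover have "avg p n ?G = avg p m ?G"
    using assms(2) by (intro avg_prefix) auto
  \<comment> \<open>A bound by 0 expresses equality here: the first \<open>m\<close> digits only
    produce subsets of \<open>{..<m}\<close>, which truncation leaves alone.\<close>
  moreover have "\<bar>avg p m (\<lambda>S. ?G S - G S) - 0\<bar> \<le> 0"
    using p by (intro avg_near) (auto simp: Int_absorb2)
  ultimately show ?thesis by (simp add: avg_diff)
qed

lemma continuous_on_avg:
  assumes "\<And>i. continuous_on K (\<lambda>x. p x i)"
  shows "continuous_on K (\<lambda>x. avg (p x) n G)"
  by (induction n arbitrary: G) (simp_all add: assms continuous_intros)

definition chi :: "nat set \<Rightarrow> nat \<Rightarrow> real" where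
  "chi S = (\<lambda>i. if i \<in> S then 1 else 0)"

lemma chi_in_cantor [simp]: "chi S \<in> cantor"
  by (simp add: chi_def cantor_def)

text \<open>The index \<open>m\<close> does not depend on the probabilities \<open>p\<close>. The
  averages therefore converge uniformly when \<open>p\<close> varies with a point, so that their
  limit is continuous.\<close>

lemma avg_cantor_tail:
  assumes g: "continuous_on cantor g" and e: "e > 0"
  obtains m where "\<And>n p. m \<le> n \<Longrightarrow> (\<And>i. 0 \<le> p i \<and> p i \<le> 1) \<Longrightarrow>
    \<bar>avg p n (\<lambda>S. g (chi S)) - avg p m (\<lambda>S. g (chi S))\<bar> \<le> e"
proof -
  obtain m where m: "\<forall>s\<in>cantor. \<forall>t\<in>cantor. (\<forall>i<m. s i = t i) \<longrightarrow> \<bar>g s - g t\<bar> < e"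
    using cantor_oscillation[OF g e] by blast
  have "\<bar>g (chi S) - g (chi (S \<inter> {..<m}))\<bar> \<le> e" for S
    by (rule less_imp_le, rule m[rule_format]) (simp_all, simp add: chi_def)
  then show ?thesis by (intro that[of m] avg_truncate)
qed

text \<open>A continuous function \<open>q\<close> distributes a point \<open>x\<close> over the digits 0 and 1: the digit 1 is
  admissible where \<open>q \<ge> 0\<close>, the digit 0 where \<open>q \<le> 1\<close>. Digit sequences that are admissible for some
  point determine it, and random digits give a linear left inverse of pulling back functions from
  \<open>K\<close> to the closed set of admissible sequences.\<close>

lemma lipeq_cantor_split:
  fixes K :: "'x::metric_space set" and q :: "nat \<Rightarrow> 'x \<Rightarrow> real"
  assumes K: "compact K" and q: "\<And>n. continuous_on K (q n)"
    and sep: "\<And>x y. x \<in> K \<Longrightarrow> y \<in> K \<Longrightarrow> x \<noteq> y \<Longrightarrow> \<exists>n. q n x < 0 \<and> 1 < q n y"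
  obtains V :: "((nat \<Rightarrow> real) \<Rightarrow> real) set" where "(\<lambda>_. 0) \<in> V" "lipeq (fsp (CF cantor {})) (gprod (fsp (CF K {})) (fsp V))"
proof -
  define p where "p x n = max 0 (min 1 (q n x))" for x n
  have p01: "0 \<le> p x n \<and> p x n \<le> 1" for x n by (simp add: p_def)
  have p_cont: "continuous_on K (\<lambda>x. p x n)" for n
    unfolding p_def by (intro continuous_intros q)
  define adm where "adm s x \<longleftrightarrow> (\<forall>n. (s n = 1 \<longrightarrow> 0 \<le> q n x) \<and> (s n = 0 \<longrightarrow> q n x \<le> 1))"
    for s :: "nat \<Rightarrow> real" and x
  have adm_unique: "x = y" if xy: "s \<in> cantor" "x \<in> K" "y \<in> K" "adm s x" "adm s y" for s x y
  proof (rule ccontr)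
    assume "x \<noteq> y"
    then obtain n where n: "q n x < 0" "1 < q n y" using sep[of x y] xy by blast
    have "s n = 0 \<or> s n = 1" using xy(1) by (simp add: cantor_def)
    then show False using n xy(4,5) unfolding adm_def by (meson not_le)
  qed
  define T where "T = {z \<in> cantor \<times> K. adm (fst z) (snd z)}"
  have cT: "compact T"
  proof -
    have C: "closed (cantor \<times> K)" "compact (cantor \<times> K)"
      using compact_Times[OF compact_cantor K] compact_imp_closed by auto
    have qc: "continuous_on (cantor \<times> K) (\<lambda>z. q n (snd z))" for n
      by (rule continuous_on_compose2[OF q]) (auto intro: continuous_intros)
    have sc: "continuous_on (cantor \<times> K) (\<lambda>z. fst z n)" for n :: nat
      by (rule continuous_on_compose2[OF continuous_on_product_coordinates]) (auto intro: continuous_intros)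
    \<comment> \<open>As the digits are 0 or 1, the two implications of \<open>adm\<close> become
      vanishing products of continuous functions, which define closed sets.\<close>
    have "T = (\<Inter>n. {z \<in> cantor \<times> K. fst z n * min 0 (q n (snd z)) = 0}) \<inter>
              (\<Inter>n. {z \<in> cantor \<times> K. (1 - fst z n) * max 0 (q n (snd z) - 1) = 0})"
    proof -
      have "adm s x \<longleftrightarrow> (\<forall>n. s n * min 0 (q n x) = 0 \<and> (1 - s n) * max 0 (q n x - 1) = 0)"
        if "s \<in> cantor" for s x
      proof -
        have "((s n = 1 \<longrightarrow> 0 \<le> q n x) \<and> (s n = 0 \<longrightarrow> q n x \<le> 1)) \<longleftrightarrow>
            (s n * min 0 (q n x) = 0 \<and> (1 - s n) * max 0 (q n x - 1) = 0)" for n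
          using that by (cases "s n = 0") (auto simp: cantor_def min_def max_def)
        then show ?thesis unfolding adm_def by simp
      qed
      then show ?thesis unfolding T_def by auto
    qed
    moreover have "closed {z \<in> cantor \<times> K. fst z n * min 0 (q n (snd z)) = 0}" for n
      by (rule continuous_closed_preimage_constant[OF _ C(1)]) (intro continuous_intros qc sc)
    moreover have "closed {z \<in> cantor \<times> K. (1 - fst z n) * max 0 (q n (snd z) - 1) = 0}" for n
      by (rule continuous_closed_preimage_constant[OF _ C(1)]) (intro continuous_intros qc sc)
    ultimately have "closed T" by (auto intro!: closed_INT)
    moreover have "T \<subseteq> cantor \<times> K" by (auto simp: T_def)
    ultimately show ?thesis using C(2) by (metis compact_Int_closed inf.absorb_iff2)
  qed
  have T_fst: "continuous_on T fst" by (rule continuous_on_fst[OF continuous_on_id])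
  define Z where "Z = fst ` T"
  have cZ: "compact Z" unfolding Z_def by (rule compact_continuous_image[OF T_fst cT])
  have Z: "s \<in> cantor" if "s \<in> Z" for s using that by (auto simp: Z_def T_def)
  define phi where "phi s = (THE x. x \<in> K \<and> adm s x)" for s
  have phi_eq: "phi s = x" if "s \<in> cantor" "x \<in> K" "adm s x" for s x
    unfolding phi_def using that adm_unique by (intro the_equality) auto
  \<comment> \<open>The projection of the compact graph \<open>T\<close> to the digit sequences is
    injective by \<open>adm_unique\<close>, so its inverse is continuous.\<close>
  have phi_cont: "continuous_on Z phi"
  proof -
    have "continuous_on (fst ` T) (\<lambda>s. (s, phi s))"
      by (rule continuous_on_inv[OF T_fst cT]) (auto intro!: phi_eq simp: T_def)
    then have "continuous_on Z (\<lambda>s. snd (s, phi s))"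
      unfolding Z_def by (intro continuous_on_snd)
    then show ?thesis by simp
  qed
  have phi_in: "phi ` Z \<subseteq> K"
    using phi_eq by (auto simp: Z_def T_def)
  define a where "a g n x = avg (p x) n (\<lambda>S. g (chi S))" for g :: "(nat \<Rightarrow> real) \<Rightarrow> real" and n x
  define P where "P g = (\<lambda>x. if x \<in> K then lim (\<lambda>n. a g n x) else 0)" for g
  have a_unif: "\<exists>m. \<forall>n\<ge>m. \<forall>x. \<bar>a g n x - a g m x\<bar> \<le> e" if "g \<in> CF cantor {}" "e > 0" for g e
  proof -
    have "continuous_on cantor g" using that(1) by (simp add: CF_def)
    from avg_cantor_tail[OF this that(2)] obtain m where
      "\<And>n p. m \<le> n \<Longrightarrow> (\<And>i. 0 \<le> p i \<and> p i \<le> 1) \<Longrightarrow>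
        \<bar>avg p n (\<lambda>S. g (chi S)) - avg p m (\<lambda>S. g (chi S))\<bar> \<le> e" by blast
    then show ?thesis unfolding a_def using p01 by (intro exI[of _ m]) simp
  qed
  have a_Cauchy: "Cauchy (\<lambda>n. a g n x)" if g: "g \<in> CF cantor {}" for g x
  proof (rule metric_CauchyI)
    fix e :: real assume "e > 0"
    then obtain m where m: "\<forall>n\<ge>m. \<forall>x. \<bar>a g n x - a g m x\<bar> \<le> e / 3" using a_unif[OF g, of "e / 3"] by auto
    have "dist (a g i x) (a g j x) < e" if "i \<ge> m" "j \<ge> m" for i j
      using m[rule_format, OF that(1), of x] m[rule_format, OF that(2), of x] \<open>e > 0\<close> unfolding dist_real_def by linarith
    then show "\<exists>M. \<forall>i\<ge>M. \<forall>j\<ge>M. dist (a g i x) (a g j x) < e" by blast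
  qed
  have a_lim: "(\<lambda>n. a g n x) \<longlonglongrightarrow> P g x" if "g \<in> CF cantor {}" "x \<in> K" for g x
    using Cauchy_convergent[OF a_Cauchy[OF that(1)], of x] that(2)
    by (simp add: P_def convergent_LIMSEQ_iff)
  have P_cont: "continuous_on K (P g)" if g: "g \<in> CF cantor {}" for g
  proof (rule uniform_limit_theorem)
    show "uniform_limit K (a g) (P g) sequentially"
    proof (rule uniform_limitI)
      fix e :: real assume e: "e > 0"
      then obtain m where m: "\<forall>n\<ge>m. \<forall>x. \<bar>a g n x - a g m x\<bar> \<le> e / 3" using a_unif[OF g, of "e / 3"] by auto
      have "dist (a g n x) (P g x) < e" if n: "n \<ge> m" and x: "x \<in> K" for n x
      proof -
        have "eventually (\<lambda>k. dist (a g m x) (a g k x) \<le> e / 3) sequentially"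
          using m unfolding eventually_sequentially dist_real_def by (metis abs_minus_commute)
        then have "dist (a g m x) (P g x) \<le> e / 3"
          by (rule Lim_dist_ubound[OF sequentially_bot a_lim[OF g x]])
        then show ?thesis using m[rule_format, OF n, of x] e unfolding dist_real_def by linarith
      qed
      then show "\<forall>\<^sub>F n in sequentially. \<forall>x\<in>K. dist (a g n x) (P g x) < e"
        unfolding eventually_sequentially by blast
    qed
    show "\<forall>\<^sub>F n in sequentially. continuous_on K (a g n)"
      unfolding a_def by (intro always_eventually allI continuous_on_avg p_cont)
  qed simp
  \<comment> \<open>Pulling back along \<open>phi\<close> defines the function only on the
    admissible sequences \<open>Z\<close>; the nonexpansive extension supplies the rest of the
    Cantor space.\<close>
  define s where "s f = (\<lambda>t. if t \<in> cantor then hext Z (f \<circ> phi) t else 0)" for f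
  have fphi: "continuous_on Z (f \<circ> phi)" if "f \<in> CF K {}" for f
    using that phi_in by (intro continuous_on_compose phi_cont) (auto simp: CF_def intro: continuous_on_subset)
  have s_in: "s f \<in> CF cantor {}" if f: "f \<in> CF K {}" for f
    using continuous_on_hext[OF cZ fphi[OF f], of cantor] by (simp add: CF_def s_def cong: continuous_on_cong)
  have s_phi: "s f t = f x" if "t \<in> cantor" "x \<in> K" "adm t x" for f t x
  proof -
    have "t \<in> Z" using that unfolding Z_def T_def by force
    then show ?thesis using that phi_eq[OF that] by (simp add: s_def hext_def)
  qed
  have Ps: "P (s f) = f" if f: "f \<in> CF K {}" for f
  proof
    fix x show "P (s f) x = f x"
    proof (cases "x \<in> K")
      case True
      have "(\<lambda>n. a (s f) n x) \<longlonglongrightarrow> f x"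
      proof (rule LIMSEQ_I)
        fix e :: real assume e: "e > 0"
        obtain m where m: "\<forall>s'\<in>cantor. \<forall>t\<in>cantor. (\<forall>i<m. s' i = t i) \<longrightarrow> \<bar>s f s' - s f t\<bar> < e / 2"
          using cantor_oscillation[of "s f" "e / 2"] s_in[OF f] e by (auto simp: CF_def)
        have "\<bar>a (s f) n x - f x\<bar> \<le> e / 2" if n: "n \<ge> m" for n
          unfolding a_def
        proof (rule avg_near[OF p01])
          fix S assume S: "S \<subseteq> {..<n}" "\<And>i. i \<in> S \<Longrightarrow> 0 < p x i" "\<And>i. i < n \<Longrightarrow> i \<notin> S \<Longrightarrow> p x i < 1"
          \<comment> \<open>A set of positive probability gives \<open>n\<close> admissible digits,
            but the zeros of \<open>chi S\<close> from there on may be inadmissible. They are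
            replaced by an admissible tail, which \<open>s f\<close> hardly notices.\<close>
          define t where "t i = (if i < n then chi S i else if q i x \<ge> 0 then 1 else 0)" for i
          have t: "t \<in> cantor" by (simp add: t_def cantor_def chi_def)
          have "adm t x"
            unfolding adm_def
          proof
            fix i
            show "(t i = 1 \<longrightarrow> 0 \<le> q i x) \<and> (t i = 0 \<longrightarrow> q i x \<le> 1)"
              using S(2,3)[of i] by (auto simp: t_def chi_def p_def split: if_splits)
          qed
          then have "s f t = f x" using s_phi t True by blast
          moreover have "\<bar>s f (chi S) - s f t\<bar> < e / 2"
            using n by (intro m[rule_format] t chi_in_cantor) (auto simp: t_def)
          ultimately show "\<bar>s f (chi S) - f x\<bar> \<le> e / 2" by simp
        qed
        then have "\<bar>a (s f) n x - f x\<bar> < e" if "n \<ge> m" for n using that e by force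
        then show "\<exists>m. \<forall>n\<ge>m. norm (a (s f) n x - f x) < e" by auto
      qed
      then show ?thesis using a_lim[OF s_in[OF f] True] LIMSEQ_unique by blast
    next
      case False
      then show ?thesis using f by (auto simp: P_def CF_def)
    qed
  qed
  have s0: "s (\<lambda>_. 0) = (\<lambda>_. 0)"
  proof -
    have "((\<lambda>_. 0) \<circ> phi) = (\<lambda>_. 0 :: real)" by auto
    then show ?thesis by (simp add: s_def fun_eq_iff hext_zero[OF cZ])
  qed
  have "lipeq (fsp (CF cantor {})) (gprod (fsp (CF K {})) (fsp {g \<in> CF cantor {}. P g = (\<lambda>_. 0)}))"
  proof (rule lipeq_split[where s = s])
    fix g assume "g \<in> CF cantor {}"
    then have "continuous_on K (P g)" by (rule P_cont)
    moreover have "P g x = 0" if "x \<notin> K" for x using that by (simp add: P_def)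
    ultimately show "P g \<in> CF K {}" by (simp add: CF_def)
  next
    fix f g assume fg: "f \<in> CF cantor {}" "g \<in> CF cantor {}"
    show "P (\<lambda>i. f i - g i) = (\<lambda>j. P f j - P g j)"
    proof
      fix x show "P (\<lambda>i. f i - g i) x = P f x - P g x"
      proof (cases "x \<in> K")
        case True
        have "(\<lambda>n. a f n x - a g n x) \<longlonglongrightarrow> P f x - P g x"
          by (intro tendsto_diff a_lim fg True)
        then have "(\<lambda>n. a (\<lambda>i. f i - g i) n x) \<longlonglongrightarrow> P f x - P g x"
          by (simp add: a_def avg_diff)
        then show ?thesis using a_lim[OF CF_diff[OF fg] True] LIMSEQ_unique by blast
      qed (simp add: P_def)
    qed
  next
    fix g B x assume g: "g \<in> CF cantor {}" "\<forall>i. \<bar>g i\<bar> \<le> B"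
    show "\<bar>P g x\<bar> \<le> B"
    proof (cases "x \<in> K")
      case True
      have "\<bar>a g n x - 0\<bar> \<le> B" for n
        unfolding a_def using g(2) by (intro avg_near p01) auto
      then have "eventually (\<lambda>n. norm (a g n x) \<le> B) sequentially" by simp
      then show ?thesis
        using Lim_norm_ubound[OF sequentially_bot a_lim[OF g(1) True]] by simp
    next
      case False
      then show ?thesis using g(2)[rule_format, of "\<lambda>_. 0"] by (simp add: P_def)
    qed
  next
    fix y y' B i assume y: "y \<in> CF K {}" "y' \<in> CF K {}" "0 \<le> B" "\<forall>j. \<bar>y j - y' j\<bar> \<le> B"
    show "\<bar>s y i - s y' i\<bar> \<le> B"
      using hext_nonexpansive[OF cZ fphi[OF y(1)] fphi[OF y(2)] y(3), of i] y(3,4) by (simp add: s_def)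
  qed (rule zero_in_CF | erule (1) CF_add | erule (1) CF_diff | erule s_in | erule Ps | rule s0)+
  from that[OF _ this] show ?thesis
    using Ps[of "\<lambda>_. 0"] unfolding s0 by simp
qed

lemma separating_sequence:
  obtains q :: "nat \<Rightarrow> 'x::{metric_space, second_countable_topology} \<Rightarrow> real"
  where "\<And>n S. continuous_on S (q n)" "\<And>x y. x \<noteq> y \<Longrightarrow> \<exists>n. q n x < 0 \<and> 1 < q n y"
proof -
  obtain D :: "'x set" where D: "countable D" "\<And>X. open X \<Longrightarrow> X \<noteq> {} \<Longrightarrow> \<exists>d\<in>D. d \<in> X"
    using countable_dense_exists by blast
  define q where "q n x = real (snd (prod_decode n)) * dist x (from_nat_into D (fst (prod_decode n))) - 1" for n x
  show ?thesis
  proof (rule that[of q])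
    fix n S show "continuous_on S (q n)" unfolding q_def by (intro continuous_intros)
  next
    fix x y :: 'x assume "x \<noteq> y"
    define d where "d = dist x y"
    have d: "d > 0" using \<open>x \<noteq> y\<close> by (simp add: d_def)
    \<comment> \<open>For \<open>z\<close> within \<open>d / 4\<close> of \<open>x\<close> the point
      \<open>y\<close> is at least \<open>3 / 4 * d\<close> away from \<open>z\<close>; scaling by
      \<open>m\<close> makes this larger than 3, whereas \<open>x\<close> is within
      \<open>1 / m\<close>. Subtracting 1 then separates the values across the interval from 0 to
      1.\<close>
    obtain m where m: "4 / d < real m" using reals_Archimedean2 by blast
    have m0: "real m > 0" using m d by (meson divide_pos_pos less_trans zero_less_numeral)
    have "0 < min (1 / real m) (d / 4)" using m0 d by simp
    then have "ball x (min (1 / real m) (d / 4)) \<noteq> {}" by (metis centre_in_ball empty_iff)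
    then obtain z where z: "z \<in> D" "dist x z < min (1 / real m) (d / 4)"
      using D(2)[of "ball x (min (1 / real m) (d / 4))"] by (auto simp: mem_ball)
    obtain k where k: "from_nat_into D k = z" using z(1) D(1) by (metis from_nat_into_surj)
    have q: "q (prod_encode (k, m)) w = real m * dist w z - 1" for w
      by (simp add: q_def k)
    have "real m * dist x z < 1" using z(2) m0 by (simp add: field_simps)
    moreover have "real m * dist y z > 2"
    proof -
      have "dist y z \<ge> 3 / 4 * d" using z(2) dist_triangle2[of x y z] unfolding d_def by simp
      then have "real m * dist y z \<ge> real m * (3 / 4 * d)" using m0 by simp
      moreover have "real m * d > 4" using m d by (simp add: field_simps)
      ultimately show ?thesis by linarith
    qed
    ultimately show "\<exists>n. q n x < 0 \<and> 1 < q n y"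
      using q by (intro exI[of _ "prod_encode (k, m)"]) simp
  qed
qed

text \<open>Supplies the two decompositions for \<open>lipeq_pelczynski\<close>: averaging makes
  \<open>CF K F\<close> a factor of the c0-sum, and a Cantor set inside \<open>Q\<close> but off
  \<open>F\<close> makes the c0-sum a factor of \<open>CF K F\<close>.\<close>

proposition lipeq_CF_milutin:
  fixes K Q F :: "'x::{metric_space, second_countable_topology} set"
  assumes K: "compact K" and F: "closed F" "F \<subseteq> K"
    and Q: "compact Q" "Q \<subseteq> K" "\<And>x. x \<in> Q \<Longrightarrow> x islimpt Q" "x0 \<in> Q" "x0 \<notin> F"
  shows "lipeq (fsp (CF K F)) (gc0 (fsp (CF cantor {})))"
proof -
  note ok = gauge_ok_gprod gauge_ok_gc0 gauge_ok_CF gauge_ok_fsp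
  let ?C = "fsp (CF cantor {})" and ?X = "fsp (CF K F)"
  obtain q :: "nat \<Rightarrow> 'x \<Rightarrow> real" where q: "\<And>n S. continuous_on S (q n)"
    "\<And>x y. x \<noteq> y \<Longrightarrow> \<exists>n. q n x < 0 \<and> 1 < q n y"
    using separating_sequence by blast
  obtain V :: "((nat \<Rightarrow> real) \<Rightarrow> real) set" where V: "(\<lambda>_. 0) \<in> V" "lipeq ?C (gprod (fsp (CF K {})) (fsp V))"
  proof (rule lipeq_cantor_split[OF K, of q])
    show "\<exists>n. q n x < 0 \<and> 1 < q n y" if "x \<noteq> y" for x y using q(2) that .
  qed (use q(1) in auto)
  \<comment> \<open>One term of the c0-sum is split into functions on \<open>K\<close> and
    \<open>V\<close>, and the functions on \<open>K\<close> into those on \<open>F\<close> and those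
    vanishing there; \<open>?W1\<close> collects everything but the latter.\<close>
  let ?W1 = "gprod (gprod (fsp (CF F {})) (fsp V)) (gc0 ?C)"
  have 1: "lipeq (gprod ?X ?W1) (gc0 ?C)"
  proof -
    have "lipeq (gc0 ?C) (gprod ?C (gc0 ?C))" by (intro lipeq_gc0_split ok)
    also have "lipeq \<dots> (gprod (gprod (fsp (CF K {})) (fsp V)) (gc0 ?C))"
      by (intro lipeq_gprod V lipeq_refl ok)
    also have "lipeq \<dots> (gprod (gprod (gprod (fsp (CF F {})) ?X) (fsp V)) (gc0 ?C))"
      by (intro lipeq_gprod lipeq_refl ok V lipeq_CF_restrict K F empty_subsetI)
    also have "lipeq \<dots> (gprod (gprod (gprod ?X (fsp (CF F {}))) (fsp V)) (gc0 ?C))"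
      by (intro lipeq_gprod lipeq_gprod_comm lipeq_refl ok V)
    also have "lipeq \<dots> (gprod (gprod ?X (gprod (fsp (CF F {})) (fsp V))) (gc0 ?C))"
      by (intro lipeq_gprod lipeq_gprod_assoc lipeq_refl ok V)
    also have "lipeq \<dots> (gprod ?X ?W1)"
      by (intro lipeq_gprod_assoc ok V)
    finally show ?thesis by (rule lipeq_sym)
  qed
  obtain r where r: "r > 0" "cball x0 r \<inter> F = {}"
  proof -
    obtain r where "r > 0" "\<forall>y. dist y x0 < r \<longrightarrow> y \<notin> F"
      using F(1) Q(5) unfolding closed_def open_dist by blast
    then have "cball x0 (r / 2) \<inter> F = {}" by (auto simp: dist_commute)
    then show ?thesis using that[of "r / 2"] \<open>r > 0\<close> by simp
  qed
  obtain e e' D where D: "homeomorphism cantor D e e'" "D \<subseteq> Q" "D \<subseteq> cball x0 r"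
    by (rule cantor_embedding[OF Q(1,3,4) r(1)])
  have clD: "closed D"
    using D(1) compact_continuous_image[OF _ compact_cantor, of e] compact_imp_closed
    by (auto simp: homeomorphism_def)
  let ?o = "(\<lambda>_. 0) :: nat \<Rightarrow> real"
  \<comment> \<open>Functions on the copy of the Cantor space are split once more, at the zero
    sequence. The value there and the functions that vanish on \<open>F\<close> and \<open>D\<close>
    are left over.\<close>
  let ?W2 = "gprod (fsp (CF {?o} {})) (fsp (CF K (F \<union> D)))"
  have 2: "lipeq ?X (gprod (gc0 ?C) ?W2)"
  proof -
    have DK: "F \<union> D \<subseteq> K" "F \<inter> D = {}" "closed (F \<union> D)" using D F Q(2) r clD by auto
    have eq: "CF (F \<union> D) F = CF D {}" by (rule CF_Un_disjoint[OF F(1) clD DK(2)])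
    have "lipeq ?X (gprod (fsp (CF (F \<union> D) F)) (fsp (CF K (F \<union> D))))"
      by (intro lipeq_CF_restrict K DK Un_upper1)
    also have "lipeq \<dots> (gprod ?C (fsp (CF K (F \<union> D))))"
      unfolding eq by (intro lipeq_gprod lipeq_refl ok lipeq_sym[OF lipeq_CF_homeomorphism[OF D(1)]])
    also have "lipeq \<dots> (gprod (gprod (fsp (CF {?o} {})) (gc0 ?C)) (fsp (CF K (F \<union> D))))"
    proof (intro lipeq_gprod lipeq_refl ok)
      have "lipeq ?C (gprod (fsp (CF {?o} {})) (fsp (CF cantor {?o})))"
        by (intro lipeq_CF_restrict compact_cantor) auto
      also have "lipeq \<dots> (gprod (fsp (CF {?o} {})) (gc0 ?C))"
        by (intro lipeq_gprod lipeq_refl ok lipeq_cantor_gc0)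
      finally show "lipeq ?C (gprod (fsp (CF {?o} {})) (gc0 ?C))" .
    qed
    also have "lipeq \<dots> (gprod (gprod (gc0 ?C) (fsp (CF {?o} {}))) (fsp (CF K (F \<union> D))))"
      by (intro lipeq_gprod lipeq_gprod_comm lipeq_refl ok)
    also have "lipeq \<dots> (gprod (gc0 ?C) ?W2)"
      by (intro lipeq_gprod_assoc ok)
    finally show ?thesis .
  qed
  show ?thesis
    by (rule lipeq_pelczynski[OF _ _ _ _ 1 2]) (intro ok V)+
qed

section \<open>Characters of commutative C*-algebras\<close>

lemma scaleC_diff_right: "scaleC c (x - y) = scaleC c x - scaleC c (y :: 'a::unital_cstar_algebra)"
  using scaleC_add_right[of c "x - y" y] by (simp add: eq_diff_eq)

lemma scaleC_minus_left: "scaleC (- c) x = - scaleC c (x :: 'a::unital_cstar_algebra)"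
  using scaleC_scaleC[of "-1" c x] scaleC_of_real[of "-1" "scaleC c x"] by simp

lemma scaleC_one [simp]: "scaleC 1 x = (x :: 'a::unital_cstar_algebra)"
  using scaleC_of_real[of 1 x] by simp

lemma star_zero [simp]: "star (0 :: 'a::unital_cstar_algebra) = 0"
proof -
  have "star (0 :: 'a) = star (0 + 0)" by simp
  then show ?thesis unfolding star_add by simp
qed

lemma star_minus: "star (- x) = - star (x :: 'a::unital_cstar_algebra)"
  using star_add[of x "- x"] by (simp add: eq_neg_iff_add_eq_0 add.commute)

lemma star_diff: "star (x - y) = star x - star (y :: 'a::unital_cstar_algebra)"
  using star_add[of x "- y"] by (simp add: star_minus)

lemma star_scaleR: "star (r *\<^sub>R x) = r *\<^sub>R star (x :: 'a::unital_cstar_algebra)"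
  by (simp flip: scaleC_of_real add: star_scaleC)

lemma star_one [simp]: "star (1 :: 'a::unital_cstar_algebra) = 1"
proof -
  have "1 = star (star (1 :: 'a) * 1)" by (simp add: star_star)
  also have "\<dots> = star 1" unfolding star_mult star_star by simp
  finally show ?thesis by simp
qed

lemma norm_star [simp]: "norm (star x) = norm (x :: 'a::unital_cstar_algebra)"
proof -
  have le: "norm x \<le> norm (star x)" for x :: 'a
  proof (cases "x = 0")
    case False
    have "norm x * norm x \<le> norm (star x) * norm x"
      using norm_mult_ineq[of "star x" x] cstar_identity[of x] by (simp add: power2_eq_square)
    then show ?thesis using False by simp
  qed simp
  show ?thesis using le[of x] le[of "star x"] by (simp add: star_star)
qed

lemma continuous_star: "continuous_on S (star :: 'a::unital_cstar_algebra \<Rightarrow> 'a)"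
proof (rule continuous_onI)
  fix x :: 'a and e :: real assume "x \<in> S" "0 < e"
  then show "\<exists>d>0. \<forall>x'\<in>S. dist x' x < d \<longrightarrow> dist (star x') (star x) \<le> e"
    by (intro exI[of _ e]) (simp add: dist_norm flip: star_diff)
qed

definition self_adjoint :: "'a::unital_cstar_algebra set" where
  "self_adjoint = {a. star a = a}"

lemma self_adjoint_intros:
  "(0 :: 'a::unital_cstar_algebra) \<in> self_adjoint"
  "(1 :: 'a) \<in> self_adjoint"
  "a \<in> self_adjoint \<Longrightarrow> b \<in> self_adjoint \<Longrightarrow> a + b \<in> self_adjoint"
  "a \<in> self_adjoint \<Longrightarrow> b \<in> self_adjoint \<Longrightarrow> a - b \<in> self_adjoint"
  "a \<in> self_adjoint \<Longrightarrow> - a \<in> self_adjoint"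
  "a \<in> self_adjoint \<Longrightarrow> r *\<^sub>R a \<in> self_adjoint"
  for a b :: "'a::unital_cstar_algebra"
  by (simp_all add: self_adjoint_def star_add star_diff star_minus star_scaleR)

lemma closed_self_adjoint: "closed (self_adjoint :: 'a::unital_cstar_algebra set)"
  unfolding self_adjoint_def by (intro closed_Collect_eq continuous_star continuous_on_id)

lemma norm_square_self_adjoint: "a \<in> self_adjoint \<Longrightarrow> norm (a * a) = (norm a)\<^sup>2"
  for a :: "'a::unital_cstar_algebra"
  using cstar_identity[of a] by (simp add: self_adjoint_def)

section \<open>Square roots and positive elements\<close>

locale commutative_cstar =
  fixes A :: "'a::unital_cstar_algebra itself"
  assumes commute: "\<And>x y :: 'a. x * y = y * x"
begin

lemma self_adjoint_mult: "a \<in> self_adjoint \<Longrightarrow> b \<in> self_adjoint \<Longrightarrow> a * b \<in> self_adjoint" for a b :: 'a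
  using commute by (simp add: self_adjoint_def star_mult)

lemma self_adjoint_power: "a \<in> self_adjoint \<Longrightarrow> a ^ n \<in> self_adjoint" for a :: 'a
  by (induction n) (auto intro: self_adjoint_intros self_adjoint_mult)

lemmas sa = self_adjoint_intros self_adjoint_mult self_adjoint_power

text \<open>For u = a + i b one has u* u = a^2 + b^2 and 2 a = u + u*, so the C*-identity gives the
  estimate. It is the one place where the order structure is drawn from the norm, and it stands in
  for spectral theory.\<close>

lemma norm_sum_squares:
  fixes a b :: 'a
  assumes a: "a \<in> self_adjoint" and b: "b \<in> self_adjoint"
  shows "(norm a)\<^sup>2 \<le> norm (a * a + b * b)"
proof -
  define u where "u = a + scaleC \<i> b"
  have su: "star u = a - scaleC \<i> b"
    using a b scaleC_scaleC[of "-1" "\<i>" b] scaleC_of_real[of "-1" "scaleC \<i> b"]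
    by (simp add: u_def star_add star_scaleC self_adjoint_def)
  have "star u * u = a * a + b * b"
    using commute[of b a] scaleC_of_real[of "-1" "b * b"]
    unfolding su unfolding u_def by (simp add: algebra_simps mult_scaleC_left mult_scaleC_right scaleC_scaleC scaleC_diff_right)
  then have u: "(norm u)\<^sup>2 = norm (a * a + b * b)" using cstar_identity[of u] by simp
  have "2 *\<^sub>R a = u + star u" unfolding su unfolding u_def by (simp add: scaleR_2)
  then have "2 * norm a = norm (u + star u)" using norm_scaleR[of 2 a] by simp
  also have "\<dots> \<le> 2 * norm u" using norm_triangle_ineq[of u "star u"] by simp
  finally have "norm a \<le> norm u" by simp
  then show ?thesis using u by (metis norm_ge_zero power_mono)
qed

text \<open>With s = 1 - w the equation s^2 = 1 - x becomes w = (x + w^2) / 2. Its right-hand side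
  maps the ball of radius \<open>norm x\<close> to itself and contracts it by the factor
  \<open>norm x\<close>.\<close>

lemma sqrt_exists:
  fixes x :: 'a
  assumes x: "x \<in> self_adjoint" and "norm x < 1"
  obtains s where "s \<in> self_adjoint" "s * s = 1 - x"
proof -
  let ?r = "norm x" and ?f = "\<lambda>w. (1 / 2) *\<^sub>R (x + w * w)"
  let ?S = "cball 0 ?r \<inter> (self_adjoint :: 'a set)"
  have "\<exists>!w\<in>?S. ?f w = w"
  proof (rule Banach_fix[where c = ?r])
    have "closed ?S" using closed_self_adjoint by (intro closed_Int) auto
    then show "complete ?S" by (simp add: complete_eq_closed)
    have "0 \<in> ?S" by (simp add: self_adjoint_intros)
    then show "?S \<noteq> {}" by blast
    show "?f ` ?S \<subseteq> ?S"
    proof (clarify, intro IntI)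
      fix w :: 'a assume w: "w \<in> cball 0 ?r" "w \<in> self_adjoint"
      have "norm (w * w) \<le> norm w * norm w" by (rule norm_mult_ineq)
      also have "\<dots> \<le> ?r * ?r" using w by (intro mult_mono) auto
      also have "\<dots> \<le> ?r" using assms by (simp add: mult_left_le)
      finally have "norm (x + w * w) \<le> 2 * ?r" using norm_triangle_ineq[of x "w * w"] by linarith
      then show "?f w \<in> cball 0 ?r" by simp
      show "?f w \<in> self_adjoint" using w x by (intro sa)
    qed
    fix w v :: 'a assume wv: "w \<in> ?S" "v \<in> ?S"
    have "?f w - ?f v = (1 / 2) *\<^sub>R ((w - v) * (w + v))"
      using commute[of w v] by (simp add: algebra_simps)
    then have "dist (?f w) (?f v) = (1 / 2) * norm ((w - v) * (w + v))"
      unfolding dist_norm by simp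
    also have "\<dots> \<le> (1 / 2) * (norm (w - v) * (norm w + norm v))"
      by (intro mult_left_mono order_trans[OF norm_mult_ineq] norm_triangle_ineq) auto
    also have "\<dots> \<le> (1 / 2) * (norm (w - v) * (?r + ?r))"
      using wv by (intro mult_left_mono add_mono) auto
    finally show "dist (?f w) (?f v) \<le> ?r * dist w v" by (simp add: dist_norm mult.commute)
  qed (use assms in auto)
  then obtain w where w: "w \<in> self_adjoint" "?f w = w" by auto
  have "x + w * w = 2 *\<^sub>R ((1 / 2) *\<^sub>R (x + w * w))" by simp
  also have "\<dots> = w + w" unfolding w(2) by (simp add: scaleR_2)
  finally have "(1 - w) * (1 - w) = 1 - x" by (simp add: algebra_simps)
  moreover have "1 - w \<in> self_adjoint" using w by (intro sa)
  ultimately show ?thesis using that by blast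
qed

text \<open>Positivity read off from the norm: for a real function, being within \<open>c\<close> of
  the constant \<open>c\<close> means taking values in [0, 2 c].\<close>

definition nonneg :: "'a \<Rightarrow> bool" where
  "nonneg x \<longleftrightarrow> x \<in> self_adjoint \<and> (\<exists>c\<ge>0. norm (c *\<^sub>R 1 - x) \<le> c)"

text \<open>If \<open>s\<close> is a square root of 1 - y^2, then s^2 + y^2 = 1, and
  \<open>norm_sum_squares\<close> bounds \<open>s\<close>.\<close>

lemma norm_one_minus_square:
  fixes y :: 'a
  assumes y: "y \<in> self_adjoint" and n: "norm y < 1"
  shows "norm (1 - y * y) \<le> 1"
proof -
  have "norm (y * y) < 1"
    using norm_square_self_adjoint[OF y] n by (simp add: power_less_one_iff)
  then obtain s where s: "s \<in> self_adjoint" "s * s = 1 - y * y"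
    by (rule sqrt_exists[OF self_adjoint_mult[OF y y]])
  have "(norm s)\<^sup>2 \<le> norm (s * s + y * y)" by (rule norm_sum_squares[OF s(1) y])
  then show ?thesis using s norm_square_self_adjoint[OF s(1)] by simp
qed

lemma norm_minus_square:
  fixes y :: 'a
  assumes y: "y \<in> self_adjoint" and c: "(norm y)\<^sup>2 \<le> c"
  shows "norm (c *\<^sub>R 1 - y * y) \<le> c"
proof -
  have strict: "norm (d *\<^sub>R 1 - y * y) \<le> d" if d: "(norm y)\<^sup>2 < d" for d
  proof -
    have d0: "d > 0" using d by (meson le_less_trans zero_le_power2)
    let ?y = "(1 / sqrt d) *\<^sub>R y"
    have "norm y < sqrt d" using d by (simp add: real_less_rsqrt)
    then have "norm ?y < 1" using d0 by simp
    then have "norm (1 - ?y * ?y) \<le> 1" using y by (intro norm_one_minus_square sa)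
    moreover have "d *\<^sub>R (1 - ?y * ?y) = d *\<^sub>R 1 - y * y"
      using d0 by (simp add: algebra_simps)
    ultimately have "norm (d *\<^sub>R 1 - y * y) = d * norm (1 - ?y * ?y)"
      using d0 norm_scaleR[of d "1 - ?y * ?y"] by simp
    also have "\<dots> \<le> d * 1" using d0 \<open>norm (1 - ?y * ?y) \<le> 1\<close> by (intro mult_left_mono) auto
    finally show ?thesis by simp
  qed
  show ?thesis
  \<comment> \<open>Square roots exist only under a strict norm bound, so the boundary case is
    approached from \<open>c + e / 2\<close>.\<close>
  proof (rule field_le_epsilon)
    fix e :: real assume e: "e > 0"
    have "norm (c *\<^sub>R 1 - y * y) \<le> norm ((c + e / 2) *\<^sub>R 1 - y * y) + norm ((e / 2) *\<^sub>R (1 :: 'a))"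
      using norm_triangle_ineq4[of "(c + e / 2) *\<^sub>R 1 - y * y" "(e / 2) *\<^sub>R (1 :: 'a)"] by (simp add: algebra_simps)
    also have "\<dots> \<le> (c + e / 2) + e / 2"
      using strict[of "c + e / 2"] c e by simp
    finally show "norm (c *\<^sub>R 1 - y * y) \<le> c + e" by simp
  qed
qed

lemma nonneg_sa: "nonneg x \<Longrightarrow> x \<in> self_adjoint"
  by (simp add: nonneg_def)

lemma nonneg_square: "y \<in> self_adjoint \<Longrightarrow> nonneg (y * y)"
  unfolding nonneg_def using norm_minus_square[of y "(norm y)\<^sup>2"]
  by (intro conjI exI[of _ "(norm y)\<^sup>2"] sa) auto

lemma nonneg_add:
  assumes "nonneg x" "nonneg y"
  shows "nonneg (x + y)"
proof -
  obtain c d where "c \<ge> 0" "d \<ge> 0" "norm (c *\<^sub>R 1 - x) \<le> c" "norm (d *\<^sub>R 1 - y) \<le> d"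
    using assms unfolding nonneg_def by blast
  then have "norm ((c + d) *\<^sub>R 1 - (x + y)) \<le> c + d"
    using norm_triangle_ineq[of "c *\<^sub>R 1 - x" "d *\<^sub>R 1 - y"] by (simp add: algebra_simps)
  then show ?thesis using assms \<open>c \<ge> 0\<close> \<open>d \<ge> 0\<close> unfolding nonneg_def
    by (intro conjI exI[of _ "c + d"] sa) auto
qed

lemma nonneg_diff_norm:
  assumes "a \<in> self_adjoint" "norm a \<le> c"
  shows "nonneg (c *\<^sub>R 1 - a)"
proof -
  have "c \<ge> 0" using assms(2) norm_ge_zero order_trans by blast
  then show ?thesis
    using assms unfolding nonneg_def by (intro conjI exI[of _ c] sa) auto
qed

lemma nonneg_add_norm:
  assumes "a \<in> self_adjoint" "norm a \<le> c"
  shows "nonneg (a + c *\<^sub>R 1)"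
  using nonneg_diff_norm[of "- a" c] assms by (simp add: add.commute sa)

text \<open>After rescaling by \<open>c + d\<close>, the shift by \<open>d\<close> makes the
  distance to 1 strictly less than 1, as \<open>sqrt_exists\<close> demands.\<close>

lemma nonneg_sqrt:
  assumes x: "nonneg x" and d: "d > 0"
  obtains y where "y \<in> self_adjoint" "y * y = x + d *\<^sub>R 1"
proof -
  obtain c where c: "c \<ge> 0" "norm (c *\<^sub>R 1 - x) \<le> c" using x unfolding nonneg_def by blast
  let ?z = "(1 / (c + d)) *\<^sub>R (c *\<^sub>R 1 - x)"
  have "norm ?z = norm (c *\<^sub>R 1 - x) / (c + d)" using c(1) d by simp
  also have "\<dots> < 1" using c d by simp
  finally have "norm ?z < 1" .
  moreover have "?z \<in> self_adjoint" using nonneg_sa[OF x] by (intro sa)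
  ultimately obtain s where s: "s \<in> self_adjoint" "s * s = 1 - ?z" using sqrt_exists[of ?z] by blast
  have "(sqrt (c + d) *\<^sub>R s) * (sqrt (c + d) *\<^sub>R s) = (c + d) *\<^sub>R (s * s)" using c d by simp
  also have "\<dots> = (c + d) *\<^sub>R 1 - (c *\<^sub>R 1 - x)"
    unfolding s(2) scaleR_diff_right[of "c + d" 1] using c d by simp
  also have "\<dots> = x + d *\<^sub>R 1" by (simp add: algebra_simps)
  finally show ?thesis using that[of "sqrt (c + d) *\<^sub>R s"] s(1) by (simp add: sa)
qed

text \<open>The shifted factors have roots \<open>s\<close> and \<open>t\<close>, so their product
  is the square of \<open>s * t\<close>; then the shift tends to 0.\<close>

lemma nonneg_mult:
  assumes x: "nonneg x" and y: "nonneg y"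
  shows "nonneg (x * y)"
proof -
  \<comment> \<open>\<open>c\<close> dominates the norm of the shifted product for every shift
    \<open>d\<close> below 1, so it can be fixed before \<open>d\<close> tends to 0;
    \<open>M\<close> controls the error of order \<open>d\<close>.\<close>
  define c where "c = (norm x + 1) * (norm y + 1)"
  define M where "M = norm x + norm y + 1"
  have c0: "c \<ge> 0" by (simp add: c_def)
  have M0: "M > 0" by (simp add: M_def add_nonneg_pos)
  have le: "norm (c *\<^sub>R 1 - x * y) \<le> c + d * M" if d: "0 < d" "d < 1" for d
  proof -
    obtain s where s: "s \<in> self_adjoint" "s * s = x + d *\<^sub>R 1" using nonneg_sqrt[OF x d(1)] by metis
    obtain t where t: "t \<in> self_adjoint" "t * t = y + d *\<^sub>R 1" using nonneg_sqrt[OF y d(1)] by metis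
    have st: "(s * t) * (s * t) = (x + d *\<^sub>R 1) * (y + d *\<^sub>R 1)"
      unfolding s(2)[symmetric] t(2)[symmetric] using commute by (simp add: mult.assoc) (metis commute mult.assoc)
    have nx: "norm (x + d *\<^sub>R 1) \<le> norm x + 1" "norm (y + d *\<^sub>R 1) \<le> norm y + 1"
      using norm_triangle_ineq[of x "d *\<^sub>R 1"] norm_triangle_ineq[of y "d *\<^sub>R 1"] d by auto
    have "norm ((s * t) * (s * t)) \<le> c"
      unfolding st c_def by (rule order_trans[OF norm_mult_ineq]) (intro mult_mono nx, auto)
    then have "(norm (s * t))\<^sup>2 \<le> c"
      using norm_square_self_adjoint[of "s * t"] s(1) t(1) by (simp add: sa)
    then have "norm (c *\<^sub>R 1 - (s * t) * (s * t)) \<le> c"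
      using s(1) t(1) by (intro norm_minus_square sa)
    moreover have "norm (c *\<^sub>R 1 - x * y) \<le> norm (c *\<^sub>R 1 - (s * t) * (s * t)) + norm (d *\<^sub>R (x + y + d *\<^sub>R 1))"
    proof -
      have "c *\<^sub>R 1 - x * y = (c *\<^sub>R 1 - (s * t) * (s * t)) + d *\<^sub>R (x + y + d *\<^sub>R 1)"
        unfolding st by (simp add: algebra_simps)
      then show ?thesis by (metis norm_triangle_ineq)
    qed
    moreover have "norm (d *\<^sub>R (x + y + d *\<^sub>R 1)) \<le> d * M"
    proof -
      have "norm (x + y + d *\<^sub>R 1) \<le> M"
        using norm_triangle_ineq[of "x + y" "d *\<^sub>R 1"] norm_triangle_ineq[of x y] d by (simp add: M_def)
      then show ?thesis using d by simp
    qed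
    ultimately show ?thesis by linarith
  qed
  have "norm (c *\<^sub>R 1 - x * y) \<le> c"
  proof (rule field_le_epsilon)
    fix e :: real assume e: "e > 0"
    define d where "d = min (e / M) (1 / 2)"
    have "0 < d" "d < 1" using e M0 by (auto simp: d_def)
    moreover have "d * M \<le> e"
    proof -
      have "d * M \<le> (e / M) * M" using M0 by (intro mult_right_mono) (auto simp: d_def)
      then show ?thesis using M0 by simp
    qed
    ultimately show "norm (c *\<^sub>R 1 - x * y) \<le> c + e" using le[of d] by linarith
  qed
  then show ?thesis
    unfolding nonneg_def using c0 by (intro conjI exI[of _ c] sa nonneg_sa[OF x] nonneg_sa[OF y]) auto
qed

lemma nonneg_of_real: "r \<ge> 0 \<Longrightarrow> nonneg (r *\<^sub>R 1)"
  using nonneg_diff_norm[of 0 r] by (simp add: sa)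

lemma nonneg_zero: "nonneg 0"
  using nonneg_of_real[of 0] by simp

lemma nonneg_one: "nonneg 1"
  using nonneg_of_real[of 1] by simp

lemma nonneg_scaleR: "nonneg x \<Longrightarrow> r \<ge> 0 \<Longrightarrow> nonneg (r *\<^sub>R x)"
  using nonneg_mult[OF nonneg_of_real, of r x] by simp

text \<open>Up to a small shift, x and r - x are squares whose sum is a scalar, so
  \<open>norm_sum_squares\<close> bounds the first of them.\<close>

lemma nonneg_norm_le:
  assumes x: "nonneg x" and y: "nonneg (r *\<^sub>R 1 - x)" and r: "r \<ge> 0"
  shows "norm x \<le> r"
proof (rule field_le_epsilon)
  fix e :: real assume e: "e > 0"
  define d where "d = e / 3"
  have d: "d > 0" using e by (simp add: d_def)
  obtain s where s: "s \<in> self_adjoint" "s * s = x + d *\<^sub>R 1" using nonneg_sqrt[OF x d] by metis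
  obtain t where t: "t \<in> self_adjoint" "t * t = r *\<^sub>R 1 - x + d *\<^sub>R 1" using nonneg_sqrt[OF y d] by metis
  have "s * s + t * t = (r + 2 * d) *\<^sub>R 1" unfolding s t by (simp add: algebra_simps scaleR_2[symmetric])
  then have "norm (x + d *\<^sub>R 1) \<le> r + 2 * d"
    using norm_sum_squares[OF s(1) t(1)] norm_square_self_adjoint[OF s(1)] s(2) r d by simp
  moreover have "norm x \<le> norm (x + d *\<^sub>R 1) + d"
    using norm_triangle_ineq4[of "x + d *\<^sub>R 1" "d *\<^sub>R 1"] d by simp
  ultimately show "norm x \<le> r + e" unfolding d_def by linarith
qed

end

lemma scaleC_zero_right [simp]: "scaleC c 0 = (0 :: 'a::unital_cstar_algebra)"
  using scaleC_diff_right[of c 0 0] by simp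

lemma scaleC_minus_right: "scaleC c (- x) = - scaleC c (x :: 'a::unital_cstar_algebra)"
  using scaleC_diff_right[of c 0 x] by simp

section \<open>Maximal cones and real characters\<close>

context commutative_cstar
begin

text \<open>Characters are obtained from maximal cones rather than from maximal ideals: a maximal cone is a
  total order, and the character sends an element to its Dedekind cut among the scalars. No quotient
  algebra and no continuity argument is needed.\<close>

definition cone :: "'a set \<Rightarrow> bool" where
  "cone Q \<longleftrightarrow> Q \<subseteq> self_adjoint \<and> Collect nonneg \<subseteq> Q \<and>
     (\<forall>x\<in>Q. \<forall>y\<in>Q. x + y \<in> Q) \<and> (\<forall>r x. nonneg r \<longrightarrow> x \<in> Q \<longrightarrow> r * x \<in> Q)"

lemma coneD:
  assumes "cone Q"
  shows "x \<in> Q \<Longrightarrow> x \<in> self_adjoint" "nonneg x \<Longrightarrow> x \<in> Q" "x \<in> Q \<Longrightarrow> y \<in> Q \<Longrightarrow> x + y \<in> Q"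
    "nonneg r \<Longrightarrow> x \<in> Q \<Longrightarrow> r * x \<in> Q"
  using assms unfolding cone_def by auto

lemma cone_scaleR: "cone Q \<Longrightarrow> x \<in> Q \<Longrightarrow> r \<ge> 0 \<Longrightarrow> r *\<^sub>R x \<in> Q"
  using coneD(4)[of Q "r *\<^sub>R 1" x] nonneg_of_real by simp

lemma cone_adjoin:
  assumes Q: "cone Q" and a: "a \<in> self_adjoint"
  shows "cone {q + r * a | q r. q \<in> Q \<and> nonneg r}"
  unfolding cone_def
proof (intro conjI subsetI ballI allI impI)
  fix x assume "x \<in> {q + r * a | q r. q \<in> Q \<and> nonneg r}"
  then obtain q r where x: "x = q + r * a" "q \<in> Q" "nonneg r" by blast
  show "x \<in> self_adjoint"
    unfolding x(1) using coneD(1)[OF Q x(2)] nonneg_sa[OF x(3)] a by (intro sa)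
  fix s :: 'a assume s: "nonneg s"
  have "s * x = s * q + (s * r) * a" by (simp add: x algebra_simps)
  then show "s * x \<in> {q + r * a | q r. q \<in> Q \<and> nonneg r}"
    using coneD(4)[OF Q s x(2)] nonneg_mult[OF s x(3)] by blast
next
  fix x assume "x \<in> Collect nonneg"
  then have "x \<in> Q" using coneD(2)[OF Q] by simp
  then have "x = x + 0 * a" "x \<in> Q" "nonneg 0" using nonneg_zero by auto
  then show "x \<in> {q + r * a | q r. q \<in> Q \<and> nonneg r}" by blast
next
  fix x y assume "x \<in> {q + r * a | q r. q \<in> Q \<and> nonneg r}" "y \<in> {q + r * a | q r. q \<in> Q \<and> nonneg r}"
  then obtain q r q' r' where x: "x = q + r * a" "q \<in> Q" "nonneg r" "y = q' + r' * a" "q' \<in> Q" "nonneg r'" by blast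
  have "x + y = (q + q') + (r + r') * a" by (simp add: x algebra_simps)
  then show "x + y \<in> {q + r * a | q r. q \<in> Q \<and> nonneg r}"
    using coneD(3)[OF Q x(2,5)] nonneg_add[OF x(3,6)] by blast
qed

text \<open>Zorn's lemma gives a maximal cone. If it contained neither a nor -a, then -1 = q + r a =
  q' - r' a; eliminating a puts -r into the cone, then r a, and finally -1.\<close>

lemma maximal_cone_exists:
  assumes Q: "cone Q" "- 1 \<notin> Q"
  obtains M where "cone M" "Q \<subseteq> M" "- 1 \<notin> M" "\<And>a. a \<in> self_adjoint \<Longrightarrow> a \<in> M \<or> - a \<in> M"
proof -
  let ?C = "{P. cone P \<and> Q \<subseteq> P \<and> - 1 \<notin> P}"
  have "\<exists>M\<in>?C. \<forall>X\<in>?C. M \<subseteq> X \<longrightarrow> X = M"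
  proof (rule subset_Zorn_nonempty)
    show "?C \<noteq> {}" using Q by blast
    fix \<C> assume C: "\<C> \<noteq> {}" "subset.chain ?C \<C>"
    have sub: "\<C> \<subseteq> ?C" using C(2) by (simp add: subset.chain_def)
    have tot: "X \<subseteq> Y \<or> Y \<subseteq> X" if "X \<in> \<C>" "Y \<in> \<C>" for X Y
      using C(2) that by (auto simp: subset.chain_def)
    have "cone (\<Union>\<C>)"
      unfolding cone_def
    proof (intro conjI ballI allI impI)
      show "\<Union>\<C> \<subseteq> self_adjoint" using sub by (auto simp: cone_def)
      obtain X where "X \<in> \<C>" using C(1) by blast
      then have "Collect nonneg \<subseteq> X" using sub by (auto simp: cone_def)
      then show "Collect nonneg \<subseteq> \<Union>\<C>" using \<open>X \<in> \<C>\<close> by blast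
      show "r * x \<in> \<Union>\<C>" if r: "nonneg r" and x: "x \<in> \<Union>\<C>" for r x
      proof -
        obtain X where X: "X \<in> \<C>" "x \<in> X" using x by blast
        then have "cone X" using sub by blast
        then show ?thesis using coneD(4)[OF _ r X(2)] X(1) by blast
      qed
      fix x y assume "x \<in> \<Union>\<C>" "y \<in> \<Union>\<C>"
      then obtain X Y where XY: "X \<in> \<C>" "Y \<in> \<C>" "x \<in> X" "y \<in> Y" by blast
      then have "cone X" "cone Y" using sub by blast+
      then have "x + y \<in> X \<or> x + y \<in> Y"
        using tot[OF XY(1,2)] XY(3,4) coneD(3)[of X x y] coneD(3)[of Y x y] by blast
      then show "x + y \<in> \<Union>\<C>" using XY by blast
    qed
    then show "\<Union>\<C> \<in> ?C" using sub C(1) by auto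
  qed
  then obtain M where M: "cone M" "Q \<subseteq> M" "- 1 \<notin> M" and max: "\<And>X. cone X \<Longrightarrow> - 1 \<notin> X \<Longrightarrow> M \<subseteq> X \<Longrightarrow> X = M"
    by auto
  have adjoin: "\<exists>q r. q \<in> M \<and> nonneg r \<and> - 1 = q + r * a" if a: "a \<in> self_adjoint" "a \<notin> M" for a
  proof -
    let ?X = "{q + r * a | q r. q \<in> M \<and> nonneg r}"
    have "x \<in> ?X" if "x \<in> M" for x
    proof -
      have "x = x + 0 * a" by simp
      then show ?thesis using that nonneg_zero by blast
    qed
    then have "M \<subseteq> ?X" by blast
    moreover have "a \<in> ?X"
    proof -
      have "a = 0 + 1 * a" by simp
      then show ?thesis using nonneg_one coneD(2)[OF M(1) nonneg_zero] by blast
    qed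
    ultimately have "- 1 \<in> ?X" using max[OF cone_adjoin[OF M(1) a(1)]] a(2) by blast
    then show ?thesis by blast
  qed
  have "a \<in> M \<or> - a \<in> M" if a: "a \<in> self_adjoint" for a
  proof (rule ccontr)
    assume not: "\<not> (a \<in> M \<or> - a \<in> M)"
    obtain q r where qr: "q \<in> M" "nonneg r" "- 1 = q + r * a" using adjoin a not by blast
    obtain q' r' where qr': "q' \<in> M" "nonneg r'" "- 1 = q' + r' * - a"
      using adjoin[of "- a"] not a by (auto simp: sa)
    \<comment> \<open>Multiplying the first equation by \<open>r'\<close> and the second by
      \<open>r\<close> makes the terms with \<open>a\<close> opposite, so that they cancel in the
      sum.\<close>
    have e1: "- r' = r' * q + r' * r * a"
      using arg_cong[OF qr(3), of "\<lambda>z. r' * z"] by (simp add: algebra_simps)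
    have e2: "- r = r * q' - r' * r * a"
      using arg_cong[OF qr'(3), of "\<lambda>z. r * z"] commute[of r' r] by (simp add: algebra_simps)
    have "(r' * q + r * q') + r' = (r' * q + r' * r * a) + (r * q' - r' * r * a) + r'" by simp
    also have "\<dots> = - r" unfolding e1[symmetric] e2[symmetric] by simp
    finally have "- r = (r' * q + r * q') + r'" by simp
    moreover have "r' * q \<in> M" "r * q' \<in> M" "r' \<in> M"
      using coneD(2,4)[OF M(1)] qr qr' by blast+
    ultimately have mr: "- r \<in> M" using coneD(3)[OF M(1)] by simp
    \<comment> \<open>Both \<open>r\<close> and \<open>- r\<close> lie in \<open>M\<close>, so the
      sign of \<open>a\<close> no longer matters: shifting \<open>a\<close> by its norm makes the
      first summand positive, and the correction is a multiple of \<open>- r\<close>.\<close>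
    have "r * a = (a + norm a *\<^sub>R 1) * r + norm a *\<^sub>R (- r)"
      using commute[of r a] by (simp add: algebra_simps)
    moreover have "(a + norm a *\<^sub>R 1) * r \<in> M"
      using nonneg_add_norm[OF a order_refl] qr(2) by (intro coneD(2)[OF M(1)] nonneg_mult)
    moreover have "norm a *\<^sub>R (- r) \<in> M" using mr by (intro cone_scaleR[OF M(1)]) auto
    ultimately have "r * a \<in> M" by (metis coneD(3)[OF M(1)])
    then show False using qr(1,3) coneD(3)[OF M(1)] M(3) by metis
  qed
  then show ?thesis using that M by blast
qed

definition real_character :: "('a \<Rightarrow> real) \<Rightarrow> bool" where
  "real_character \<phi> \<longleftrightarrow> \<phi> 1 = 1 \<and> (\<forall>a\<in>self_adjoint. \<forall>b\<in>self_adjoint.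
     \<phi> (a + b) = \<phi> a + \<phi> b \<and> \<phi> (a * b) = \<phi> a * \<phi> b) \<and> (\<forall>a\<in>self_adjoint. \<forall>r. \<phi> (r *\<^sub>R a) = r * \<phi> a)"

lemma total_cone_character:
  assumes M: "cone M" "- 1 \<notin> M" and total: "\<And>a. a \<in> self_adjoint \<Longrightarrow> a \<in> M \<or> - a \<in> M"
  obtains \<phi> where "real_character \<phi>" "\<And>a. a \<in> M \<Longrightarrow> 0 \<le> \<phi> a"
proof -
  note M_add = coneD(3)[OF M(1)] and M_mult = coneD(4)[OF M(1)] and M_nonneg = coneD(2)[OF M(1)]
    and M_sa = coneD(1)[OF M(1)] and M_scale = cone_scaleR[OF M(1)]
  have const: "r \<ge> 0" if "r *\<^sub>R 1 \<in> M" for r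
  proof (rule ccontr)
    assume "\<not> r \<ge> 0"
    then have "(1 / - r) *\<^sub>R (r *\<^sub>R 1) \<in> M" using M_scale[OF that, of "1 / - r"] by simp
    then show False using M(2) \<open>\<not> r \<ge> 0\<close> by simp
  qed
  define T where "T a = {t :: real. a - t *\<^sub>R 1 \<in> M}" for a
  define \<phi> where "\<phi> a = Sup (T a)" for a
  have T_ub: "t \<le> u" if "t \<in> T a" "u *\<^sub>R 1 - a \<in> M" for t u a
  proof -
    have "(u - t) *\<^sub>R 1 \<in> M"
      using M_add[OF that(2), of "a - t *\<^sub>R 1"] that(1) by (simp add: T_def algebra_simps)
    then show ?thesis using const by fastforce
  qed
  have T_ne: "- norm a \<in> T a" and T_bdd: "norm a *\<^sub>R 1 - a \<in> M" if "a \<in> self_adjoint" for a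
    using nonneg_add_norm[OF that order_refl] nonneg_diff_norm[OF that order_refl] M_nonneg by (auto simp: T_def)
  have bdd: "bdd_above (T a)" if "a \<in> self_adjoint" for a
    using T_ub[OF _ T_bdd[OF that]] by (intro bdd_aboveI) blast
  have le_phi: "t \<le> \<phi> a" if "a - t *\<^sub>R 1 \<in> M" "a \<in> self_adjoint" for a t
    unfolding \<phi>_def using that bdd by (intro cSup_upper) (auto simp: T_def)
  have phi_le: "\<phi> a \<le> u" if "u *\<^sub>R 1 - a \<in> M" "a \<in> self_adjoint" for a u
    unfolding \<phi>_def using T_ne[OF that(2)] T_ub[OF _ that(1)] by (intro cSup_least) auto
  have above: "u *\<^sub>R 1 - a \<in> M" if a: "a \<in> self_adjoint" "\<phi> a < u" for a u
  proof -
    have "a - u *\<^sub>R 1 \<notin> M" using le_phi a by force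
    then have "- (a - u *\<^sub>R 1) \<in> M" using total[of "a - u *\<^sub>R 1"] a by (auto simp: sa)
    then show ?thesis by simp
  qed
  have below: "a - t *\<^sub>R 1 \<in> M" if a: "a \<in> self_adjoint" "t < \<phi> a" for a t
  proof -
    have "t *\<^sub>R 1 - a \<notin> M" using phi_le a by force
    then have "- (t *\<^sub>R 1 - a) \<in> M" using total[of "t *\<^sub>R 1 - a"] a by (auto simp: sa)
    then show ?thesis by simp
  qed
  have phi_real: "\<phi> (r *\<^sub>R 1) = r" for r
  proof -
    have "0 \<in> M" using M_nonneg nonneg_zero by blast
    moreover have "r *\<^sub>R 1 \<in> (self_adjoint :: 'a set)" by (intro sa)
    ultimately show ?thesis using le_phi[of "r *\<^sub>R 1" r] phi_le[of r "r *\<^sub>R 1"] by simp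
  qed
  have phi_pos: "0 \<le> \<phi> a" if "a \<in> M" for a
    using le_phi[of a 0] that M_sa by simp
  have phi_add: "\<phi> (a + b) = \<phi> a + \<phi> b" if a: "a \<in> self_adjoint" and b: "b \<in> self_adjoint" for a b
  proof (rule antisym; rule field_le_epsilon)
    fix e :: real assume e: "e > 0"
    have "(\<phi> a + e / 2) *\<^sub>R 1 - a + ((\<phi> b + e / 2) *\<^sub>R 1 - b) \<in> M"
      using above[OF a, of "\<phi> a + e / 2"] above[OF b, of "\<phi> b + e / 2"] e by (intro M_add) auto
    moreover have "(\<phi> a + e / 2) *\<^sub>R 1 - a + ((\<phi> b + e / 2) *\<^sub>R 1 - b) = (\<phi> a + \<phi> b + e) *\<^sub>R 1 - (a + b)"
      using scaleR_left_distrib[of "\<phi> a + e / 2" "\<phi> b + e / 2" "1::'a"] by (simp add: algebra_simps)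
    ultimately show "\<phi> (a + b) \<le> \<phi> a + \<phi> b + e" using a b by (intro phi_le) (auto simp: sa)
    have "a - (\<phi> a - e / 2) *\<^sub>R 1 + (b - (\<phi> b - e / 2) *\<^sub>R 1) \<in> M"
      using below[OF a, of "\<phi> a - e / 2"] below[OF b, of "\<phi> b - e / 2"] e by (intro M_add) auto
    moreover have "a - (\<phi> a - e / 2) *\<^sub>R 1 + (b - (\<phi> b - e / 2) *\<^sub>R 1) = (a + b) - (\<phi> a + \<phi> b - e) *\<^sub>R 1"
      using scaleR_left_distrib[of "\<phi> a - e / 2" "\<phi> b - e / 2" "1::'a"] by (simp add: algebra_simps)
    ultimately have "\<phi> a + \<phi> b - e \<le> \<phi> (a + b)" using a b by (intro le_phi) (auto simp: sa)
    then show "\<phi> a + \<phi> b \<le> \<phi> (a + b) + e" by simp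
  qed
  have phi_diff: "\<phi> (a - b) = \<phi> a - \<phi> b" if a: "a \<in> self_adjoint" and b: "b \<in> self_adjoint" for a b
    using phi_add[of "a - b" b] a b by (simp add: sa)
  \<comment> \<open>\<open>\<phi> a = 0\<close> places both a and -a below every scalar d > 0 in the
    order of \<open>M\<close>. Multiplying by the positive \<open>b\<close> bounds a b and its
    negative by d b, hence by d times \<open>norm b\<close>.\<close>
  have null1: "\<phi> (a * b) = 0" if a: "a \<in> self_adjoint" "\<phi> a = 0" and b: "nonneg b" for a b
  proof -
    have bs: "b \<in> self_adjoint" using nonneg_sa b .
    have "\<bar>\<phi> (a * b)\<bar> \<le> 0 + e" if e: "e > 0" for e
    proof -
      define d where "d = e / (norm b + 1)"
      have nb: "norm b + 1 > 0" by (simp add: add_nonneg_pos)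
      have d: "d > 0" using e nb by (simp add: d_def)
      have db: "d * norm b \<le> e" using e nb by (simp add: d_def field_simps)
      have "b * (d *\<^sub>R 1 - a) \<in> M" using above[OF a(1), of d] a(2) d b by (intro M_mult) auto
      moreover have "d *\<^sub>R (norm b *\<^sub>R 1 - b) \<in> M"
        using T_bdd[OF bs] d by (intro M_scale) auto
      ultimately have "b * (d *\<^sub>R 1 - a) + d *\<^sub>R (norm b *\<^sub>R 1 - b) \<in> M" by (rule M_add)
      moreover have "b * (d *\<^sub>R 1 - a) + d *\<^sub>R (norm b *\<^sub>R 1 - b) = (d * norm b) *\<^sub>R 1 - a * b"
        using commute[of b a] by (simp add: algebra_simps)
      ultimately have 1: "\<phi> (a * b) \<le> d * norm b" using a bs by (intro phi_le) (auto simp: sa)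
      have "b * (a - (- d) *\<^sub>R 1) \<in> M" using below[OF a(1), of "- d"] a(2) d b by (intro M_mult) auto
      moreover have "d *\<^sub>R (norm b *\<^sub>R 1 - b) \<in> M"
        using T_bdd[OF bs] d by (intro M_scale) auto
      ultimately have "b * (a - (- d) *\<^sub>R 1) + d *\<^sub>R (norm b *\<^sub>R 1 - b) \<in> M" by (rule M_add)
      moreover have "b * (a - (- d) *\<^sub>R 1) + d *\<^sub>R (norm b *\<^sub>R 1 - b) = a * b - (- (d * norm b)) *\<^sub>R 1"
        using commute[of b a] by (simp add: algebra_simps)
      ultimately have "- (d * norm b) \<le> \<phi> (a * b)" using a bs by (intro le_phi) (auto simp: sa)
      then show ?thesis using 1 db by linarith
    qed
    then have "\<bar>\<phi> (a * b)\<bar> \<le> 0" by (rule field_le_epsilon)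
    then show ?thesis by simp
  qed
  \<comment> \<open>A self-adjoint \<open>b\<close> is the difference of the positive elements
    \<open>b + norm b *\<^sub>R 1\<close> and \<open>norm b *\<^sub>R 1\<close>.\<close>
  have null: "\<phi> (a * b) = 0" if a: "a \<in> self_adjoint" "\<phi> a = 0" and b: "b \<in> self_adjoint" for a b
  proof -
    have 1: "\<phi> (a * (b + norm b *\<^sub>R 1)) = 0"
      by (rule null1[OF a nonneg_add_norm[OF b order_refl]])
    have 2: "\<phi> (a * (norm b *\<^sub>R 1)) = 0"
      by (rule null1[OF a nonneg_of_real]) simp
    have "a * (b + norm b *\<^sub>R 1) \<in> self_adjoint" "a * (norm b *\<^sub>R 1) \<in> self_adjoint"
      using a b by (simp_all add: sa del: mult_scaleR_right)
    then have "\<phi> (a * (b + norm b *\<^sub>R 1) - a * (norm b *\<^sub>R 1)) = 0"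
      using phi_diff 1 2 by simp
    then show ?thesis by (simp add: distrib_left)
  qed
  \<comment> \<open>Subtracting its own value from \<open>a\<close> moves it into the kernel, which
    absorbs products by \<open>null\<close>; homogeneity and multiplicativity both follow from
    this.\<close>
  have shift: "\<phi> (a * b) = \<phi> (\<phi> a *\<^sub>R b)" if a: "a \<in> self_adjoint" and b: "b \<in> self_adjoint" for a b
  proof -
    have "\<phi> (a - \<phi> a *\<^sub>R 1) = 0" using a phi_diff[of a "\<phi> a *\<^sub>R 1"] phi_real by (simp add: sa)
    then have "\<phi> ((a - \<phi> a *\<^sub>R 1) * b) = 0" using a b by (intro null sa)
    moreover have "(a - \<phi> a *\<^sub>R 1) * b = a * b - \<phi> a *\<^sub>R b" by (simp add: algebra_simps)
    moreover have "a * b \<in> self_adjoint" "\<phi> a *\<^sub>R b \<in> self_adjoint" using a b by (simp_all add: sa)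
    ultimately show ?thesis using phi_diff[of "a * b" "\<phi> a *\<^sub>R b"] by simp
  qed
  have phi_scale: "\<phi> (r *\<^sub>R b) = r * \<phi> b" if b: "b \<in> self_adjoint" for r b
  proof -
    have "\<phi> (b * (r *\<^sub>R 1)) = \<phi> (\<phi> b *\<^sub>R (r *\<^sub>R 1))" by (intro shift b sa)
    also have "\<phi> b *\<^sub>R (r *\<^sub>R (1::'a)) = (r * \<phi> b) *\<^sub>R 1" by (simp add: mult.commute)
    finally show ?thesis using phi_real by simp
  qed
  have "real_character \<phi>"
    unfolding real_character_def
    using phi_add phi_scale shift phi_real[of 1] by auto
  then show ?thesis using that phi_pos by blast
qed

lemma nonneg_power: "nonneg x \<Longrightarrow> nonneg (x ^ n)"
  by (induction n) (auto intro: nonneg_one nonneg_mult)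

lemma norm_power_two_power:
  fixes u :: 'a
  assumes "u \<in> self_adjoint"
  shows "norm (u ^ (2 ^ n)) = norm u ^ (2 ^ n)"
proof (induction n)
  case (Suc n)
  have "u ^ (2 ^ Suc n) = u ^ (2 ^ n) * u ^ (2 ^ n)" by (simp add: power_add[symmetric] mult_2)
  then show ?case
    using norm_square_self_adjoint[of "u ^ (2 ^ n)"] Suc assms
    by (simp add: sa power_mult[symmetric] mult.commute)
qed simp

text \<open>If \<open>1 - u\<close> had a multiple \<open>r - u * r \<ge> 1\<close> with \<open>r\<close> nonnegative, then \<open>u\<close> would be a strict
  contraction on \<open>r\<close>, so that the powers of \<open>u\<close> would tend to zero.\<close>

lemma character_attains_norm_one:
  fixes a :: 'a
  assumes a: "a \<in> self_adjoint" and n: "norm a = 1"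
  obtains \<phi> where "real_character \<phi>" "1 \<le> (\<phi> a)\<^sup>2"
proof -
  define u where "u = a * a"
  have u: "nonneg u" "u \<in> self_adjoint" "norm u = 1"
    using nonneg_square[OF a] norm_square_self_adjoint[OF a] n a by (simp_all add: u_def sa)
  have P: "cone (Collect nonneg)"
    unfolding cone_def using nonneg_sa nonneg_add nonneg_mult by auto
  \<comment> \<open>Any total cone above \<open>?Q\<close> contains \<open>u - 1\<close>, so that
    its character has value at least 1 at \<open>u\<close>.\<close>
  let ?Q = "{q + r * (u - 1) | q r. q \<in> Collect nonneg \<and> nonneg r}"
  have Q: "cone ?Q" using u by (intro cone_adjoin[OF P] sa)
  have "- 1 \<notin> ?Q"
  proof
    assume "- 1 \<in> ?Q"
    then obtain p r where pr: "- 1 = p + r * (u - 1)" "nonneg p" "nonneg r" by auto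
    have eq: "r = 1 + p + u * r"
      using pr(1) commute[of r u] by (simp add: algebra_simps)
    \<comment> \<open>As r is at most k, the element u r = r - 1 - p is at most r - r / k = l r,
      with l below 1.\<close>
    define k where "k = norm r + 1"
    define l where "l = 1 - 1 / k"
    have k: "k \<ge> 1" by (simp add: k_def)
    have l: "0 \<le> l" "l < 1" using k by (auto simp: l_def)
    have r1: "nonneg (r - 1)"
      using nonneg_add[OF pr(2) nonneg_mult[OF u(1) pr(3)]] eq by (metis add_diff_cancel_left' add.assoc)
    have kr: "nonneg (k *\<^sub>R 1 - r)" using pr(3) by (intro nonneg_diff_norm nonneg_sa) (auto simp: k_def)
    have step: "nonneg (l *\<^sub>R r - u * r)"
    proof -
      have "l *\<^sub>R r - u * r = (1 / k) *\<^sub>R (k *\<^sub>R 1 - r) + p"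
      proof -
        have "l *\<^sub>R r - u * r = (r - u * r) - (1 / k) *\<^sub>R r" by (simp add: l_def algebra_simps)
        also have "r - u * r = 1 + p" using eq by (simp add: algebra_simps)
        finally show ?thesis using k by (simp add: scaleR_diff_right)
      qed
      then show ?thesis using kr pr(2) k by (auto intro!: nonneg_add nonneg_scaleR)
    qed
    have iter: "nonneg (l ^ n *\<^sub>R r - u ^ n * r)" for n
    proof (induction n)
      case (Suc n)
      have "l ^ Suc n *\<^sub>R r - u ^ Suc n * r = l ^ n *\<^sub>R (l *\<^sub>R r - u * r) + u * (l ^ n *\<^sub>R r - u ^ n * r)"
        by (simp add: algebra_simps)
      then show ?case using Suc step l u by (auto intro!: nonneg_add nonneg_scaleR nonneg_mult)
    qed (simp add: nonneg_zero)
    \<comment> \<open>In the order, u^n is at most u^n r because 1 is at most r; this is at most l^n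
      r, and hence at most l^n k.\<close>
    have le: "norm (u ^ n) \<le> l ^ n * k" for n
    proof (rule nonneg_norm_le[OF nonneg_power[OF u(1)]])
      have "(l ^ n * k) *\<^sub>R 1 - u ^ n = l ^ n *\<^sub>R (k *\<^sub>R 1 - r) + (l ^ n *\<^sub>R r - u ^ n * r) + u ^ n * (r - 1)"
        by (simp add: algebra_simps)
      then show "nonneg ((l ^ n * k) *\<^sub>R 1 - u ^ n)"
        using kr iter[of n] r1 l nonneg_power[OF u(1)] by (auto intro!: nonneg_add nonneg_scaleR nonneg_mult)
    qed (use l k in auto)
    \<comment> \<open>The exponents are powers of two because the norm of a self-adjoint element is
      known to be multiplicative under squaring.\<close>
    obtain n where n: "l ^ n < 1 / k" using real_arch_pow_inv[of "1 / k" l] l k by auto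
    have "l ^ (2 ^ n) \<le> l ^ n" using l by (intro power_decreasing) auto
    then have "l ^ (2 ^ n) * k \<le> l ^ n * k" using k by (intro mult_right_mono) auto
    also have "\<dots> < 1" using n k by (simp add: field_simps)
    finally have "l ^ (2 ^ n) * k < 1" .
    moreover have "norm (u ^ (2 ^ n)) = 1" using norm_power_two_power[OF u(2)] u(3) by simp
    ultimately show False using le[of "2 ^ n"] by simp
  qed
  from Q this obtain M where M: "cone M" "?Q \<subseteq> M" "- 1 \<notin> M" "\<And>a. a \<in> self_adjoint \<Longrightarrow> a \<in> M \<or> - a \<in> M"
    by (rule maximal_cone_exists) blast
  obtain \<phi> where \<phi>: "real_character \<phi>" "\<And>a. a \<in> M \<Longrightarrow> 0 \<le> \<phi> a"
  proof (rule total_cone_character[OF M(1,3,4)])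
    fix \<phi> assume "real_character \<phi>" "\<And>a. a \<in> M \<Longrightarrow> 0 \<le> \<phi> a"
    then show thesis using that by blast
  qed
  have "\<exists>q r. u - 1 = q + r * (u - 1) \<and> q \<in> Collect nonneg \<and> nonneg r"
    by (rule exI[of _ 0], rule exI[of _ 1]) (simp add: nonneg_zero nonneg_one)
  then have "u - 1 \<in> ?Q" by simp
  then have "0 \<le> \<phi> (u - 1)" using M(2) \<phi>(2) by blast
  moreover have "\<phi> (u - 1 + 1) = \<phi> (u - 1) + \<phi> 1"
    using \<phi>(1) u(2) sa(2) sa(4)[OF u(2) sa(2)] unfolding real_character_def by blast
  moreover have "\<phi> u = \<phi> a * \<phi> a" using \<phi>(1) a unfolding real_character_def u_def by blast
  moreover have "\<phi> 1 = 1" using \<phi>(1) unfolding real_character_def by blast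
  ultimately show ?thesis using that[OF \<phi>(1)] by (simp add: power2_eq_square)
qed

section \<open>Complex characters\<close>

definition character :: "('a \<Rightarrow> complex) \<Rightarrow> bool" where
  "character \<xi> \<longleftrightarrow> (\<forall>x y. \<xi> (x + y) = \<xi> x + \<xi> y) \<and> (\<forall>x y. \<xi> (x * y) = \<xi> x * \<xi> y) \<and>
     (\<forall>c x. \<xi> (scaleC c x) = c * \<xi> x) \<and> (\<forall>x. \<xi> (star x) = cnj (\<xi> x)) \<and> \<xi> 1 = 1"

lemma character_scaleR: "character \<xi> \<Longrightarrow> \<xi> (r *\<^sub>R x) = of_real r * \<xi> x"
  unfolding character_def by (metis scaleC_of_real)

text \<open>Continuity is automatic: for a self-adjoint a of norm below 1, a square root s of 1 -
  a^2 has a real value, so the squares of the values at s and a add up to 1. The C*-identity extends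
  the bound to all elements.\<close>

lemma character_norm_le:
  assumes \<xi>: "character \<xi>"
  shows "cmod (\<xi> x) \<le> norm x"
proof -
  have small: "cmod (\<xi> a) \<le> 1" if a: "a \<in> self_adjoint" "norm a < 1" for a
  proof -
    have "norm (a * a) < 1"
      using norm_square_self_adjoint[OF a(1)] a(2) by (simp add: power_less_one_iff)
    then obtain s where s: "s \<in> self_adjoint" "s * s = 1 - a * a"
      by (rule sqrt_exists[OF self_adjoint_mult[OF a(1) a(1)]])
    have real: "\<xi> b = of_real (Re (\<xi> b))" if "b \<in> self_adjoint" for b
      using \<xi> that unfolding character_def self_adjoint_def
      by (metis (mono_tags, lifting) Reals_cnj_iff mem_Collect_eq of_real_Re)
    have "\<xi> (s * s + a * a) = \<xi> 1" using s(2) by simp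
    then have "\<xi> s * \<xi> s + \<xi> a * \<xi> a = 1" using \<xi> unfolding character_def by metis
    then have "complex_of_real (Re (\<xi> s) * Re (\<xi> s) + Re (\<xi> a) * Re (\<xi> a)) = of_real 1"
      using real[OF s(1)] real[OF a(1)] by (metis of_real_1 of_real_add of_real_mult)
    then have "Re (\<xi> s) * Re (\<xi> s) + Re (\<xi> a) * Re (\<xi> a) = 1" by (simp only: of_real_eq_iff)
    then have "(Re (\<xi> a))\<^sup>2 \<le> 1"
      using zero_le_square[of "Re (\<xi> s)"] unfolding power2_eq_square by linarith
    then have "\<bar>Re (\<xi> a)\<bar> \<le> 1" using abs_le_square_iff[of "Re (\<xi> a)" 1] by simp
    then show ?thesis using real[OF a(1)] by (metis norm_of_real)
  qed
  have sa_le: "cmod (\<xi> a) \<le> norm a" if a: "a \<in> self_adjoint" for a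
  proof (rule field_le_epsilon)
    fix e :: real assume e: "e > 0"
    define t where "t = norm a + e"
    have t: "t > 0" "norm a < t" using e by (auto simp: t_def add_nonneg_pos)
    then have "cmod (\<xi> ((1 / t) *\<^sub>R a)) \<le> 1" using a by (intro small sa) auto
    then have "cmod (\<xi> a) / t \<le> 1" using character_scaleR[OF \<xi>, of "1 / t" a] t by (simp add: norm_divide)
    then have "cmod (\<xi> a) \<le> t" using t by simp
    then show "cmod (\<xi> a) \<le> norm a + e" by (simp add: t_def)
  qed
  have "\<xi> (star x * x) = cnj (\<xi> x) * \<xi> x" using \<xi> unfolding character_def by metis
  then have "(cmod (\<xi> x))\<^sup>2 = cmod (\<xi> (star x * x))"
    by (simp add: norm_mult power2_eq_square)
  also have "\<dots> \<le> norm (star x * x)"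
    by (intro sa_le) (simp add: self_adjoint_def star_mult star_star)
  finally show ?thesis unfolding cstar_identity by simp
qed

text \<open>Complexification along the unique decomposition into self-adjoint real and imaginary
  parts.\<close>

lemma character_of_real_character:
  assumes \<phi>: "real_character \<phi>"
  obtains \<xi> where "character \<xi>" "\<And>a. a \<in> self_adjoint \<Longrightarrow> \<xi> a = of_real (\<phi> a)"
proof -
  define re where "re x = (1 / 2) *\<^sub>R (x + star x)" for x :: 'a
  define im where "im x = (1 / 2) *\<^sub>R scaleC \<i> (star x - x)" for x :: 'a
  have scR: "scaleC c (r *\<^sub>R x) = r *\<^sub>R scaleC c x" for c r and x :: 'a
    by (simp flip: scaleC_of_real add: scaleC_scaleC mult.commute)
  have re_sa: "re x \<in> self_adjoint" for x
    by (simp add: re_def self_adjoint_def star_scaleR star_add star_star add.commute)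
  have im_sa: "im x \<in> self_adjoint" for x
    using scaleC_minus_left[of \<i> "x - star x"]
    by (simp add: im_def self_adjoint_def star_scaleR star_scaleC star_diff star_star scaleC_diff_right)
  have ii: "scaleC \<i> (scaleC \<i> x) = - x" for x :: 'a
    using scaleC_minus_left[of 1 x] by (simp add: scaleC_scaleC)
  have decomp: "x = re x + scaleC \<i> (im x)" for x
  proof -
    have "re x + scaleC \<i> (im x) = (1 / 2) *\<^sub>R (x + star x) + (1 / 2) *\<^sub>R (x - star x)"
      by (simp add: re_def im_def scR ii)
    also have "\<dots> = (1 / 2) *\<^sub>R (x + x)" by (simp flip: scaleR_add_right)
    also have "\<dots> = x" by (simp add: scaleR_2[symmetric])
    finally show ?thesis by simp
  qed
  have uniq: "re (a + scaleC \<i> b) = a \<and> im (a + scaleC \<i> b) = b"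
    if "a \<in> self_adjoint" "b \<in> self_adjoint" for a b
  proof -
    have s: "star (a + scaleC \<i> b) = a - scaleC \<i> b"
      using that scaleC_minus_left[of \<i> b] by (simp add: star_add star_scaleC self_adjoint_def)
    have "re (a + scaleC \<i> b) = a" unfolding re_def s by (simp add: scaleR_2[symmetric])
    moreover have "star (a + scaleC \<i> b) - (a + scaleC \<i> b) = - (2 *\<^sub>R scaleC \<i> b)"
      unfolding s by (simp add: scaleR_2)
    then have "im (a + scaleC \<i> b) = (1 / 2) *\<^sub>R scaleC \<i> (- (2 *\<^sub>R scaleC \<i> b))"
      unfolding im_def by simp
    then have "im (a + scaleC \<i> b) = b"
      by (simp add: scaleC_minus_right scR ii)
    ultimately show ?thesis by blast
  qed
  define \<xi> where "\<xi> x = Complex (\<phi> (re x)) (\<phi> (im x))" for x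
  have chi: "\<xi> (a + scaleC \<i> b) = Complex (\<phi> a) (\<phi> b)" if "a \<in> self_adjoint" "b \<in> self_adjoint" for a b
    using uniq[OF that] by (simp add: \<xi>_def)
  have p: "\<phi> (a + b) = \<phi> a + \<phi> b" "\<phi> (a * b) = \<phi> a * \<phi> b" "\<phi> (r *\<^sub>R a) = r * \<phi> a" "\<phi> 1 = 1"
    if "a \<in> self_adjoint" "b \<in> self_adjoint" for a b r
    using \<phi> that unfolding real_character_def by auto
  have p_minus: "\<phi> (- a) = - \<phi> a" if "a \<in> self_adjoint" for a
    using p(3)[OF that that, of "-1"] by simp
  have p_diff: "\<phi> (a - b) = \<phi> a - \<phi> b" if "a \<in> self_adjoint" "b \<in> self_adjoint" for a b
    using p(1)[of a "- b"] p_minus[of b] that by (simp add: sa)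
  have sa_eq: "\<xi> a = of_real (\<phi> a)" if "a \<in> self_adjoint" for a
  proof -
    have "\<phi> 0 = 0" using p(3)[of 0 0 0] by (simp add: sa)
    then show ?thesis using chi[OF that, of 0] by (simp add: sa complex_of_real_def)
  qed
  have mult: "\<xi> (x * y) = \<xi> x * \<xi> y" for x y
  proof -
    let ?a = "re x" and ?b = "im x" and ?c = "re y" and ?d = "im y"
    have "x * y = (?a + scaleC \<i> ?b) * (?c + scaleC \<i> ?d)" using decomp by metis
    also have "\<dots> = (?a * ?c - ?b * ?d) + scaleC \<i> (?a * ?d + ?b * ?c)"
      by (simp add: algebra_simps mult_scaleC_left mult_scaleC_right ii scaleC_add_right)
    finally have "\<xi> (x * y) = Complex (\<phi> (?a * ?c - ?b * ?d)) (\<phi> (?a * ?d + ?b * ?c))"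
      using re_sa im_sa by (simp add: chi sa)
    also have "\<dots> = \<xi> x * \<xi> y"
      using re_sa im_sa by (simp add: \<xi>_def p p_diff sa complex_eq_iff)
    finally show ?thesis .
  qed
  have add: "\<xi> (x + y) = \<xi> x + \<xi> y" for x y
  proof -
    have "x + y = (re x + re y) + scaleC \<i> (im x + im y)"
      using decomp[of x] decomp[of y] by (simp add: scaleC_add_right algebra_simps)
    then have "\<xi> (x + y) = Complex (\<phi> (re x + re y)) (\<phi> (im x + im y))"
      using re_sa im_sa by (simp add: chi sa)
    then show ?thesis using re_sa im_sa by (simp add: \<xi>_def p complex_eq_iff)
  qed
  have const: "\<xi> (scaleC c 1) = c" for c
  proof -
    have "Re c *\<^sub>R 1 + scaleC \<i> (Im c *\<^sub>R (1 :: 'a)) = scaleC (of_real (Re c) + \<i> * of_real (Im c)) 1"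
      by (simp flip: scaleC_of_real add: scaleC_scaleC scaleC_add_left)
    then have "scaleC c 1 = Re c *\<^sub>R 1 + scaleC \<i> (Im c *\<^sub>R (1 :: 'a))"
      by (simp flip: complex_eq)
    then have "\<xi> (scaleC c 1) = Complex (\<phi> (Re c *\<^sub>R 1)) (\<phi> (Im c *\<^sub>R 1))"
      by (simp add: chi sa)
    then show ?thesis using p(3,4)[of 1 1] by (simp add: sa)
  qed
  have scale: "\<xi> (scaleC c x) = c * \<xi> x" for c x
    using mult[of "scaleC c 1" x] const[of c] by (simp add: mult_scaleC_left)
  have star: "\<xi> (star x) = cnj (\<xi> x)" for x
  proof -
    have "star x = re x + scaleC \<i> (- im x)"
      using arg_cong[OF decomp[of x], of star] re_sa[of x] im_sa[of x]

      by (simp add: star_add star_scaleC self_adjoint_def scaleC_minus_left scaleC_minus_right)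
    then have "\<xi> (star x) = Complex (\<phi> (re x)) (\<phi> (- im x))"
      using re_sa im_sa by (simp add: chi sa)
    then show ?thesis using im_sa by (simp add: \<xi>_def p_minus complex_eq_iff)
  qed
  have "character \<xi>"
    unfolding character_def using add mult scale star const[of 1] by simp
  then show ?thesis using that sa_eq by blast
qed

lemma character_attains_norm:
  fixes a :: 'a
  assumes a: "a \<in> self_adjoint"
  obtains \<xi> where "character \<xi>" "norm a \<le> cmod (\<xi> a)"
proof -
  \<comment> \<open>For a = 0 the estimate holds for every character, but one has to exist; the unit
    provides it.\<close>
  define b where "b = (if a = 0 then 1 else (1 / norm a) *\<^sub>R a)"
  have b: "b \<in> self_adjoint" "norm b = 1" using a by (auto simp: b_def sa)
  obtain \<phi> where \<phi>: "real_character \<phi>" "1 \<le> (\<phi> b)\<^sup>2" using character_attains_norm_one[OF b] by metis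
  obtain \<xi> where \<xi>: "character \<xi>" "\<And>a. a \<in> self_adjoint \<Longrightarrow> \<xi> a = of_real (\<phi> a)"
    using character_of_real_character[OF \<phi>(1)] by metis
  have "1 \<le> cmod (\<xi> b)" using \<xi>(2)[OF b(1)] \<phi>(2) abs_le_square_iff[of 1 "\<phi> b"] by simp
  then have "norm a \<le> cmod (\<xi> a)"
    using character_scaleR[OF \<xi>(1), of "1 / norm a" a]
    by (cases "a = 0") (simp_all add: b_def norm_divide pos_le_divide_eq)
  then show ?thesis using that \<xi>(1) by blast
qed

end

section \<open>The Gelfand representation\<close>

text \<open>An isometric *-isomorphism onto C(X), with the supremum norm expressed by its upper
  bounds. Values of \<open>\<gamma> a\<close> outside \<open>X\<close> are left open.\<close>

locale gelfand =
  fixes X :: "'x::metric_space set" and \<gamma> :: "'a::unital_cstar_algebra \<Rightarrow> 'x \<Rightarrow> complex"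
  assumes X_compact: "compact X"
    and gamma_cont: "continuous_on X (\<gamma> a)"
    and gamma_add: "x \<in> X \<Longrightarrow> \<gamma> (a + b) x = \<gamma> a x + \<gamma> b x"
    and gamma_mult: "x \<in> X \<Longrightarrow> \<gamma> (a * b) x = \<gamma> a x * \<gamma> b x"
    and gamma_scaleC: "x \<in> X \<Longrightarrow> \<gamma> (scaleC c a) x = c * \<gamma> a x"
    and gamma_star: "x \<in> X \<Longrightarrow> \<gamma> (star a) x = cnj (\<gamma> a x)"
    and gamma_one: "x \<in> X \<Longrightarrow> \<gamma> 1 x = 1"
    and norm_le_iff: "0 \<le> B \<Longrightarrow> norm a \<le> B \<longleftrightarrow> (\<forall>x\<in>X. cmod (\<gamma> a x) \<le> B)"
    and gamma_surj: "continuous_on X f \<Longrightarrow> \<exists>a. \<forall>x\<in>X. \<gamma> a x = f x"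

section \<open>The spectrum of a separable algebra\<close>

context commutative_cstar
begin

text \<open>As in the Banach-Alaoglu theorem: \<open>character_norm_le\<close> places the characters
  in a product of discs, and the algebraic conditions are closed in the product topology.\<close>

lemma compact_characters: "compact {\<xi> :: 'a \<Rightarrow> complex. character \<xi>}"
proof -
  have ev: "continuous_on UNIV (\<lambda>\<xi> :: 'a \<Rightarrow> complex. \<xi> x)" for x
    by (rule continuous_on_product_coordinates)
  have eq: "{\<xi> :: 'a \<Rightarrow> complex. character \<xi>} =
      (\<Inter>x. \<Inter>y. {\<xi>. \<xi> (x + y) = \<xi> x + \<xi> y}) \<inter> (\<Inter>x. \<Inter>y. {\<xi>. \<xi> (x * y) = \<xi> x * \<xi> y}) \<inter>
      (\<Inter>c. \<Inter>x. {\<xi>. \<xi> (scaleC c x) = c * \<xi> x}) \<inter> (\<Inter>x. {\<xi>. \<xi> (star x) = cnj (\<xi> x)}) \<inter> {\<xi>. \<xi> 1 = 1}"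
    unfolding character_def by auto
  have "closed {\<xi> :: 'a \<Rightarrow> complex. character \<xi>}"
    unfolding eq by (intro closed_Int closed_INT ballI closed_Collect_eq continuous_intros ev)
  moreover have "compact {\<xi> :: 'a \<Rightarrow> complex. \<forall>x. \<xi> x \<in> cball 0 (norm x)}"
    by (rule compact_coordinatewise_bounded) simp
  moreover have "{\<xi>. character \<xi>} \<subseteq> {\<xi> :: 'a \<Rightarrow> complex. \<forall>x. \<xi> x \<in> cball 0 (norm x)}"
    using character_norm_le by auto
  ultimately show ?thesis by (metis closed_Int_compact inf.absorb1)
qed

lemma character_diff: "character \<xi> \<Longrightarrow> \<xi> (x - y) = \<xi> x - \<xi> y"
  unfolding character_def by (metis add_diff_cancel_right' diff_add_cancel)

text \<open>Real Stone-Weierstrass for the image of the self-adjoint elements, on which characters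
  are real.\<close>

lemma self_adjoint_approximation:
  fixes X :: "'x::metric_space set" and \<gamma> :: "'a \<Rightarrow> 'x \<Rightarrow> complex"
  assumes X: "compact X" and cont: "\<And>a. continuous_on X (\<gamma> a)"
    and ch: "\<And>x. x \<in> X \<Longrightarrow> character (\<lambda>a. \<gamma> a x)"
    and sep: "\<And>x y. x \<in> X \<Longrightarrow> y \<in> X \<Longrightarrow> x \<noteq> y \<Longrightarrow> \<exists>a. \<gamma> a x \<noteq> \<gamma> a y"
    and f: "continuous_on X f" and e: "e > 0"
  obtains a where "\<And>x. x \<in> X \<Longrightarrow> cmod (\<gamma> a x - complex_of_real (f x)) < e"
proof -
  have real: "\<gamma> a x = of_real (Re (\<gamma> a x))" if "x \<in> X" "a \<in> self_adjoint" for a x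
    using ch[OF that(1)] that(2) unfolding character_def self_adjoint_def
    by (metis (mono_tags, lifting) Reals_cnj_iff mem_Collect_eq of_real_Re)
  let ?P = "\<lambda>g. continuous_on X g \<and> (\<exists>a\<in>self_adjoint. \<forall>x\<in>X. \<gamma> a x = complex_of_real (g x))"
  have "\<exists>g. ?P g \<and> (\<forall>x\<in>X. \<bar>f x - g x\<bar> < e)"
  proof (rule Stone_Weierstrass_HOL[OF X])
    fix c :: real
    have "\<forall>x\<in>X. \<gamma> (c *\<^sub>R 1) x = of_real c"
      using character_scaleR[OF ch] ch unfolding character_def by fastforce
    moreover have "c *\<^sub>R 1 \<in> (self_adjoint :: 'a set)" by (intro sa)
    ultimately show "?P (\<lambda>x. c)" by auto
  next
    fix g h assume gh: "?P g \<and> ?P h"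
    then obtain a b where ab: "a \<in> self_adjoint" "b \<in> self_adjoint"
      "\<forall>x\<in>X. \<gamma> a x = complex_of_real (g x)" "\<forall>x\<in>X. \<gamma> b x = complex_of_real (h x)" by blast
    have "\<forall>x\<in>X. \<gamma> (a + b) x = complex_of_real (g x + h x)"
      using ab(3,4) ch unfolding character_def by fastforce
    moreover have "\<forall>x\<in>X. \<gamma> (a * b) x = complex_of_real (g x * h x)"
      using ab(3,4) ch unfolding character_def by fastforce
    moreover have "a + b \<in> self_adjoint" "a * b \<in> self_adjoint" using ab by (simp_all add: sa)
    ultimately show "?P (\<lambda>x. g x + h x)" "?P (\<lambda>x. g x * h x)"
      using gh by (auto intro!: continuous_intros)
  next
    fix x y assume xy: "x \<in> X \<and> y \<in> X \<and> x \<noteq> y"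
    then obtain a where a: "\<gamma> a x \<noteq> \<gamma> a y" using sep by blast
    \<comment> \<open>Twice the real and the imaginary part of \<open>a\<close>, both self-adjoint;
      if \<open>a\<close> separates two points, so does one of these.\<close>
    define re where "re = a + star a"
    define im where "im = scaleC \<i> (star a - a)"
    have g_re: "\<gamma> re z = of_real (2 * Re (\<gamma> a z))" if "z \<in> X" for z
      using ch[OF that] unfolding re_def character_def by (simp add: complex_add_cnj)
    have g_im: "\<gamma> im z = of_real (2 * Im (\<gamma> a z))" if "z \<in> X" for z
    proof -
      have "\<gamma> im z = \<i> * (\<gamma> (star a) z - \<gamma> a z)"
        using ch[OF that] character_diff[OF ch[OF that]] unfolding im_def character_def by simp
      then show ?thesis using ch[OF that] unfolding character_def by (simp add: complex_eq_iff)
    qed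
    have "re \<in> self_adjoint" "im \<in> self_adjoint"
      by (simp_all add: re_def im_def self_adjoint_def star_add star_star star_scaleC star_diff add.commute
          scaleC_minus_left scaleC_diff_right)
    moreover have "continuous_on X (\<lambda>z. Re (\<gamma> a z))" "continuous_on X (\<lambda>z. Im (\<gamma> a z))"
      by (intro continuous_intros cont)+
    ultimately have P: "?P (\<lambda>z. 2 * Re (\<gamma> a z))" "?P (\<lambda>z. 2 * Im (\<gamma> a z))"
      using g_re g_im by (auto intro!: continuous_intros)
    have "2 * Re (\<gamma> a x) \<noteq> 2 * Re (\<gamma> a y) \<or> 2 * Im (\<gamma> a x) \<noteq> 2 * Im (\<gamma> a y)"
      using a by (auto simp: complex_eq_iff)
    then show "\<exists>g. ?P g \<and> g x \<noteq> g y" using P by blast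
  qed (use f e in auto)
  then obtain g a where g: "\<forall>x\<in>X. \<bar>f x - g x\<bar> < e" "\<forall>x\<in>X. \<gamma> a x = complex_of_real (g x)" by blast
  have "cmod (\<gamma> a x - complex_of_real (f x)) < e" if "x \<in> X" for x
    using g that by (metis abs_minus_commute norm_of_real of_real_diff)
  then show ?thesis using that by blast
qed

text \<open>Characters are determined by their values on a dense sequence. Recording these values
  embeds the compact spectrum into a metric space of sequences.\<close>

lemma gelfand_exists:
  assumes sep: "separable_space (euclidean :: 'a topology)"
  obtains X :: "(nat \<Rightarrow> complex) set" and \<gamma> :: "'a \<Rightarrow> (nat \<Rightarrow> complex) \<Rightarrow> complex" where "gelfand X \<gamma>"
proof -
  obtain C :: "'a set" where C: "countable C" "closure C = UNIV"
    using sep unfolding separable_space_def by auto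
  have "C \<noteq> {}" using C(2) by auto
  define d where "d = from_nat_into C"
  have dense: "\<exists>n. norm (z - d n) < e" if e: "e > 0" for z e
  proof -
    have "z \<in> closure C" using C(2) by simp
    then obtain y where "y \<in> C" "dist y z < e" using e closure_approachable by blast
    then show ?thesis using from_nat_into_surj[OF C(1), of y] unfolding d_def
      by (metis dist_commute dist_norm)
  qed
  let ?M = "{\<xi> :: 'a \<Rightarrow> complex. character \<xi>}"
  define \<rho> where "\<rho> \<xi> = (\<lambda>n. \<xi> (d n))" for \<xi> :: "'a \<Rightarrow> complex"
  have rho_cont: "continuous_on ?M \<rho>"
    unfolding \<rho>_def
    by (intro continuous_on_coordinatewise_then_product continuous_on_subset[OF continuous_on_product_coordinates]) auto
  have rho_inj: "inj_on \<rho> ?M"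
  proof (rule inj_onI)
    fix \<xi> \<xi>' assume \<xi>: "\<xi> \<in> ?M" "\<xi>' \<in> ?M" "\<rho> \<xi> = \<rho> \<xi>'"
    show "\<xi> = \<xi>'"
    proof
      fix z
      have "cmod (\<xi> z - \<xi>' z) \<le> 0 + e" if e: "e > 0" for e
      proof -
        obtain n where n: "norm (z - d n) < e / 2" using dense[of "e / 2" z] e by auto
        have "\<xi> (d n) = \<xi>' (d n)" using \<xi>(3) unfolding \<rho>_def by metis
        then have "\<xi> z - \<xi>' z = \<xi> (z - d n) - \<xi>' (z - d n)" using \<xi> by (simp add: character_diff)
        then have "cmod (\<xi> z - \<xi>' z) \<le> cmod (\<xi> (z - d n)) + cmod (\<xi>' (z - d n))"
          using norm_triangle_ineq4 by metis
        also have "\<dots> \<le> norm (z - d n) + norm (z - d n)"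
          using \<xi> by (intro add_mono character_norm_le) auto
        finally show ?thesis using n by simp
      qed
      then have "cmod (\<xi> z - \<xi>' z) \<le> 0" by (rule field_le_epsilon)
      then show "\<xi> z = \<xi>' z" by simp
    qed
  qed
  define X where "X = \<rho> ` ?M"
  define g where "g = inv_into ?M \<rho>"
  have g: "g (\<rho> \<xi>) = \<xi>" if "character \<xi>" for \<xi>
    unfolding g_def using rho_inj that by simp
  define \<gamma> where "\<gamma> a x = g x a" for a x
  have ch: "character (\<lambda>a. \<gamma> a x)" if "x \<in> X" for x
    using that g unfolding X_def \<gamma>_def by auto
  have X: "compact X"
    unfolding X_def by (rule compact_continuous_image[OF rho_cont compact_characters])
  have cont: "continuous_on X (\<gamma> a)" for a
  proof -
    have "continuous_on X g"
      unfolding X_def by (rule continuous_on_inv[OF rho_cont compact_characters]) (use g in auto)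
    then show ?thesis unfolding \<gamma>_def by (rule continuous_on_product_then_coordinatewise)
  qed
  have sep': "\<exists>a. \<gamma> a x \<noteq> \<gamma> a y" if xy: "x \<in> X" "y \<in> X" "x \<noteq> y" for x y
  proof (rule ccontr)
    assume "\<nexists>a. \<gamma> a x \<noteq> \<gamma> a y"
    then have "g x = g y" by (auto simp: \<gamma>_def)
    moreover obtain \<xi> \<xi>' where "x = \<rho> \<xi>" "y = \<rho> \<xi>'" "character \<xi>" "character \<xi>'"
      using xy(1,2) unfolding X_def by blast
    ultimately show False using g xy(3) by metis
  qed
  have norm_iff: "norm a \<le> B \<longleftrightarrow> (\<forall>x\<in>X. cmod (\<gamma> a x) \<le> B)" if B: "0 \<le> B" for a B
  proof
    assume "norm a \<le> B"
    then show "\<forall>x\<in>X. cmod (\<gamma> a x) \<le> B" using character_norm_le[OF ch] order_trans by blast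
  next
    assume le: "\<forall>x\<in>X. cmod (\<gamma> a x) \<le> B"
    have "star a * a \<in> self_adjoint" by (simp add: self_adjoint_def star_mult star_star)
    then obtain \<xi> where \<xi>: "character \<xi>" "norm (star a * a) \<le> cmod (\<xi> (star a * a))"
      by (rule character_attains_norm)
    have "\<xi> (star a * a) = cnj (\<xi> a) * \<xi> a" using \<xi>(1) unfolding character_def by metis
    then have "(norm a)\<^sup>2 \<le> (cmod (\<xi> a))\<^sup>2"
      using \<xi>(2) by (simp add: cstar_identity norm_mult power2_eq_square)
    then have "norm a \<le> cmod (\<xi> a)" by (rule power2_le_imp_le) simp
    moreover have "\<xi> a = \<gamma> a (\<rho> \<xi>)" "\<rho> \<xi> \<in> X" using g \<xi>(1) by (auto simp: \<gamma>_def X_def)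
    ultimately show "norm a \<le> B" using le by fastforce
  qed
  have diff: "\<gamma> (a - b) x = \<gamma> a x - \<gamma> b x" if "x \<in> X" for a b x
    using character_diff[OF ch[OF that]] .
  have surj_real: "\<exists>a. \<forall>x\<in>X. \<gamma> a x = complex_of_real (f x)" if f: "continuous_on X f" for f
  proof -
    have "\<exists>a. \<forall>x\<in>X. cmod (\<gamma> a x - complex_of_real (f x)) < (1/2) ^ n" for n
      using self_adjoint_approximation[where X = X and \<gamma> = \<gamma> and f = f and e = "(1/2) ^ n"] X cont ch sep' f
      by (metis zero_less_divide_1_iff zero_less_numeral zero_less_power)
    then obtain a where a: "\<And>n. \<forall>x\<in>X. cmod (\<gamma> (a n) x - complex_of_real (f x)) < (1/2) ^ n"
      by metis
    \<comment> \<open>The representation is isometric, so uniform closeness of the images makes the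
      approximating elements a Cauchy sequence.\<close>
    have close: "norm (a m - a n) \<le> 2 * (1/2) ^ N" if "m \<ge> N" "n \<ge> N" for m n N
    proof -
      have p: "(1/2 :: real) ^ m \<le> (1/2) ^ N" "(1/2 :: real) ^ n \<le> (1/2) ^ N"
        using that by (auto intro!: power_decreasing)
      have "cmod (\<gamma> (a m - a n) x) \<le> 2 * (1/2) ^ N" if x: "x \<in> X" for x
      proof -
        have "\<gamma> (a m - a n) x = (\<gamma> (a m) x - complex_of_real (f x)) - (\<gamma> (a n) x - complex_of_real (f x))"
          using diff[OF x] by simp
        then have "cmod (\<gamma> (a m - a n) x) \<le> cmod (\<gamma> (a m) x - complex_of_real (f x)) + cmod (\<gamma> (a n) x - complex_of_real (f x))"
          by (metis norm_triangle_ineq4)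
        then show ?thesis using a[of m, rule_format, OF x] a[of n, rule_format, OF x] p by linarith
      qed
      then show ?thesis by (subst norm_iff) auto
    qed
    have "Cauchy a"
    proof (rule metric_CauchyI)
      fix e :: real assume "e > 0"
      then obtain N where N: "(1/2 :: real) ^ N < e / 2" using real_arch_pow_inv[of "e / 2" "1/2"] by auto
      have "dist (a m) (a n) < e" if "m \<ge> N" "n \<ge> N" for m n
        using close[OF that] N unfolding dist_norm by linarith
      then show "\<exists>M. \<forall>m\<ge>M. \<forall>n\<ge>M. dist (a m) (a n) < e" by blast
    qed
    then obtain b where b: "a \<longlonglongrightarrow> b" using Cauchy_convergent convergent_def by blast
    have "\<gamma> b x = complex_of_real (f x)" if x: "x \<in> X" for x
    proof -
      have "(\<lambda>n. \<gamma> (a n) x) \<longlonglongrightarrow> \<gamma> b x"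
      proof (rule LIM_zero_cancel, rule Lim_null_comparison)
        show "\<forall>\<^sub>F n in sequentially. norm (\<gamma> (a n) x - \<gamma> b x) \<le> norm (a n - b)"
          using character_norm_le[OF ch[OF x]] by (simp flip: diff[OF x])
        show "(\<lambda>n. norm (a n - b)) \<longlonglongrightarrow> 0" using LIM_zero[OF b] by (rule tendsto_norm_zero)
      qed
      moreover have "(\<lambda>n. \<gamma> (a n) x) \<longlonglongrightarrow> complex_of_real (f x)"
      proof (rule LIM_zero_cancel, rule Lim_null_comparison)
        show "\<forall>\<^sub>F n in sequentially. norm (\<gamma> (a n) x - complex_of_real (f x)) \<le> (1/2) ^ n"
          using a x by (auto intro!: always_eventually less_imp_le)
        show "(\<lambda>n. (1/2 :: real) ^ n) \<longlonglongrightarrow> 0" by (rule LIMSEQ_power_zero) simp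
      qed
      ultimately show ?thesis by (rule LIMSEQ_unique)
    qed
    then show ?thesis by blast
  qed
  have surj: "\<exists>a. \<forall>x\<in>X. \<gamma> a x = f x" if f: "continuous_on X f" for f
  proof -
    obtain a b where ab: "\<forall>x\<in>X. \<gamma> a x = complex_of_real (Re (f x))" "\<forall>x\<in>X. \<gamma> b x = complex_of_real (Im (f x))"
      using surj_real[of "\<lambda>x. Re (f x)"] surj_real[of "\<lambda>x. Im (f x)"] f by (auto intro: continuous_intros)
    have "\<gamma> (a + scaleC \<i> b) x = f x" if x: "x \<in> X" for x
    proof -
      have "\<gamma> (a + scaleC \<i> b) x = \<gamma> a x + \<i> * \<gamma> b x" using ch[OF x] unfolding character_def by simp
      then show ?thesis using ab x by (simp add: complex_eq_iff)
    qed
    then show ?thesis by blast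
  qed
  have "gelfand X \<gamma>"
  proof
    show "\<exists>a. \<forall>x\<in>X. \<gamma> a x = f x" if "continuous_on X f" for f by (rule surj[OF that])
    show "norm a \<le> B \<longleftrightarrow> (\<forall>x\<in>X. cmod (\<gamma> a x) \<le> B)" if "0 \<le> B" for a B by (rule norm_iff[OF that])
  qed (use ch X cont in \<open>auto simp: character_def\<close>)
  then show ?thesis using that by blast
qed

end

section \<open>The identity component of the unitary group\<close>

context gelfand
begin

lemma gamma_diff: "x \<in> X \<Longrightarrow> \<gamma> (a - b) x = \<gamma> a x - \<gamma> b x"
  using gamma_add[of x "a - b" b] by simp

lemma gamma_zero [simp]: "x \<in> X \<Longrightarrow> \<gamma> 0 x = 0"
  using gamma_diff[of x 0 0] by simp

lemma gamma_eqI: "(\<And>x. x \<in> X \<Longrightarrow> \<gamma> a x = \<gamma> b x) \<Longrightarrow> a = b"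
  using norm_le_iff[of 0 "a - b"] by (simp add: gamma_diff)

lemma gamma_norm_le: "x \<in> X \<Longrightarrow> cmod (\<gamma> a x) \<le> norm a"
  using norm_le_iff[of "norm a" a] by simp

lemma mult_commute: "a * b = b * (a :: 'a)"
  by (rule gamma_eqI) (simp add: gamma_mult)

lemma continuous_gamma: "x \<in> X \<Longrightarrow> continuous_on S (\<lambda>a. \<gamma> a x)"
proof (rule continuous_onI)
  fix a e assume "x \<in> X" "(e :: real) > 0"
  then show "\<exists>d>0. \<forall>b\<in>S. dist b a < d \<longrightarrow> dist (\<gamma> b x) (\<gamma> a x) \<le> e"
    by (intro exI[of _ e]) (auto simp: dist_norm simp flip: gamma_diff intro: order_trans[OF gamma_norm_le])
qed

lemma unitary_iff: "u \<in> unitary_group \<longleftrightarrow> (\<forall>x\<in>X. cmod (\<gamma> u x) = 1)"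
proof -
  have "cnj z * z = 1 \<longleftrightarrow> cmod z = 1" for z :: complex
  proof -
    have "cnj z * z = of_real ((cmod z)\<^sup>2)" by (simp add: complex_norm_square mult.commute del: of_real_power)
    then have "cnj z * z = 1 \<longleftrightarrow> (cmod z)\<^sup>2 = 1" by (metis of_real_1 of_real_eq_iff)
    then show ?thesis using power2_eq_iff_nonneg[of "cmod z" 1] by simp
  qed
  then have "(star u * u = 1) \<longleftrightarrow> (\<forall>x\<in>X. cmod (\<gamma> u x) = 1)"
    using gamma_eqI[of "star u * u" 1] by (metis gamma_mult gamma_star gamma_one)
  then show ?thesis unfolding unitary_group_def using mult_commute[of u "star u"] by auto
qed

definition cexp :: "('x \<Rightarrow> real) \<Rightarrow> 'a" where
  "cexp f = (SOME a. \<forall>x\<in>X. \<gamma> a x = cis (f x))"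

lemma gamma_cexp: "continuous_on X f \<Longrightarrow> x \<in> X \<Longrightarrow> \<gamma> (cexp f) x = cis (f x)"
proof -
  assume f: "continuous_on X f" and x: "x \<in> X"
  have "continuous_on X (\<lambda>x. cis (f x))"
    unfolding cis_conv_exp by (intro continuous_intros f)
  from gamma_surj[OF this] have "\<exists>a. \<forall>x\<in>X. \<gamma> a x = cis (f x)" .
  then have "\<forall>x\<in>X. \<gamma> (cexp f) x = cis (f x)" unfolding cexp_def by (rule someI_ex)
  then show ?thesis using x by blast
qed

lemma cexp_eq_iff:
  assumes "continuous_on X f" "continuous_on X g"
  shows "cexp f = cexp g \<longleftrightarrow> (\<forall>x\<in>X. cis (f x) = cis (g x))"
  using gamma_eqI[of "cexp f" "cexp g"] gamma_cexp[OF assms(1)] gamma_cexp[OF assms(2)] by metis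

lemma cexp_add:
  assumes "continuous_on X f" "continuous_on X g"
  shows "cexp (\<lambda>x. f x + g x) = cexp f * cexp g"
  by (rule gamma_eqI) (use assms in \<open>simp add: gamma_cexp gamma_mult continuous_on_add flip: cis_mult\<close>)

lemma cexp_zero: "cexp (\<lambda>_. 0) = 1"
  by (rule gamma_eqI) (simp add: gamma_cexp gamma_one)

lemma star_cexp:
  assumes "continuous_on X f"
  shows "star (cexp f) = cexp (\<lambda>x. - f x)"
  by (rule gamma_eqI) (use assms in \<open>simp add: gamma_cexp gamma_star continuous_on_minus cis_cnj\<close>)

lemma cmod_cis_diff_le: "cmod (cis a - cis b) \<le> \<bar>a - b\<bar>"
proof -
  have "cis a - cis b = cis b * (cis (a - b) - 1)"
    by (simp add: algebra_simps cis_mult)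
  then have "cmod (cis a - cis b) = cmod (exp (\<i> * of_real (a - b)) - 1)"
    by (simp add: norm_mult cis_conv_exp)
  also have "\<dots> \<le> \<bar>a - b\<bar>"
    unfolding dist_exp_i_1 using abs_sin_x_le_abs_x[of "(a - b) / 2"] by simp
  finally show ?thesis .
qed

lemma norm_cexp_diff_le:
  assumes "continuous_on X f" "continuous_on X g" "0 \<le> B" "\<And>x. x \<in> X \<Longrightarrow> \<bar>f x - g x\<bar> \<le> B"
  shows "norm (cexp f - cexp g) \<le> B"
  using assms norm_le_iff[of B "cexp f - cexp g"] cmod_cis_diff_le order_trans
  by (simp add: gamma_diff gamma_cexp) blast

lemma bounded_on_X:
  assumes "continuous_on X f"
  obtains B where "B > 0" "\<And>x. x \<in> X \<Longrightarrow> \<bar>f x\<bar> \<le> (B :: real)"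
  using compact_imp_bounded[OF compact_continuous_image[OF assms X_compact]]
  unfolding bounded_pos by auto

lemma continuous_cexp_scale:
  assumes f: "continuous_on X f"
  shows "continuous_on T (\<lambda>t :: real. cexp (\<lambda>x. t * f x))"
proof (rule continuous_onI)
  let ?p = "\<lambda>t :: real. cexp (\<lambda>x. t * f x)"
  have ct: "continuous_on X (\<lambda>x. t * f x)" for t by (intro continuous_intros f)
  obtain B where B: "B > 0" "\<And>x. x \<in> X \<Longrightarrow> \<bar>f x\<bar> \<le> B" using bounded_on_X[OF f] by blast
  fix t e :: real assume e: "e > 0"
  have "dist (?p s) (?p t) \<le> e" if "dist s t < e / B" for s
  proof -
    have "norm (?p s - ?p t) \<le> e"
    proof (rule norm_cexp_diff_le[OF ct ct])
      fix x assume "x \<in> X"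
      have "\<bar>s * f x - t * f x\<bar> = \<bar>s - t\<bar> * \<bar>f x\<bar>" by (simp add: abs_mult flip: left_diff_distrib)
      also have "\<dots> \<le> (e / B) * B"
        using that B(2)[OF \<open>x \<in> X\<close>] B(1) e by (intro mult_mono) (auto simp: dist_real_def)
      finally show "\<bar>s * f x - t * f x\<bar> \<le> e" using B by simp
    qed (use e in simp)
    then show ?thesis by (simp add: dist_norm)
  qed
  then show "\<exists>d>0. \<forall>s\<in>T. dist s t < d \<longrightarrow> dist (?p s) (?p t) \<le> e"
    using e B by (intro exI[of _ "e / B"]) auto
qed

lemma cexp_in_unitary: "continuous_on X f \<Longrightarrow> cexp f \<in> unitary_group"
  by (simp add: unitary_iff gamma_cexp)

text \<open>The quotient of \<open>u\<close> and \<open>cexp f\<close> stays within distance 1 of 1,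
  hence in the right half plane, where the principal logarithm is continuous. The bound on
  \<open>k\<close> later gives continuity of the logarithm in \<open>u\<close>.\<close>

lemma near_cexp:
  assumes u: "u \<in> unitary_group" and f: "continuous_on X f" and near: "norm (u - cexp f) < 1"
  obtains k where "continuous_on X k" "u = cexp (\<lambda>x. k x + f x)"
    "\<And>x. x \<in> X \<Longrightarrow> \<bar>k x\<bar> \<le> cmod (Ln (\<gamma> u x * cnj (cis (f x))))"
proof -
  define w where "w x = \<gamma> u x * cnj (cis (f x))" for x
  have w1: "cmod (w x) = 1" if "x \<in> X" for x
    using u that by (simp add: w_def norm_mult unitary_iff)
  have "cmod (w x - 1) < 1" if "x \<in> X" for x
  proof -
    have "w x - 1 = (\<gamma> u x - cis (f x)) * cnj (cis (f x))"
      by (simp add: w_def algebra_simps cis_cnj cis_mult)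
    then have "cmod (w x - 1) = cmod (\<gamma> (u - cexp f) x)"
      using f that by (simp add: norm_mult gamma_diff gamma_cexp)
    then show ?thesis using gamma_norm_le[OF that, of "u - cexp f"] near by simp
  qed
  then have "0 < Re (w x)" if "x \<in> X" for x
    using that abs_Re_le_cmod[of "w x - 1"] by fastforce
  then have w_ne: "w x \<notin> \<real>\<^sub>\<le>\<^sub>0" "w x \<noteq> 0" if "x \<in> X" for x
    using that by (force simp: complex_nonpos_Reals_iff, force)
  define k where "k x = Im (Ln (w x))" for x
  have "continuous_on X w"
    unfolding w_def cis_conv_exp by (intro continuous_intros gamma_cont f)
  then have k: "continuous_on X k"
    unfolding k_def using w_ne by (intro continuous_intros) auto
  have "cis (k x) = w x" if x: "x \<in> X" for x
  proof -
    have "Re (Ln (w x)) = 0" using w1[OF x] w_ne[OF x] by simp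
    then have "Ln (w x) = \<i> * of_real (k x)" by (simp add: complex_eq_iff k_def)
    then show ?thesis using exp_Ln[OF w_ne(2)[OF x]] by (simp add: cis_conv_exp)
  qed
  then have "u = cexp (\<lambda>x. k x + f x)"
    by (intro gamma_eqI)
      (simp add: gamma_cexp continuous_on_add k f w_def flip: cis_mult, simp add: cis_cnj cis_mult mult.assoc)
  moreover have "\<bar>k x\<bar> \<le> cmod (Ln (\<gamma> u x * cnj (cis (f x))))" for x
    unfolding k_def w_def by (rule abs_Im_le_cmod)
  ultimately show ?thesis using that k by blast
qed

text \<open>The uniform radius 1 makes both \<open>H\<close> and its complement relatively open in
  \<open>S\<close>.\<close>

lemma connected_subset_of_locally_constant:
  fixes S :: "'s::metric_space set"
  assumes "connected S" "\<And>u v. u \<in> S \<Longrightarrow> v \<in> S \<Longrightarrow> dist u v < 1 \<Longrightarrow> v \<in> H \<Longrightarrow> u \<in> H" "S \<inter> H \<noteq> {}"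
  shows "S \<subseteq> H"
proof -
  have "openin (top_of_set S) (S \<inter> H)"
    unfolding openin_euclidean_subtopology_iff using assms(2) by (auto intro!: exI[of _ 1])
  moreover have "openin (top_of_set S) (S - H)"
    unfolding openin_euclidean_subtopology_iff using assms(2) by (auto intro!: exI[of _ 1] simp: dist_commute)
  then have "closedin (top_of_set S) (S \<inter> H)"
    by (simp add: closedin_def Diff_Int_distrib2 Diff_Int)
  ultimately show ?thesis using assms(1,3) unfolding connected_clopen by blast
qed

text \<open>By \<open>near_cexp\<close>, every unitary at distance below 1 from an exponential is an
  exponential, so the component cannot leave them; conversely, scaling the exponent joins each
  exponential to 1.\<close>

lemma component_eq: "unitary_identity_component = cexp ` {f. continuous_on X f}"
proof
  let ?H = "cexp ` {f. continuous_on X f}"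
  have one: "(1 :: 'a) \<in> unitary_group" by (simp add: unitary_group_def)
  show "unitary_identity_component \<subseteq> ?H"
  proof (rule connected_subset_of_locally_constant)
    show "connected (unitary_identity_component :: 'a set)"
      unfolding unitary_identity_component_def by (rule connected_connected_component)
    have "(1 :: 'a) \<in> unitary_identity_component"
      unfolding unitary_identity_component_def using one by (simp add: connected_component_refl)
    moreover have "1 \<in> ?H" using cexp_zero by (metis continuous_on_const image_eqI mem_Collect_eq)
    ultimately show "unitary_identity_component \<inter> ?H \<noteq> {}" by blast
    fix u v :: 'a assume uv: "u \<in> unitary_identity_component" "dist u v < 1" "v \<in> ?H"
    have "u \<in> unitary_group"
      using uv(1) connected_component_subset unfolding unitary_identity_component_def by blast
    moreover obtain f where f: "continuous_on X f" "v = cexp f" using uv(3) by blast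
    ultimately obtain k where "continuous_on X k" "u = cexp (\<lambda>x. k x + f x)"
      using near_cexp[of u f] uv(2) by (metis dist_norm)
    then show "u \<in> ?H" using f by (auto intro!: imageI continuous_on_add)
  qed
  show "?H \<subseteq> unitary_identity_component"
  proof
    fix u assume "u \<in> ?H"
    then obtain f where f: "continuous_on X f" "u = cexp f" by blast
    let ?p = "\<lambda>t :: real. cexp (\<lambda>x. t * f x)"
    have ct: "continuous_on X (\<lambda>x. t * f x)" for t by (intro continuous_intros f)
    have "continuous_on {0..1} ?p" by (rule continuous_cexp_scale[OF f(1)])
    then have "connected (?p ` {0..1})" by (rule connected_continuous_image) simp
    moreover have "1 \<in> ?p ` {0..1}" by (rule image_eqI[of _ _ 0]) (simp_all add: cexp_zero)
    moreover have "?p ` {0..1} \<subseteq> unitary_group" using cexp_in_unitary[OF ct] by blast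
    ultimately have "?p ` {0..1} \<subseteq> unitary_identity_component"
      unfolding unitary_identity_component_def by (intro connected_component_maximal)
    moreover have "u \<in> ?p ` {0..1}" by (rule image_eqI[of _ _ 1]) (simp_all add: f)
    ultimately show "u \<in> unitary_identity_component" by blast
  qed
qed

lemma cexp_in_component: "continuous_on X f \<Longrightarrow> cexp f \<in> unitary_identity_component"
  unfolding component_eq by blast

lemma componentE:
  fixes u :: 'a
  assumes "u \<in> unitary_identity_component"
  obtains f where "continuous_on X f" "u = cexp f"
  using assms unfolding component_eq by blast

lemma one_in_component: "(1 :: 'a) \<in> unitary_identity_component"
  using cexp_in_component[of "\<lambda>_. 0"] cexp_zero by simp

lemma mult_in_component:
  fixes u v :: 'a
  assumes "u \<in> unitary_identity_component" "v \<in> unitary_identity_component"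
  shows "u * v \<in> unitary_identity_component"
proof -
  obtain f g where "continuous_on X f" "u = cexp f" "continuous_on X g" "v = cexp g"
    using assms by (metis componentE)
  then show ?thesis using cexp_in_component[of "\<lambda>x. f x + g x"] cexp_add by (simp add: continuous_on_add)
qed

lemma star_in_component:
  fixes u :: 'a
  assumes "u \<in> unitary_identity_component"
  shows "star u \<in> unitary_identity_component"
proof -
  obtain f where "continuous_on X f" "u = cexp f" using assms by (metis componentE)
  then show ?thesis using cexp_in_component[of "\<lambda>x. - f x"] star_cexp by (simp add: continuous_on_minus)
qed

lemma component_unitary: "u \<in> unitary_identity_component \<Longrightarrow> u \<in> unitary_group"
  using connected_component_subset unfolding unitary_identity_component_def by blast

lemma unitary_mult_star: "u \<in> unitary_group \<Longrightarrow> u * star u = (1 :: 'a) \<and> star u * u = 1"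
  by (simp add: unitary_group_def)

lemma norm_unitary_mult: "u \<in> unitary_group \<Longrightarrow> norm (u * a) = norm a" for u a :: 'a
proof (rule antisym)
  assume u: "u \<in> unitary_group"
  have eq: "cmod (\<gamma> (u * a) x) = cmod (\<gamma> a x)" if "x \<in> X" for x
    using u that by (simp add: gamma_mult norm_mult unitary_iff)
  show "norm (u * a) \<le> norm a" using eq gamma_norm_le by (simp add: norm_le_iff)
  show "norm a \<le> norm (u * a)" using eq gamma_norm_le[of _ "u * a"] by (simp add: norm_le_iff)
qed

end

section \<open>Winding numbers and components\<close>

context gelfand
begin

definition wn :: "(real \<Rightarrow> 'a) \<Rightarrow> 'x \<Rightarrow> complex" where
  "wn p x = winding_number (\<lambda>t. \<gamma> (p t) x) 0"

lemma character_path: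
  assumes p: "p \<in> loops_at unitary_identity_component 1" and x: "x \<in> X"
  shows "path (\<lambda>t. \<gamma> (p t) x)" "0 \<notin> path_image (\<lambda>t. \<gamma> (p t) x)"
    "pathstart (\<lambda>t. \<gamma> (p t) x) = 1" "pathfinish (\<lambda>t. \<gamma> (p t) x) = 1"
    "\<And>t. t \<in> {0..1} \<Longrightarrow> cmod (\<gamma> (p t) x) = 1"
proof -
  have "path ((\<lambda>a. \<gamma> a x) \<circ> p)"
    using p by (intro path_continuous_image continuous_gamma x) (auto simp: loops_at_def)
  then show "path (\<lambda>t. \<gamma> (p t) x)" by (simp add: o_def)
  show n: "cmod (\<gamma> (p t) x) = 1" if "t \<in> {0..1}" for t
  proof -
    have "p t \<in> unitary_identity_component" using p that by (auto simp: loops_at_def path_image_def)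
    then show ?thesis using component_unitary unitary_iff x by blast
  qed
  show "0 \<notin> path_image (\<lambda>t. \<gamma> (p t) x)" unfolding path_image_def using n by force
  show "pathstart (\<lambda>t. \<gamma> (p t) x) = 1" "pathfinish (\<lambda>t. \<gamma> (p t) x) = 1"
    using p x by (auto simp: loops_at_def pathstart_def pathfinish_def gamma_one)
qed

lemma wn_homotopic:
  assumes "homotopic_paths unitary_identity_component p q" and x: "x \<in> X"
  shows "wn p x = wn q x"
proof -
  have "\<gamma> u x \<noteq> 0" if "u \<in> unitary_identity_component" for u
    using component_unitary[OF that] unitary_iff x by force
  then have "homotopic_paths (- {0}) ((\<lambda>a. \<gamma> a x) \<circ> p) ((\<lambda>a. \<gamma> a x) \<circ> q)"
    by (intro homotopic_paths_continuous_image[OF assms(1) continuous_gamma[OF x]]) auto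
  then show ?thesis unfolding wn_def using winding_number_homotopic_paths by (auto simp: o_def)
qed

lemma wn_join:
  assumes p: "p \<in> loops_at unitary_identity_component 1" and q: "q \<in> loops_at unitary_identity_component 1"
    and x: "x \<in> X"
  shows "wn (p +++ q) x = wn p x + wn q x"
proof -
  have "(\<lambda>t. \<gamma> ((p +++ q) t) x) = (\<lambda>t. \<gamma> (p t) x) +++ (\<lambda>t. \<gamma> (q t) x)"
    by (auto simp: joinpaths_def)
  then show ?thesis
    unfolding wn_def using character_path[OF p x] character_path[OF q x] by (simp add: winding_number_join)
qed

lemma wn_const: "x \<in> X \<Longrightarrow> wn (\<lambda>_. 1) x = 0"
  unfolding wn_def by (rule winding_number_constI[of 1]) (simp_all add: gamma_one)

text \<open>Uniform continuity on the compact product with the unit interval: evaluations at nearby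
  points are loops on the unit circle less than 1 apart, so they wind equally often around
  0.\<close>

lemma wn_uniformly_constant:
  assumes p: "p \<in> loops_at unitary_identity_component 1"
  obtains d where "d > 0" "\<And>x y. x \<in> X \<Longrightarrow> y \<in> X \<Longrightarrow> dist x y < d \<Longrightarrow> wn p x = wn p y"
proof -
  let ?f = "\<lambda>z. \<gamma> (p (snd z)) (fst z)"
  have pc: "continuous_on {0..1} p" using p by (simp add: loops_at_def path_def)
  have "continuous_on (X \<times> {0..1}) ?f"
    unfolding continuous_on_iff
  proof (intro ballI allI impI)
    fix z e assume z: "z \<in> X \<times> {0..1::real}" and e: "(e :: real) > 0"
    obtain d1 where d1: "d1 > 0" "\<And>t. t \<in> {0..1} \<Longrightarrow> dist t (snd z) < d1 \<Longrightarrow> dist (p t) (p (snd z)) < e / 2"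
      using pc[unfolded continuous_on_iff, rule_format, of "snd z" "e / 2"] z e by (auto simp: mem_Times_iff)
    obtain d2 where d2: "d2 > 0" "\<And>y. y \<in> X \<Longrightarrow> dist y (fst z) < d2 \<Longrightarrow> dist (\<gamma> (p (snd z)) y) (\<gamma> (p (snd z)) (fst z)) < e / 2"
      using gamma_cont[of "p (snd z)", unfolded continuous_on_iff, rule_format, of "fst z" "e / 2"] z e
      by (auto simp: mem_Times_iff)
    have "dist (?f w) (?f z) < e" if w: "w \<in> X \<times> {0..1}" "dist w z < min d1 d2" for w
    proof -
      have "dist (snd w) (snd z) < d1" "dist (fst w) (fst z) < d2"
        using w(2) dist_snd_le[of w z] dist_fst_le[of w z] by auto
      then have "dist (p (snd w)) (p (snd z)) < e / 2" "dist (\<gamma> (p (snd z)) (fst w)) (?f z) < e / 2"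
        using d1(2)[of "snd w"] d2(2)[of "fst w"] w(1) by auto
      moreover have "dist (?f w) (\<gamma> (p (snd z)) (fst w)) \<le> dist (p (snd w)) (p (snd z))"
        using w(1) gamma_norm_le[of "fst w" "p (snd w) - p (snd z)"] by (auto simp: dist_norm gamma_diff)
      ultimately show ?thesis using dist_triangle[of "?f w" "?f z" "\<gamma> (p (snd z)) (fst w)"] by linarith
    qed
    then show "\<exists>d>0. \<forall>w\<in>X \<times> {0..1}. dist w z < d \<longrightarrow> dist (?f w) (?f z) < e"
      using d1(1) d2(1) by (intro exI[of _ "min d1 d2"]) auto
  qed
  then have "uniformly_continuous_on (X \<times> {0..1}) ?f"
    by (rule compact_uniformly_continuous) (intro compact_Times X_compact compact_Icc)
  then obtain d where d: "d > 0" "\<And>w z. w \<in> X \<times> {0..1} \<Longrightarrow> z \<in> X \<times> {0..1} \<Longrightarrow> dist w z < d \<Longrightarrow> dist (?f w) (?f z) < 1"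
    unfolding uniformly_continuous_on_def by (metis dist_commute zero_less_one)
  have "wn p x = wn p y" if xy: "x \<in> X" "y \<in> X" "dist x y < d" for x y
    unfolding wn_def
  proof (rule winding_number_nearby_loops_eq)
    fix t :: real assume t: "t \<in> {0..1}"
    have "dist (\<gamma> (p t) x) (\<gamma> (p t) y) < 1" using d(2)[of "(x, t)" "(y, t)"] xy t by (simp add: dist_Pair_Pair)
    then show "cmod (\<gamma> (p t) x - \<gamma> (p t) y) < cmod (\<gamma> (p t) y - 0)"
      using character_path(5)[OF p xy(2) t] by (simp add: dist_norm)
  qed (use character_path[OF p] xy in auto)
  then show ?thesis using that d(1) by blast
qed

text \<open>Homotopy invariance makes the value on a class independent of the choice.\<close>

definition wn_class :: "(real \<Rightarrow> 'a) set \<Rightarrow> 'x \<Rightarrow> complex" where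
  "wn_class P x = wn (SOME p. p \<in> P) x"

lemma wn_class_eq:
  assumes p: "p \<in> loops_at unitary_identity_component 1" and x: "x \<in> X"
  shows "wn_class {q. homotopic_paths unitary_identity_component p q} x = wn p x"
proof -
  have "homotopic_paths unitary_identity_component p (SOME q. q \<in> {q. homotopic_paths unitary_identity_component p q})"
    using someI[of "\<lambda>q. q \<in> {q. homotopic_paths unitary_identity_component p q}" p] p by (simp add: loops_at_def)
  from wn_homotopic[OF this x] show ?thesis unfolding wn_class_def by (rule sym)
qed

abbreviation pi1 :: "(real \<Rightarrow> 'a) set monoid" where
  "pi1 \<equiv> fundamental_group unitary_identity_component 1"

lemma pi1_carrierE:
  assumes "P \<in> carrier pi1"
  obtains p where "p \<in> loops_at unitary_identity_component 1"
    "P = {q. homotopic_paths unitary_identity_component p q}"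
proof -
  have "\<exists>p. P = {q. homotopic_paths unitary_identity_component p q} \<and> p \<in> loops_at unitary_identity_component 1"
    using assms by (simp add: fundamental_group_def)
  then show ?thesis using that by (elim exE conjE)
qed

lemma wn_class_mult:
  assumes "P \<in> carrier pi1" "Q \<in> carrier pi1" "x \<in> X"
  shows "wn_class (P \<otimes>\<^bsub>pi1\<^esub> Q) x = wn_class P x + wn_class Q x"
proof -
  obtain p where p: "p \<in> loops_at unitary_identity_component 1" "P = {q. homotopic_paths unitary_identity_component p q}"
    using assms(1) by (rule pi1_carrierE)
  obtain q where q: "q \<in> loops_at unitary_identity_component 1" "Q = {r. homotopic_paths unitary_identity_component q r}"
    using assms(2) by (rule pi1_carrierE)
  have "p +++ q \<in> loops_at unitary_identity_component 1"
    using p(1) q(1) by (auto simp: loops_at_def path_image_join)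
  then show ?thesis
    unfolding p(2) q(2) fundamental_group_mult[OF p(1) q(1)]
    using wn_class_eq[OF _ assms(3)] p(1) q(1) wn_join[OF p(1) q(1) assms(3)] by simp
qed

lemma wn_class_one: "x \<in> X \<Longrightarrow> wn_class \<one>\<^bsub>pi1\<^esub> x = 0"
proof -
  assume x: "x \<in> X"
  have "(\<lambda>_. 1) \<in> loops_at unitary_identity_component (1 :: 'a)"
    using one_in_component by (auto simp: loops_at_def path_def pathstart_def pathfinish_def path_image_def)
  from wn_class_eq[OF this x] wn_const[OF x] show ?thesis by (simp add: fundamental_group_def)
qed

text \<open>At each point the winding number is a homomorphism, so two points that agree on the
  generators agree on the whole group.\<close>

lemma wn_class_generate:
  assumes H: "H \<subseteq> carrier pi1" and P: "P \<in> generate pi1 H" and x: "x \<in> X" and y: "y \<in> X"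
    and eq: "\<And>h. h \<in> H \<Longrightarrow> wn_class h x = wn_class h y"
  shows "wn_class P x = wn_class P y"
proof -
  interpret G: group pi1 by (rule group_fundamental_group[OF one_in_component])
  show ?thesis
    using P
  proof induction
    case (inv h)
    have h: "h \<in> carrier pi1" using inv H by blast
    have "wn_class (inv\<^bsub>pi1\<^esub> h) z = - wn_class h z" if "z \<in> X" for z
    proof -
      have "wn_class (inv\<^bsub>pi1\<^esub> h \<otimes>\<^bsub>pi1\<^esub> h) z = 0"
        using wn_class_one[OF that] h by simp
      then show ?thesis using wn_class_mult[OF _ h that, of "inv\<^bsub>pi1\<^esub> h"] h by (simp add: eq_neg_iff_add_eq_0)
    qed
    then show ?case using eq[OF inv] x y by simp
  next
    case (eng h1 h2)
    then have "h1 \<in> carrier pi1" "h2 \<in> carrier pi1" using G.generate_in_carrier[OF H] by auto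
    then show ?case using eng wn_class_mult x y by simp
  qed (use x y eq wn_class_one in auto)
qed

text \<open>The loop \<open>t \<mapsto> exp (2 \<pi> i t 1\<^sub>C)\<close> winds once around the origin at the characters in \<open>C\<close> and
  not at all at the others.\<close>

lemma clopen_loop:
  assumes C: "openin (top_of_set X) C" "closedin (top_of_set X) C"
  obtains p where "p \<in> loops_at unitary_identity_component 1"
    "\<And>x. x \<in> X \<Longrightarrow> wn p x = (if x \<in> C then 1 else 0)"
proof -
  have CX: "C \<subseteq> X" using C(2) closedin_subset by force
  define f where "f x = (if x \<in> C then 2 * pi else 0)" for x
  have f: "continuous_on X f"
  proof -
    have "continuous_on (C \<union> (X - C)) f"
      unfolding f_def
    proof (rule continuous_on_cases_local)
      have "C \<union> (X - C) = X" using CX by blast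
      then show "closedin (top_of_set (C \<union> (X - C))) C" "closedin (top_of_set (C \<union> (X - C))) (X - C)"
        using C(2) closedin_diff[OF closedin_topspace C(1)] by simp_all
    qed auto
    moreover have "C \<union> (X - C) = X" using CX by blast
    ultimately show ?thesis by simp
  qed
  define p where "p = (\<lambda>t. cexp (\<lambda>x. t * f x))"
  have ct: "continuous_on X (\<lambda>x. t * f x)" for t by (intro continuous_intros f)
  have p1: "p 1 = 1"
    unfolding p_def by (rule gamma_eqI) (use ct[of 1] in \<open>simp add: gamma_cexp gamma_one f_def\<close>)
  have p0: "p 0 = 1" by (simp add: p_def cexp_zero)
  have p: "p \<in> loops_at unitary_identity_component 1"
    unfolding loops_at_def using p0 p1 continuous_cexp_scale[OF f] cexp_in_component[OF ct]
    by (auto simp: path_def pathstart_def pathfinish_def path_image_def p_def)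
  have "wn p x = (if x \<in> C then 1 else 0)" if x: "x \<in> X" for x
  proof (cases "x \<in> C")
    case True
    have "(\<lambda>t. \<gamma> (p t) x) = circlepath 0 1"
      using gamma_cexp[OF ct x] True
      by (simp add: p_def f_def circlepath_def part_circlepath_def linepath_def cis_conv_exp algebra_simps fun_eq_iff)
    then show ?thesis using True by (simp add: wn_def winding_number_circlepath_centre)
  next
    case False
    have "(\<lambda>t. \<gamma> (p t) x) = (\<lambda>_. 1)"
      using gamma_cexp[OF ct x] False by (simp add: p_def f_def)
    then show ?thesis using False winding_number_constI[of 1 0 "\<lambda>_. 1"] by (simp add: wn_def)
  qed
  then show ?thesis using that p by blast
qed

text \<open>Points are identified when the finitely many generators wind equally around 0 at both.
  The classes are uniformly open, hence finite in number. A clopen part of a class is clopen in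
  \<open>X\<close>, so its loop would wind differently at equivalent points unless the part is
  trivial; thus classes are connected.\<close>

lemma base_points:
  assumes "finitely_generated_group pi1"
  obtains b d where "d > 0" "\<And>x y. x \<in> X \<Longrightarrow> y \<in> X \<Longrightarrow> dist x y < d \<Longrightarrow> b x = b y"
    "\<And>x. x \<in> X \<Longrightarrow> b x \<in> X" "\<And>x. x \<in> X \<Longrightarrow> b (b x) = b x" "finite (b ` X)"
    "\<And>x. x \<in> X \<Longrightarrow> connected {y \<in> X. b y = b x}"
proof -
  obtain H where H: "finite H" "H \<subseteq> carrier pi1" "generate pi1 H = carrier pi1"
    using assms unfolding finitely_generated_group_def by blast
  define eq where "eq x y \<longleftrightarrow> (\<forall>h\<in>H. wn_class h x = wn_class h y)" for x y
  have "\<exists>d>0. \<forall>x\<in>X. \<forall>y\<in>X. dist x y < d \<longrightarrow> wn_class h x = wn_class h y" if h: "h \<in> H" for h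
  proof -
    obtain p where p: "p \<in> loops_at unitary_identity_component 1"
      "h = {q. homotopic_paths unitary_identity_component p q}"
      using h H(2) pi1_carrierE[of h] by blast
    obtain d where "d > 0" "\<And>x y. x \<in> X \<Longrightarrow> y \<in> X \<Longrightarrow> dist x y < d \<Longrightarrow> wn p x = wn p y"
      using wn_uniformly_constant[OF p(1)] by blast
    then show ?thesis unfolding p(2) using wn_class_eq[OF p(1)] by (intro exI[of _ d] conjI ballI impI) metis+
  qed
  then have "\<forall>h\<in>H. \<exists>d. d > 0 \<and> (\<forall>x\<in>X. \<forall>y\<in>X. dist x y < d \<longrightarrow> wn_class h x = wn_class h y)"
    by blast
  from bchoice[OF this] obtain D where
    "\<forall>h\<in>H. D h > 0 \<and> (\<forall>x\<in>X. \<forall>y\<in>X. dist x y < D h \<longrightarrow> wn_class h x = wn_class h y)" ..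
  then have D: "\<And>h. h \<in> H \<Longrightarrow> D h > 0"
    "\<And>h x y. h \<in> H \<Longrightarrow> x \<in> X \<Longrightarrow> y \<in> X \<Longrightarrow> dist x y < D h \<Longrightarrow> wn_class h x = wn_class h y"
    by blast+
  \<comment> \<open>The 1 keeps the minimum meaningful when there are no generators.\<close>
  define d where "d = Min (insert 1 (D ` H))"
  have d: "d > 0" unfolding d_def using H(1) D(1) by (subst Min_gr_iff) auto
  have near_eq: "eq x y" if "x \<in> X" "y \<in> X" "dist x y < d" for x y
    unfolding eq_def
  proof
    fix h assume h: "h \<in> H"
    have "d \<le> D h" unfolding d_def using H(1) h by (intro Min_le) auto
    then show "wn_class h x = wn_class h y" using that by (intro D(2)[OF h]) auto
  qed
  \<comment> \<open>Equivalent points satisfy the same predicate in \<open>y\<close>, so the choice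
    is constant on each class.\<close>
  define b where "b x = (SOME y. y \<in> X \<and> eq x y)" for x
  have b: "b x \<in> X \<and> eq x (b x)" if "x \<in> X" for x
    unfolding b_def by (rule someI[of "\<lambda>y. y \<in> X \<and> eq x y" x]) (simp add: that eq_def)
  have eq_sym: "eq y x" if "eq x y" for x y
    using that unfolding eq_def by metis
  have eq_trans: "eq x z" if "eq x y" "eq y z" for x y z
    using that unfolding eq_def by metis
  have b_cong: "b x = b y" if "eq x y" for x y
  proof -
    have "eq x z \<longleftrightarrow> eq y z" for z using that eq_sym eq_trans by blast
    then show ?thesis unfolding b_def by simp
  qed
  have b_eq: "b x = b y \<longleftrightarrow> eq x y" if "x \<in> X" "y \<in> X" for x y
    using b[OF that(1)] b[OF that(2)] b_cong eq_sym eq_trans by metis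
  have loc: "b x = b y" if "x \<in> X" "y \<in> X" "dist x y < d" for x y
    using b_cong near_eq that by blast
  have clopen: "eq x y \<Longrightarrow> x \<in> C \<longleftrightarrow> y \<in> C"
    if C: "openin (top_of_set X) C" "closedin (top_of_set X) C" and "x \<in> X" "y \<in> X" for C x y
  proof -
    assume e: "eq x y"
    obtain p where p: "p \<in> loops_at unitary_identity_component 1"
      "\<And>x. x \<in> X \<Longrightarrow> wn p x = (if x \<in> C then 1 else 0)" using clopen_loop[OF C] by blast
    let ?P = "{q. homotopic_paths unitary_identity_component p q}"
    have "?P \<in> generate pi1 H" using p(1) unfolding H(3) by (auto simp: fundamental_group_def)
    then have "wn_class ?P x = wn_class ?P y"
      using wn_class_generate[OF H(2)] \<open>x \<in> X\<close> \<open>y \<in> X\<close> e unfolding eq_def by blast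
    then have "wn p x = wn p y" using wn_class_eq[OF p(1)] \<open>x \<in> X\<close> \<open>y \<in> X\<close> by simp
    then show ?thesis using p(2) \<open>x \<in> X\<close> \<open>y \<in> X\<close> by (auto split: if_splits)
  qed
  have con: "connected {y \<in> X. b y = b x}" if x: "x \<in> X" for x
  proof -
    let ?L = "{y \<in> X. b y = b x}"
    have open_b: "openin (top_of_set X) {y \<in> X. Q (b y)}" for Q
      unfolding openin_euclidean_subtopology_iff
    proof (intro conjI ballI exI[of _ d] d impI)
      fix y z assume "y \<in> {y \<in> X. Q (b y)}" "z \<in> X" "dist z y < d"
      then show "z \<in> {y \<in> X. Q (b y)}" using loc[of z y] by simp
    qed auto
    have L: "openin (top_of_set X) ?L" by (rule open_b)
    have "X - ?L = {y \<in> X. b y \<noteq> b x}" by auto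
    then have L': "closedin (top_of_set X) ?L"
      using open_b[of "\<lambda>z. z \<noteq> b x"] by (simp add: closedin_def)
    show ?thesis
      unfolding connected_clopen
    proof (intro allI impI, elim conjE)
      fix T assume T: "openin (top_of_set ?L) T" "closedin (top_of_set ?L) T"
      have TC: "openin (top_of_set X) T" "closedin (top_of_set X) T"
        using openin_trans[OF T(1) L] closedin_trans[OF T(2) L'] by auto
      have "T \<subseteq> ?L" using T(1) openin_subset by force
      moreover have "y \<in> T \<longleftrightarrow> z \<in> T" if "y \<in> ?L" "z \<in> ?L" for y z
      proof -
        have "eq y z" using b_eq[of y z] that by auto
        then show ?thesis using clopen[OF TC] that by blast
      qed
      ultimately show "T = {} \<or> T = ?L" by blast
    qed
  qed
  have fin: "finite (b ` X)"
  proof -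
    have "X \<subseteq> (\<Union>x\<in>X. ball x d)" using d by force
    then obtain S where S: "S \<subseteq> X" "finite S" "X \<subseteq> (\<Union>x\<in>S. ball x d)"
      by (rule compactE_image[OF X_compact open_ball])
    have "b ` X \<subseteq> b ` S"
    proof
      fix z assume "z \<in> b ` X"
      then obtain x where x: "x \<in> X" "z = b x" by blast
      then obtain s where s: "s \<in> S" "dist s x < d" using S(3) by auto
      then have "b s = z" using loc[of s x] x S(1) by (metis subsetD)
      then show "z \<in> b ` S" using s(1) by (rule image_eqI[OF sym])
    qed
    then show ?thesis by (rule finite_subset[OF _ finite_imageI[OF S(2)]])
  qed
  have idem: "b (b x) = b x" if "x \<in> X" for x
    by (rule b_cong[OF conjunct2[OF b[OF that]], symmetric])
  show ?thesis by (rule that[OF d loc conjunct1[OF b] idem fin con])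
qed

text \<open>Over a finite spectrum, the indicators of the points would span the algebra.\<close>

lemma infinite_spectrum:
  assumes "infinite_dimensional TYPE('a)"
  shows "infinite X"
proof
  assume fin: "finite X"
  have "\<exists>a. \<forall>y\<in>X. \<gamma> a y = (if y = x then 1 else 0)" for x
    using fin by (intro gamma_surj continuous_on_finite)
  then obtain e where e: "\<And>x y. y \<in> X \<Longrightarrow> \<gamma> (e x) y = (if y = x then 1 else 0)" by metis
  interpret V: vector_space "scaleC :: complex \<Rightarrow> 'a \<Rightarrow> 'a" by (rule vector_space_scaleC)
  have gsum: "\<gamma> (\<Sum>x\<in>S. f x) y = (\<Sum>x\<in>S. \<gamma> (f x) y)" if "finite S" "y \<in> X" for S y and f :: "'x \<Rightarrow> 'a"
    using that by (induction S rule: finite_induct) (auto simp: gamma_add)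
  have decomp: "a = (\<Sum>x\<in>X. scaleC (\<gamma> a x) (e x))" for a
  proof (rule gamma_eqI)
    fix y assume y: "y \<in> X"
    have "\<gamma> (\<Sum>x\<in>X. scaleC (\<gamma> a x) (e x)) y = (\<Sum>x\<in>X. \<gamma> a x * (if y = x then 1 else 0))"
      using y e by (simp add: gsum[OF fin y] gamma_scaleC)
    also have "\<dots> = (\<Sum>x\<in>X. if y = x then \<gamma> a x else 0)" by (intro sum.cong) auto
    also have "\<dots> = \<gamma> a y" using fin y by (simp add: sum.delta')
    finally show "\<gamma> a y = \<gamma> (\<Sum>x\<in>X. scaleC (\<gamma> a x) (e x)) y" by simp
  qed
  have "(\<Sum>x\<in>X. scaleC (\<gamma> a x) (e x)) \<in> V.span (e ` X)" for a
    by (intro V.span_sum V.span_scale V.span_base) auto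
  then have "a \<in> V.span (e ` X)" for a by (subst decomp)
  then have "V.span (e ` X) = UNIV" by auto
  moreover have "finite (e ` X)" using fin by (rule finite_imageI)
  ultimately show False using assms unfolding infinite_dimensional_def by (elim notE) (intro exI conjI)
qed

end

section \<open>Quasi-isometries and maximal metrics in general\<close>

lemma quasi_isometryE:
  assumes "quasi_isometry X Y f"
  obtains K L e where "f \<in> mspace X \<rightarrow> mspace Y" "K > 0" "L > 0" "e > 0"
    "\<And>x y. x \<in> mspace X \<Longrightarrow> y \<in> mspace X \<Longrightarrow> mdist X x y \<le> K * mdist Y (f x) (f y) + L"
    "\<And>x y. x \<in> mspace X \<Longrightarrow> y \<in> mspace X \<Longrightarrow> mdist Y (f x) (f y) \<le> K * mdist X x y + L"
    "\<And>y. y \<in> mspace Y \<Longrightarrow> \<exists>x\<in>mspace X. mdist Y y (f x) < e"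
proof -
  obtain K L e where *: "f \<in> mspace X \<rightarrow> mspace Y" "K > 0" "L > 0" "e > 0"
    "\<And>x y. x \<in> mspace X \<Longrightarrow> y \<in> mspace X \<Longrightarrow> 1 / K * mdist X x y - L \<le> mdist Y (f x) (f y)"
    "\<And>x y. x \<in> mspace X \<Longrightarrow> y \<in> mspace X \<Longrightarrow> mdist Y (f x) (f y) \<le> K * mdist X x y + L"
    "\<And>y. y \<in> mspace Y \<Longrightarrow> \<exists>x\<in>mspace X. mdist Y y (f x) < e"
    using assms unfolding quasi_isometry_def by auto
  have low: "mdist X x y \<le> K * mdist Y (f x) (f y) + K * L" if "x \<in> mspace X" "y \<in> mspace X" for x y
    using *(5)[OF that] *(2) by (simp add: field_simps)
  show ?thesis
  proof (rule that[of K "max L (K * L)" e])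
    show "mdist X x y \<le> K * mdist Y (f x) (f y) + max L (K * L)" if "x \<in> mspace X" "y \<in> mspace X" for x y
      using low[OF that] by linarith
    show "mdist Y (f x) (f y) \<le> K * mdist X x y + max L (K * L)" if "x \<in> mspace X" "y \<in> mspace X" for x y
      using *(6)[OF that] by linarith
    show "max L (K * L) > 0" using *(3) by simp
  qed (use * in auto)
qed

lemma quasi_isometryI:
  assumes "f \<in> mspace X \<rightarrow> mspace Y" "K > 0" "L > 0" "e > 0"
    and low: "\<And>x y. x \<in> mspace X \<Longrightarrow> y \<in> mspace X \<Longrightarrow> mdist X x y \<le> K * mdist Y (f x) (f y) + L"
    and up: "\<And>x y. x \<in> mspace X \<Longrightarrow> y \<in> mspace X \<Longrightarrow> mdist Y (f x) (f y) \<le> K * mdist X x y + L"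
    and "\<And>y. y \<in> mspace Y \<Longrightarrow> \<exists>x\<in>mspace X. mdist Y y (f x) < e"
  shows "quasi_isometry X Y f"
proof -
  let ?L = "max L (L / K)"
  have "1 / K * mdist X x y - ?L \<le> mdist Y (f x) (f y) \<and> mdist Y (f x) (f y) \<le> K * mdist X x y + ?L"
    if xy: "x \<in> mspace X" "y \<in> mspace X" for x y
  proof
    have "1 / K * mdist X x y \<le> 1 / K * (K * mdist Y (f x) (f y) + L)"
      using low[OF xy] assms(2) by (intro mult_left_mono) auto
    also have "\<dots> = mdist Y (f x) (f y) + L / K" using assms(2) by (simp add: distrib_left)
    finally show "1 / K * mdist X x y - ?L \<le> mdist Y (f x) (f y)" by linarith
    show "mdist Y (f x) (f y) \<le> K * mdist X x y + ?L" using up[OF xy] by linarith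
  qed
  moreover have "?L > 0" using assms(3) by simp
  ultimately have "\<exists>K>0. \<exists>L>0. \<forall>x\<in>mspace X. \<forall>y\<in>mspace X.
      1 / K * mdist X x y - L \<le> mdist Y (f x) (f y) \<and> mdist Y (f x) (f y) \<le> K * mdist X x y + L"
    using assms(2) by blast
  moreover have "\<exists>e>0. \<forall>y\<in>mspace Y. \<exists>x\<in>mspace X. mdist Y y (f x) < e"
    using assms(4,7) by blast
  ultimately show ?thesis using assms(1) unfolding quasi_isometry_def by blast
qed

lemma quasi_isometric_trans:
  assumes "quasi_isometric X Y" "quasi_isometric Y Z"
  shows "quasi_isometric X Z"
proof -
  obtain f g where "quasi_isometry X Y f" "quasi_isometry Y Z g"
    using assms unfolding quasi_isometric_def by blast
  obtain K L e where f: "f \<in> mspace X \<rightarrow> mspace Y" "K > 0" "L > 0" "e > 0"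
    "\<And>x y. x \<in> mspace X \<Longrightarrow> y \<in> mspace X \<Longrightarrow> mdist X x y \<le> K * mdist Y (f x) (f y) + L"
    "\<And>x y. x \<in> mspace X \<Longrightarrow> y \<in> mspace X \<Longrightarrow> mdist Y (f x) (f y) \<le> K * mdist X x y + L"
    "\<And>y. y \<in> mspace Y \<Longrightarrow> \<exists>x\<in>mspace X. mdist Y y (f x) < e"
    by (rule quasi_isometryE[OF \<open>quasi_isometry X Y f\<close>]) (rule that)
  obtain K' L' e' where g: "g \<in> mspace Y \<rightarrow> mspace Z" "K' > 0" "L' > 0" "e' > 0"
    "\<And>x y. x \<in> mspace Y \<Longrightarrow> y \<in> mspace Y \<Longrightarrow> mdist Y x y \<le> K' * mdist Z (g x) (g y) + L'"
    "\<And>x y. x \<in> mspace Y \<Longrightarrow> y \<in> mspace Y \<Longrightarrow> mdist Z (g x) (g y) \<le> K' * mdist Y x y + L'"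
    "\<And>y. y \<in> mspace Z \<Longrightarrow> \<exists>x\<in>mspace Y. mdist Z y (g x) < e'"
    by (rule quasi_isometryE[OF \<open>quasi_isometry Y Z g\<close>]) (rule that)
  have fY: "f x \<in> mspace Y" if "x \<in> mspace X" for x using f(1) that by blast
  have gZ: "g y \<in> mspace Z" if "y \<in> mspace Y" for y using g(1) that by blast
  have "quasi_isometry X Z (g \<circ> f)"
  proof (rule quasi_isometryI[where K = "K * K'" and L = "K * L' + L + K' * L + L'" and e = "e' + (K' * e + L')"])
    fix x y assume xy: "x \<in> mspace X" "y \<in> mspace X"
    have "mdist X x y \<le> K * (K' * mdist Z (g (f x)) (g (f y)) + L') + L"
      using f(5)[OF xy] mult_left_mono[OF g(5)[OF fY[OF xy(1)] fY[OF xy(2)]], of K] f(2) by linarith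
    moreover have "K' * L > 0" using f g by simp
    ultimately show "mdist X x y \<le> K * K' * mdist Z ((g \<circ> f) x) ((g \<circ> f) y) + (K * L' + L + K' * L + L')"
      using g(3) by (simp add: distrib_left mult.assoc)
    have "mdist Z (g (f x)) (g (f y)) \<le> K' * (K * mdist X x y + L) + L'"
      using g(6)[OF fY[OF xy(1)] fY[OF xy(2)]] mult_left_mono[OF f(6)[OF xy], of K'] g(2) by linarith
    moreover have "K * L' > 0" using f g by simp
    ultimately show "mdist Z ((g \<circ> f) x) ((g \<circ> f) y) \<le> K * K' * mdist X x y + (K * L' + L + K' * L + L')"
      using f(3) by (simp add: distrib_left mult.assoc mult.left_commute)
  next
    fix z assume z: "z \<in> mspace Z"
    obtain y where y: "y \<in> mspace Y" "mdist Z z (g y) < e'" using g(7)[OF z] by blast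
    obtain x where x: "x \<in> mspace X" "mdist Y y (f x) < e" using f(7)[OF y(1)] by blast
    interpret Z: Metric_space "mspace Z" "mdist Z" by (rule Metric_space_mspace_mdist)
    have "mdist Z (g y) (g (f x)) \<le> K' * e + L'"
      using g(6)[OF y(1) fY[OF x(1)]] mult_left_mono[of "mdist Y y (f x)" e K'] x(2) g(2) by linarith
    then have "mdist Z z (g (f x)) < e' + (K' * e + L')"
      using Z.triangle[OF z gZ[OF y(1)] gZ[OF fY[OF x(1)]]] y(2) by linarith
    then show "\<exists>x\<in>mspace X. mdist Z z ((g \<circ> f) x) < e' + (K' * e + L')" using x(1) by auto
  qed (use f g fY gZ in \<open>auto intro!: add_pos_pos\<close>)
  then show ?thesis unfolding quasi_isometric_def by blast
qed

text \<open>A coarse inverse \<open>g\<close> selects points whose images are within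
  \<open>e\<close>; each passage through \<open>f\<close> costs at most that error on either
  side.\<close>

lemma quasi_isometric_sym:
  assumes "quasi_isometric X Y"
  shows "quasi_isometric Y X"
proof -
  obtain f where "quasi_isometry X Y f" using assms unfolding quasi_isometric_def by blast
  obtain K L e where f: "f \<in> mspace X \<rightarrow> mspace Y" "K > 0" "L > 0" "e > 0"
    "\<And>x y. x \<in> mspace X \<Longrightarrow> y \<in> mspace X \<Longrightarrow> mdist X x y \<le> K * mdist Y (f x) (f y) + L"
    "\<And>x y. x \<in> mspace X \<Longrightarrow> y \<in> mspace X \<Longrightarrow> mdist Y (f x) (f y) \<le> K * mdist X x y + L"
    "\<And>y. y \<in> mspace Y \<Longrightarrow> \<exists>x\<in>mspace X. mdist Y y (f x) < e"
    by (rule quasi_isometryE[OF \<open>quasi_isometry X Y f\<close>]) (rule that)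
  interpret Y: Metric_space "mspace Y" "mdist Y" by (rule Metric_space_mspace_mdist)
  interpret X: Metric_space "mspace X" "mdist X" by (rule Metric_space_mspace_mdist)
  have fY: "f x \<in> mspace Y" if "x \<in> mspace X" for x using f(1) that by blast
  from f(7) obtain g where g: "\<And>y. y \<in> mspace Y \<Longrightarrow> g y \<in> mspace X \<and> mdist Y y (f (g y)) < e"
    by metis
  have up: "mdist Y (f (g x)) (f (g y)) \<le> mdist Y x y + 2 * e"
    and low: "mdist Y x y \<le> mdist Y (f (g x)) (f (g y)) + 2 * e" if xy: "x \<in> mspace Y" "y \<in> mspace Y" for x y
  proof -
    note gx = g[OF xy(1)] and gy = g[OF xy(2)]
    note fx = fY[OF conjunct1[OF gx]] and fy = fY[OF conjunct1[OF gy]]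
    show "mdist Y (f (g x)) (f (g y)) \<le> mdist Y x y + 2 * e"
      using Y.triangle[OF fx xy(1) fy] Y.triangle[OF xy fy] gx gy Y.commute[of "f (g x)" x] by linarith
    show "mdist Y x y \<le> mdist Y (f (g x)) (f (g y)) + 2 * e"
      using Y.triangle[OF xy(1) fx xy(2)] Y.triangle[OF fx fy xy(2)] gx gy Y.commute[of "f (g y)" y] by linarith
  qed
  have "quasi_isometry Y X g"
  proof (rule quasi_isometryI[where K = K and L = "L + K * (2 * e) + 2 * e" and e = "K * e + L"])
    fix x y assume xy: "x \<in> mspace Y" "y \<in> mspace Y"
    show "mdist Y x y \<le> K * mdist X (g x) (g y) + (L + K * (2 * e) + 2 * e)"
    proof -
      have "K * (2 * e) > 0" using f by simp
      then show ?thesis using low[OF xy] f(6)[of "g x" "g y"] g[OF xy(1)] g[OF xy(2)] f(3,4) by linarith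
    qed
    show "mdist X (g x) (g y) \<le> K * mdist Y x y + (L + K * (2 * e) + 2 * e)"
    proof -
      have "mdist X (g x) (g y) \<le> K * (mdist Y x y + 2 * e) + L"
        using f(5)[of "g x" "g y"] g[OF xy(1)] g[OF xy(2)] mult_left_mono[OF up[OF xy], of K] f(2) by linarith
      then show ?thesis using f(4) by (simp add: distrib_left)
    qed
  next
    fix x assume x: "x \<in> mspace X"
    have "mdist X x (g (f x)) \<le> K * mdist Y (f x) (f (g (f x))) + L"
      using f(5)[OF x] g[OF fY[OF x]] by blast
    also have "\<dots> < K * e + L" using g[OF fY[OF x]] f(2) by simp
    finally show "\<exists>y\<in>mspace Y. mdist X x (g y) < K * e + L" using fY[OF x] by blast
  qed (use f g in \<open>auto intro!: add_pos_pos mult_pos_pos\<close>)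
  then show ?thesis unfolding quasi_isometric_def by blast
qed

lemma continuous_mdist:
  fixes G :: "'g::metric_space set"
  assumes ms: "mspace m = G" and top: "mtopology_of m = top_of_set G"
  shows "continuous_on (G \<times> G) (\<lambda>(x, y). mdist m x y)"
  unfolding continuous_on_iff
proof (intro ballI allI impI)
  interpret M: Metric_space G "mdist m" using Metric_space_mspace_mdist[of m] by (simp add: ms)
  have mt: "M.mtopology = top_of_set G" using top by (simp add: mtopology_of_def ms)
  have near: "\<exists>d>0. \<forall>y\<in>G. dist y x < d \<longrightarrow> mdist m x y < e" if "x \<in> G" "e > 0" for x e
  proof -
    have "openin (top_of_set G) (M.mball x e)" using M.openin_mball by (simp flip: mt)
    moreover have "x \<in> M.mball x e" using that by simp
    ultimately obtain d where "d > 0" "\<forall>y\<in>G. dist y x < d \<longrightarrow> y \<in> M.mball x e"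
      unfolding openin_euclidean_subtopology_iff by blast
    then show ?thesis by auto
  qed
  fix z e assume z: "z \<in> G \<times> G" and e: "(e :: real) > 0"
  obtain x y where xy: "z = (x, y)" "x \<in> G" "y \<in> G" using z by blast
  obtain d1 where d1: "d1 > 0" "\<forall>u\<in>G. dist u x < d1 \<longrightarrow> mdist m x u < e / 2" using near[OF xy(2), of "e / 2"] e by auto
  obtain d2 where d2: "d2 > 0" "\<forall>u\<in>G. dist u y < d2 \<longrightarrow> mdist m y u < e / 2" using near[OF xy(3), of "e / 2"] e by auto
  have "dist (mdist m u v) (mdist m x y) < e" if uv: "u \<in> G" "v \<in> G" "dist (u, v) (x, y) < min d1 d2" for u v
  proof -
    have "dist u x < d1" "dist v y < d2"
      using uv(3) dist_fst_le[of "(u, v)" "(x, y)"] dist_snd_le[of "(u, v)" "(x, y)"] by auto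
    then have "mdist m x u < e / 2" "mdist m y v < e / 2" using d1 d2 uv by auto
    then show ?thesis
      using M.triangle[OF uv(1) xy(2) uv(2)] M.triangle[OF xy(2,3) uv(2)]
        M.triangle[OF xy(2) uv(1) xy(3)] M.triangle[OF uv(1,2) xy(3)] M.commute[of u x] M.commute[of v y]
      unfolding dist_real_def by linarith
  qed
  then show "\<exists>d>0. \<forall>w\<in>G \<times> G. dist w z < d \<longrightarrow>
      dist (case w of (x, y) \<Rightarrow> mdist m x y) (case z of (x, y) \<Rightarrow> mdist m x y) < e"
    using d1(1) d2(1) xy(1) by (intro exI[of _ "min d1 d2"]) auto
qed

text \<open>The metric \<open>m\<close> is itself a continuous left-invariant pseudometric, so the
  maximality of \<open>m'\<close> applies to it.\<close>

lemma maximal_metric_comparison: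
  fixes G :: "'g::{times, metric_space} set"
  assumes m: "maximal_metric G m" and m': "maximal_metric G m'"
  obtains K L where "K > 0" "L > 0" "\<And>x y. x \<in> G \<Longrightarrow> y \<in> G \<Longrightarrow> mdist m x y \<le> K * mdist m' x y + L"
proof -
  have ms: "mspace m = G" "mtopology_of m = top_of_set G" "left_invariant G (mdist m)"
    using m unfolding maximal_metric_def by auto
  interpret M: Metric_space G "mdist m" using Metric_space_mspace_mdist[of m] by (simp add: ms)
  have "pseudometric_on G (mdist m)"
    unfolding pseudometric_on_def using M.commute M.triangle by auto
  then show ?thesis
    using m' ms(3) continuous_mdist[OF ms(1,2)] that unfolding maximal_metric_def by meson
qed

section \<open>The model of the identity component\<close>

text \<open>\<open>b\<close> sends each point to the base point of its component.\<close>

locale based_gelfand = gelfand X \<gamma>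
  for X :: "'x::metric_space set" and \<gamma> :: "'a::unital_cstar_algebra \<Rightarrow> 'x \<Rightarrow> complex" +
  fixes b :: "'x \<Rightarrow> 'x" and \<delta> :: real
  assumes delta: "\<delta> > 0"
    and b_locally_constant: "x \<in> X \<Longrightarrow> y \<in> X \<Longrightarrow> dist x y < \<delta> \<Longrightarrow> b x = b y"
    and b_in: "x \<in> X \<Longrightarrow> b x \<in> X"
    and b_idem: "x \<in> X \<Longrightarrow> b (b x) = b x"
    and b_finite: "finite (b ` X)"
    and b_connected: "x \<in> X \<Longrightarrow> connected {y \<in> X. b y = b x}"
begin

text \<open>As \<open>b\<close> is constant on small balls, even the integer part of a function may
  be composed with it; this is how multiples of 2 pi are removed later.\<close>

lemma continuous_comp_b: "continuous_on X (\<lambda>x. h (b x))" for h :: "'x \<Rightarrow> 's::metric_space"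
  unfolding continuous_on_iff
proof (intro ballI allI impI exI[of _ \<delta>] conjI delta)
  fix x y and e :: real assume "x \<in> X" "y \<in> X" "dist y x < \<delta>" "e > 0"
  then show "dist (h (b y)) (h (b x)) < e" using b_locally_constant[of y x] by simp
qed

section \<open>Logarithms that vanish at the base points\<close>

definition reduced :: "('x \<Rightarrow> real) \<Rightarrow> 'x \<Rightarrow> real" where
  "reduced h = (\<lambda>x. if x \<in> X then h x - h (b x) else 0)"

lemma reduced_in: "continuous_on X h \<Longrightarrow> reduced h \<in> CF X (b ` X)"
proof -
  assume h: "continuous_on X h"
  have "continuous_on X (\<lambda>x. h x - h (b x))" by (intro continuous_intros h continuous_comp_b)
  then have "continuous_on X (reduced h)" by (simp add: reduced_def cong: continuous_on_cong)
  then show ?thesis by (auto simp: CF_def reduced_def b_idem)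
qed

lemma reduced_id:
  assumes "f \<in> CF X (b ` X)"
  shows "reduced f = f"
proof
  fix x
  show "reduced f x = f x" using assms b_in by (auto simp: reduced_def CF_def)
qed

text \<open>Two logarithms of the same unitary differ by a function with values in \<open>2 \<pi> \<int>\<close>, which is
  constant on each component.\<close>

lemma reduced_unique:
  assumes f: "continuous_on X f" and g: "continuous_on X g" and eq: "cexp f = cexp g"
  shows "reduced f = reduced g"
proof
  fix x
  show "reduced f x = reduced g x"
  proof (cases "x \<in> X")
    case True
    let ?L = "{y \<in> X. b y = b x}"
    define k where "k y = f y - g y" for y
    have int: "\<exists>n :: int. k y = 2 * pi * n" if "y \<in> X" for y
    proof -
      have "cis (f y) = cis (g y)" using eq cexp_eq_iff[OF f g] that by blast
      then have "sin (f y) = sin (g y) \<and> cos (f y) = cos (g y)" by (metis cis.sel)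
      then obtain n :: int where "f y = g y + 2 * pi * n" using sin_cos_eq_iff by blast
      then show ?thesis by (auto simp: k_def)
    qed
    have "continuous_on ?L k"
      unfolding k_def by (intro continuous_intros continuous_on_subset[OF f] continuous_on_subset[OF g]) auto
    then have "k constant_on ?L"
    proof (rule continuous_discrete_range_constant[OF b_connected[OF True]])
      fix y assume y: "y \<in> ?L"
      have "2 * pi \<le> norm (k z - k y)" if z: "z \<in> ?L" "k z \<noteq> k y" for z
      proof -
        obtain m :: int where m: "k z = 2 * pi * m" using int[of z] z by auto
        obtain n :: int where n: "k y = 2 * pi * n" using int[of y] y by auto
        note mn = m n
        then have "m \<noteq> n" using z by auto
        then have "1 \<le> \<bar>of_int m - of_int n :: real\<bar>" by linarith
        moreover have "norm (k z - k y) = 2 * pi * \<bar>of_int m - of_int n\<bar>"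
          unfolding mn by (simp add: abs_mult flip: right_diff_distrib)
        ultimately show ?thesis by simp
      qed
      then show "\<exists>e>0. \<forall>z. z \<in> ?L \<and> k z \<noteq> k y \<longrightarrow> e \<le> norm (k z - k y)"
        by (intro exI[of _ "2 * pi"]) auto
    qed
    moreover have "x \<in> ?L" "b x \<in> ?L" using True b_in b_idem by auto
    ultimately have "k x = k (b x)" unfolding constant_on_def by metis
    then show ?thesis using True by (simp add: reduced_def k_def)
  qed (simp add: reduced_def)
qed

text \<open>\<open>lift u\<close> is a logarithm of \<open>u\<close>, corrected by a locally constant function so that it vanishes at the
  base points.\<close>

definition lift :: "'a \<Rightarrow> 'x \<Rightarrow> real" where
  "lift u = reduced (SOME h. continuous_on X h \<and> u = cexp h)"

definition embed :: "('x \<Rightarrow> real) \<Rightarrow> 'a" where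
  "embed f = (SOME a. \<forall>x\<in>X. \<gamma> a x = of_real (f x))"

lemma lift_cexp: "continuous_on X h \<Longrightarrow> lift (cexp h) = reduced h"
proof -
  assume h: "continuous_on X h"
  let ?h = "SOME h'. continuous_on X h' \<and> cexp h = cexp h'"
  have "continuous_on X ?h \<and> cexp h = cexp ?h"
    by (rule someI[of "\<lambda>h'. continuous_on X h' \<and> cexp h = cexp h'" h]) (simp add: h)
  then show ?thesis unfolding lift_def using reduced_unique[of ?h h] h by simp
qed

lemma lift_in: "u \<in> unitary_identity_component \<Longrightarrow> lift u \<in> CF X (b ` X)"
  by (metis componentE lift_cexp reduced_in)

lemma lift_mult:
  assumes "u \<in> unitary_identity_component" "v \<in> unitary_identity_component"
  shows "lift (u * v) = (\<lambda>x. lift u x + lift v x)"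
proof -
  obtain f where f: "continuous_on X f" "u = cexp f" using assms(1) by (rule componentE)
  obtain g where g: "continuous_on X g" "v = cexp g" using assms(2) by (rule componentE)
  have "u * v = cexp (\<lambda>x. f x + g x)" using f g cexp_add by simp
  then have "lift (u * v) = reduced (\<lambda>x. f x + g x)"
    using lift_cexp[of "\<lambda>x. f x + g x"] f g by (simp add: continuous_on_add)
  then show ?thesis unfolding f(2) g(2) lift_cexp[OF f(1)] lift_cexp[OF g(1)] by (auto simp: reduced_def)
qed

lemma gamma_embed:
  assumes "continuous_on X f" "x \<in> X"
  shows "\<gamma> (embed f) x = of_real (f x)"
proof -
  have "\<exists>a. \<forall>x\<in>X. \<gamma> a x = of_real (f x)"
    by (rule gamma_surj) (intro continuous_intros assms)
  then have "\<forall>x\<in>X. \<gamma> (embed f) x = of_real (f x)" unfolding embed_def by (rule someI_ex)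
  then show ?thesis using assms by blast
qed

lemma norm_embed_diff_le_iff:
  assumes f: "f \<in> CF X F" and g: "g \<in> CF X F" and B: "0 \<le> B"
  shows "norm (embed f - embed g) \<le> B \<longleftrightarrow> (\<forall>x. \<bar>f x - g x\<bar> \<le> B)"
proof -
  have fg: "continuous_on X f" "continuous_on X g" using f g by (auto simp: CF_def)
  have "cmod (\<gamma> (embed f - embed g) x) = \<bar>f x - g x\<bar>" if "x \<in> X" for x
    using gamma_embed[OF fg(1) that] gamma_embed[OF fg(2) that] that
    by (simp add: gamma_diff flip: of_real_diff)
  moreover have "\<bar>f x - g x\<bar> \<le> B" if "x \<notin> X" for x
    using f g B that by (simp add: CF_def)
  ultimately show ?thesis unfolding norm_le_iff[OF B] by auto
qed

text \<open>The second term, which is at most 2, serves only to obtain the norm topology.\<close>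

definition dist_c :: "'a \<Rightarrow> 'a \<Rightarrow> real" where
  "dist_c u v = norm (embed (lift u) - embed (lift v)) + norm (u - v)"

lemma metric_dist_c: "Metric_space unitary_identity_component dist_c"
proof
  fix u v w
  show "dist_c u w \<le> dist_c u v + dist_c v w"
    using norm_triangle_ineq[of "embed (lift u) - embed (lift v)" "embed (lift v) - embed (lift w)"]
      norm_triangle_ineq[of "u - v" "v - w"] by (simp add: dist_c_def)
  show "dist_c u v = 0 \<longleftrightarrow> u = v"
    unfolding dist_c_def by (metis add_nonneg_eq_0_iff eq_iff_diff_eq_0 norm_eq_zero norm_ge_zero)
qed (simp_all add: dist_c_def norm_minus_commute)

text \<open>Near \<open>u\<close> the exponents differ by a small \<open>k\<close>, and the reduced
  logarithms by the difference of two values of \<open>k\<close>.\<close>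

lemma lift_continuous:
  assumes u: "u \<in> unitary_identity_component" and e: "e > 0"
  obtains d where "d > 0" "\<And>v. v \<in> unitary_identity_component \<Longrightarrow> norm (v - u) < d \<Longrightarrow>
    norm (embed (lift u) - embed (lift v)) < e"
proof -
  obtain f where f: "continuous_on X f" "u = cexp f" using u by (rule componentE)
  have "isCont Ln 1" by (intro continuous_at_Ln) simp
  \<comment> \<open>A third of \<open>e\<close> suffices for the two values of \<open>k\<close> and
    leaves the final inequality strict.\<close>
  then obtain d where d: "d > 0" "\<And>w. dist w 1 < d \<Longrightarrow> dist (Ln w) (Ln 1) < e / 3"
    using e unfolding continuous_at_eps_delta by (metis zero_less_divide_iff zero_less_numeral)
  have "norm (embed (lift u) - embed (lift v)) < e"
    if v: "v \<in> unitary_identity_component" "norm (v - u) < min d 1" for v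
  proof -
    have "norm (v - cexp f) < 1" using v(2) f(2) by simp
    obtain k where k: "continuous_on X k" "v = cexp (\<lambda>x. k x + f x)"
      "\<And>x. x \<in> X \<Longrightarrow> \<bar>k x\<bar> \<le> cmod (Ln (\<gamma> v x * cnj (cis (f x))))"
      by (rule near_cexp[OF component_unitary[OF v(1)] f(1) \<open>norm (v - cexp f) < 1\<close>]) (rule that)
    have k_le: "\<bar>k x\<bar> \<le> e / 3" if x: "x \<in> X" for x
    proof -
      have "\<gamma> v x * cnj (cis (f x)) - 1 = (\<gamma> v x - cis (f x)) * cnj (cis (f x))"
        by (simp add: algebra_simps cis_cnj cis_mult)
      then have "dist (\<gamma> v x * cnj (cis (f x))) 1 = cmod (\<gamma> (v - u) x)"
        using f x by (simp add: dist_norm norm_mult gamma_diff gamma_cexp)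
      also have "\<dots> < d" using gamma_norm_le[OF x, of "v - u"] v(2) by simp
      finally have "cmod (Ln (\<gamma> v x * cnj (cis (f x)))) < e / 3" using d(2) by fastforce
      then show ?thesis using k(3)[OF x] by linarith
    qed
    have lv: "lift v = reduced (\<lambda>x. k x + f x)"
      unfolding k(2) by (intro lift_cexp continuous_intros k f)
    have lu: "lift u = reduced f" unfolding f(2) by (rule lift_cexp[OF f(1)])
    have "\<bar>lift u x - lift v x\<bar> \<le> 2 * (e / 3)" for x
    proof (cases "x \<in> X")
      case True
      then have "lift u x - lift v x = k (b x) - k x" by (simp add: lu lv reduced_def)
      then show ?thesis using k_le[OF True] k_le[OF b_in[OF True]] by linarith
    qed (use e in \<open>simp add: lu lv reduced_def\<close>)
    then have "norm (embed (lift u) - embed (lift v)) \<le> 2 * (e / 3)"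
      using norm_embed_diff_le_iff[OF lift_in[OF u] lift_in[OF v(1)], of "2 * (e / 3)"] e by simp
    then show ?thesis using e by simp
  qed
  then show ?thesis using that[of "min d 1"] d(1) by simp
qed

text \<open>\<open>lift_continuous\<close> shows that norm balls are small for
  \<open>dist_c\<close>; the norm summand of \<open>dist_c\<close> gives the converse.\<close>

lemma mtopology_dist_c:
  "Metric_space.mtopology unitary_identity_component dist_c = top_of_set unitary_identity_component"
proof -
  interpret M: Metric_space "unitary_identity_component :: 'a set" dist_c by (rule metric_dist_c)
  show ?thesis
  proof (rule topology_eq[THEN iffD2], intro allI)
    fix U :: "'a set"
    let ?G = "unitary_identity_component :: 'a set"
    show "openin M.mtopology U \<longleftrightarrow> openin (top_of_set ?G) U"
    proof
      assume U: "openin M.mtopology U"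
      show "openin (top_of_set ?G) U"
        unfolding openin_euclidean_subtopology_iff
      proof (intro conjI ballI)
        show "U \<subseteq> ?G" using U M.openin_mtopology by blast
        fix u assume u: "u \<in> U"
        then obtain r where r: "r > 0" "M.mball u r \<subseteq> U" using U M.openin_mtopology by blast
        have uG: "u \<in> ?G" using u \<open>U \<subseteq> ?G\<close> by blast
        obtain d where d: "d > 0" "\<And>v. v \<in> ?G \<Longrightarrow> norm (v - u) < d \<Longrightarrow> norm (embed (lift u) - embed (lift v)) < r / 2"
          using lift_continuous[OF uG, of "r / 2"] r(1) by auto
        have "v \<in> U" if v: "v \<in> ?G" "dist v u < min d (r / 2)" for v
        proof -
          have "dist_c u v < r"
            using d(2)[OF v(1)] v(2) by (simp add: dist_c_def dist_norm norm_minus_commute)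
          then show ?thesis using r(2) v(1) uG by auto
        qed
        then show "\<exists>e>0. \<forall>v\<in>?G. dist v u < e \<longrightarrow> v \<in> U"
          using d(1) r(1) by (intro exI[of _ "min d (r / 2)"]) auto
      qed
    next
      assume U: "openin (top_of_set ?G) U"
      show "openin M.mtopology U"
        unfolding M.openin_mtopology
      proof (intro conjI allI impI)
        show "U \<subseteq> ?G" using U openin_imp_subset by blast
        fix u assume "u \<in> U"
        then obtain e where e: "e > 0" "\<forall>v\<in>?G. dist v u < e \<longrightarrow> v \<in> U"
          using U unfolding openin_euclidean_subtopology_iff by blast
        have "dist v u \<le> dist_c u v" for v
          by (simp add: dist_c_def dist_norm norm_minus_commute)
        then have "M.mball u e \<subseteq> U" using e(2) by (meson M.in_mball le_less_trans subsetI)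
        then show "\<exists>r>0. M.mball u r \<subseteq> U" using e(1) by blast
      qed
    qed
  qed
qed

text \<open>\<open>lift\<close> turns products into sums, so the contribution of \<open>g\<close>
  cancels, and multiplication by a unitary is isometric.\<close>

lemma left_invariant_dist_c: "left_invariant unitary_identity_component dist_c"
  unfolding left_invariant_def
proof (intro ballI)
  fix g u v :: 'a
  assume g: "g \<in> unitary_identity_component" and u: "u \<in> unitary_identity_component" and v: "v \<in> unitary_identity_component"
  have n: "norm (g * u - g * v) = norm (u - v)"
    using norm_unitary_mult[OF component_unitary[OF g], of "u - v"] by (simp add: right_diff_distrib)
  have "embed (lift (g * u)) - embed (lift (g * v)) = embed (lift u) - embed (lift v)"
  proof (rule gamma_eqI)
    fix x assume x: "x \<in> X"
    have c: "continuous_on X (lift w)" if "w \<in> unitary_identity_component" for w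
      using lift_in[OF that] by (simp add: CF_def)
    show "\<gamma> (embed (lift (g * u)) - embed (lift (g * v))) x = \<gamma> (embed (lift u) - embed (lift v)) x"
      using x c[OF u] c[OF v] c[OF mult_in_component[OF g u]] c[OF mult_in_component[OF g v]] lift_mult[OF g u] lift_mult[OF g v]
      by (simp add: gamma_diff gamma_embed)
  qed
  then show "dist_c (g * u) (g * v) = dist_c u v" using n by (simp add: dist_c_def)
qed

section \<open>Maximality of the metric\<close>

lemma power_in_component: "u \<in> unitary_identity_component \<Longrightarrow> u ^ n \<in> unitary_identity_component" for u :: 'a
  by (induction n) (simp_all add: one_in_component mult_in_component)

lemma cexp_power: "continuous_on X h \<Longrightarrow> cexp h ^ n = cexp (\<lambda>x. real n * h x)"
proof (induction n)
  case (Suc n)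
  have "cexp h ^ Suc n = cexp (\<lambda>x. h x + real n * h x)"
    using Suc cexp_add[of h "\<lambda>x. real n * h x"] by (simp add: continuous_on_mult_left)
  also have "(\<lambda>x. h x + real n * h x) = (\<lambda>x. real (Suc n) * h x)" by (simp add: algebra_simps)
  finally show ?case .
qed (simp add: cexp_zero)

text \<open>By continuity \<open>p\<close> is below 1 near the identity. An exponential is the
  \<open>n\<close>-th power of the exponential of \<open>h / n\<close>, and left invariance makes
  the distance from 1 subadditive along powers.\<close>

lemma pseudometric_large_scale:
  assumes p: "pseudometric_on unitary_identity_component p"
    and cont: "continuous_on (unitary_identity_component \<times> unitary_identity_component) (\<lambda>(x, y). p x y)"
    and inv: "left_invariant unitary_identity_component p"
  obtains K where "K > 0"
    "\<And>h B. continuous_on X h \<Longrightarrow> 0 \<le> B \<Longrightarrow> (\<And>x. x \<in> X \<Longrightarrow> \<bar>h x\<bar> \<le> B) \<Longrightarrow> p 1 (cexp h) \<le> K * B + 2"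
proof -
  let ?G = "unitary_identity_component :: 'a set"
  note one = one_in_component
  have p1: "p 1 1 = 0" using p one by (simp add: pseudometric_on_def)
  obtain d where d: "d > 0" "\<And>w. w \<in> ?G \<times> ?G \<Longrightarrow> dist w (1, 1) < d \<Longrightarrow> dist ((\<lambda>(x, y). p x y) w) (p 1 1) < 1"
    using cont[unfolded continuous_on_iff, rule_format, of "(1, 1)" 1] one by auto
  have small: "p 1 v < 1" if "v \<in> ?G" "norm (v - 1) < d" for v
    using d(2)[of "(1, v)"] that one p1 by (simp add: dist_Pair_Pair dist_norm)
  have pow: "p 1 (v ^ n) \<le> real n * p 1 v" if v: "v \<in> ?G" for v n
  proof (induction n)
    case (Suc n)
    have "p 1 (v ^ Suc n) \<le> p 1 v + p v (v ^ Suc n)"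
      using p one v power_in_component[OF v, of "Suc n"] unfolding pseudometric_on_def by blast
    also have "p v (v ^ Suc n) = p 1 (v ^ n)"
      using inv v one power_in_component[OF v, of n] unfolding left_invariant_def by (metis mult.right_neutral power_Suc)
    finally show ?case using Suc by (simp add: algebra_simps)
  qed (simp add: p1)
  have "p 1 (cexp h) \<le> (1 / d) * B + 2" if h: "continuous_on X h" "0 \<le> B" "\<And>x. x \<in> X \<Longrightarrow> \<bar>h x\<bar> \<le> B" for h B
  proof -
    \<comment> \<open>The additional 1 makes \<open>B / n\<close> strictly smaller than
      \<open>d\<close>, also when \<open>B / d\<close> is an integer, and keeps \<open>n\<close>
      positive when \<open>B\<close> is 0.\<close>
    define n where "n = nat \<lceil>B / d\<rceil> + 1"
    have n: "B / d < real n" "real n \<le> B / d + 2" "real n > 0"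
    proof -
      have "0 \<le> B / d" using h(2) d(1) by simp
      then have "0 \<le> \<lceil>B / d\<rceil>" by linarith
      then have "real n = of_int \<lceil>B / d\<rceil> + 1" by (simp add: n_def)
      then show "B / d < real n" "real n \<le> B / d + 2" "real n > 0"
        using le_of_int_ceiling[of "B / d"] of_int_ceiling_le_add_one[of "B / d"] \<open>0 \<le> B / d\<close> by linarith+
    qed
    let ?h = "\<lambda>x. (1 / real n) * h x"
    have hc: "continuous_on X ?h" by (intro continuous_intros h)
    have "norm (cexp ?h - cexp (\<lambda>_. 0)) \<le> B / real n"
    proof (rule norm_cexp_diff_le[OF hc continuous_on_const])
      show "\<bar>?h x - 0\<bar> \<le> B / real n" if "x \<in> X" for x
        using h(3)[OF that] n(3) by (simp add: abs_mult divide_right_mono)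
    qed (use h(2) in simp)
    moreover have "B / real n < d" using n(1,3) d(1) by (simp add: field_simps)
    ultimately have lt: "p 1 (cexp ?h) < 1"
      using small[OF cexp_in_component[OF hc]] by (simp add: cexp_zero)
    have "p 1 (cexp h) = p 1 (cexp ?h ^ n)"
      using cexp_power[OF hc, of n] n(3) by simp
    also have "\<dots> \<le> real n * p 1 (cexp ?h)"
      by (rule pow[OF cexp_in_component[OF hc]])
    also have "\<dots> \<le> real n * 1"
      using lt n(3) by (intro mult_left_mono) auto
    finally have "p 1 (cexp h) \<le> real n" by simp
    then show ?thesis using n(2) by simp
  qed
  then show ?thesis using that[of "1 / d"] d(1) by simp
qed

text \<open>The quotient of two elements has a logarithm that is the difference of their lifts plus
  locally constant values in [0, 2 pi]; the latter enter only the additive constant.\<close>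

lemma maximal_metric_dist_c:
  "maximal_metric unitary_identity_component (metric (unitary_identity_component, dist_c))"
proof -
  let ?G = "unitary_identity_component :: 'a set"
  interpret M: Metric_space ?G dist_c by (rule metric_dist_c)
  have "\<exists>K>0. \<exists>L>0. \<forall>u\<in>?G. \<forall>v\<in>?G. p u v \<le> K * dist_c u v + L"
    if p: "pseudometric_on ?G p" "continuous_on (?G \<times> ?G) (\<lambda>(x, y). p x y)" "left_invariant ?G p" for p
  proof -
    obtain K where K: "K > 0" "\<And>h B. continuous_on X h \<Longrightarrow> 0 \<le> B \<Longrightarrow> (\<And>x. x \<in> X \<Longrightarrow> \<bar>h x\<bar> \<le> B) \<Longrightarrow> p 1 (cexp h) \<le> K * B + 2"
      using pseudometric_large_scale[OF p] by blast
    have "p u v \<le> K * dist_c u v + (K * (2 * pi) + 2)" if u: "u \<in> ?G" and v: "v \<in> ?G" for u v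
    proof -
      let ?w = "star u * v"
      have su: "star u \<in> ?G" by (rule star_in_component[OF u])
      have w: "?w \<in> ?G" by (rule mult_in_component[OF su v])
      have uw: "u * ?w = v" using unitary_mult_star[OF component_unitary[OF u]] by (simp flip: mult.assoc)
      have "p u v = p (u * 1) (u * ?w)" using uw by simp
      also have "\<dots> = p 1 ?w" using p(3) u w one_in_component unfolding left_invariant_def by blast
      finally have puv: "p u v = p 1 ?w" .
      obtain h where h: "continuous_on X h" "?w = cexp h" using w by (rule componentE)
      \<comment> \<open>The remainder modulo 2 pi of the value at the base point: the logarithm
        changes by a multiple of 2 pi on each component, which leaves the unitary unchanged.\<close>
      define t where "t x = h (b x) - 2 * pi * of_int \<lfloor>h (b x) / (2 * pi)\<rfloor>" for x
      define g where "g x = reduced h x + t x" for x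
      have t: "0 \<le> t x \<and> t x \<le> 2 * pi" for x
      proof -
        have "of_int \<lfloor>h (b x) / (2 * pi)\<rfloor> * (2 * pi) \<le> h (b x)"
          "h (b x) < (of_int \<lfloor>h (b x) / (2 * pi)\<rfloor> + 1) * (2 * pi)"
          by (rule floor_divide_lower, simp, rule floor_divide_upper, simp)
        then show ?thesis unfolding t_def by (simp add: algebra_simps)
      qed
      have gc: "continuous_on X g"
        unfolding g_def t_def using reduced_in[OF h(1)]
        by (intro continuous_intros continuous_comp_b[of "\<lambda>z. h z"] continuous_comp_b[of "\<lambda>z. real_of_int \<lfloor>h z / (2 * pi)\<rfloor>"])
          (simp add: CF_def)
      have "cis (g x) = cis (h x)" if x: "x \<in> X" for x
      proof -
        have "g x = h x - 2 * pi * of_int \<lfloor>h (b x) / (2 * pi)\<rfloor>" using x by (simp add: g_def t_def reduced_def)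
        then show ?thesis by (simp add: cis_2pi flip: cis_divide)
      qed
      then have wg: "?w = cexp g" unfolding h(2) using cexp_eq_iff[OF h(1) gc] by simp
      define B where "B = norm (embed (lift u) - embed (lift v))"
      have lw: "lift v x - lift u x = reduced h x" for x
        using lift_mult[OF u w] uw lift_cexp[OF h(1)] h(2) by (metis add_diff_cancel_left')
      have "\<bar>lift u x - lift v x\<bar> \<le> B" for x
        using norm_embed_diff_le_iff[OF lift_in[OF u] lift_in[OF v], of B] by (simp add: B_def)
      then have "\<bar>g x\<bar> \<le> B + 2 * pi" for x
        using lw[of x] t[of x] unfolding g_def by (smt (verit))
      then have "p 1 (cexp g) \<le> K * (B + 2 * pi) + 2"
        by (intro K(2)[OF gc]) (simp_all add: B_def)
      also have "\<dots> \<le> K * dist_c u v + (K * (2 * pi) + 2)"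
        using K(1) by (simp add: dist_c_def B_def distrib_left)
      finally show ?thesis using puv wg by simp
    qed
    moreover have "K * (2 * pi) + 2 > 0" using K(1) by (simp add: add_pos_pos)
    ultimately show ?thesis using K(1) by blast
  qed
  then show ?thesis
    unfolding maximal_metric_def using mtopology_dist_c left_invariant_dist_c by simp
qed

end

section \<open>Comparison with the space of continuous functions on the interval\<close>

text \<open>Boundedness is automatic on the compact interval.\<close>

lemma mspace_C01: "mspace C01 = {f. f \<in> extensional {0..1} \<and> continuous_on {0..1} f}"
proof -
  have "compactin (top_of_set {0..1 :: real}) (topspace (top_of_set {0..1}))"
    by (simp add: compactin_subtopology)
  from compactin_mspace_cfunspace[OF this, of "euclidean_metric :: real metric"] show ?thesis
    unfolding C01_def by auto
qed

lemma mdist_C01_le_iff: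
  assumes "f \<in> mspace C01" "g \<in> mspace C01"
  shows "mdist C01 f g \<le> a \<longleftrightarrow> (\<forall>x\<in>{0..1}. \<bar>f x - g x\<bar> \<le> a)"
  using cfunspace_mdist_le[of f "top_of_set {0..1}" euclidean_metric g a] assms
  unfolding C01_def by (simp add: dist_real_def)

context based_gelfand
begin

text \<open>One of the finitely many classes is infinite; a connected set that is not a single point
  has no isolated points, and only finitely many of its points can be base points.\<close>

lemma perfect_part:
  assumes "infinite X"
  obtains Q x0 where "compact Q" "Q \<subseteq> X" "\<And>x. x \<in> Q \<Longrightarrow> x islimpt Q" "x0 \<in> Q" "x0 \<notin> b ` X"
proof -
  have "X = (\<Union>c\<in>b ` X. {y \<in> X. b y = c})" by auto
  then obtain c where c: "c \<in> b ` X" "infinite {y \<in> X. b y = c}"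
    using assms b_finite by (metis (no_types, lifting) finite_UN)
  then obtain x where x: "x \<in> X" "c = b x" by blast
  let ?Q = "{y \<in> X. b y = b x}"
  have inf: "infinite ?Q" using c x by simp
  have "closedin (top_of_set X) ?Q"
    using continuous_closedin_preimage_constant[OF continuous_comp_b[of "\<lambda>z. z"]] .
  then have "compact ?Q" using X_compact closedin_compact by blast
  moreover have "y islimpt ?Q" if "y \<in> ?Q" for y
  proof (rule connected_imp_perfect[OF b_connected[OF x(1)] that])
    show "?Q \<noteq> {z}" for z using inf by (metis finite.emptyI finite_insert)
  qed
  moreover obtain x0 where "x0 \<in> ?Q" "x0 \<notin> b ` X"
    using inf b_finite by (meson finite_subset subsetI)
  ultimately show ?thesis using that[of ?Q x0] by blast
qed

text \<open>The map is \<open>lift\<close> followed by the Lipschitz equivalence.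
  \<open>lift\<close> forgets only the torus part, on which \<open>dist_c\<close> is at most
  2.\<close>

lemma quasi_isometric_C01:
  assumes L: "lipeq (fsp (CF X (b ` X))) (fsp (CF {0..1 :: real} {}))"
    and m: "maximal_metric (unitary_identity_component :: 'a set) m"
  shows "quasi_isometric m C01"
proof -
  let ?G = "unitary_identity_component :: 'a set" and ?I = "{0..1 :: real}"
  obtain h k where h: "lip_map (fsp (CF X (b ` X))) (fsp (CF ?I {})) h"
    and k: "lip_map (fsp (CF ?I {})) (fsp (CF X (b ` X))) k"
    and kh: "\<forall>f\<in>pts (fsp (CF X (b ` X))). k (h f) = f" and hk: "\<forall>g\<in>pts (fsp (CF ?I {})). h (k g) = g"
    using L unfolding lipeq_def by blast
  obtain A where A: "A > 0" "\<And>f g B B'. f \<in> pts (fsp (CF X (b ` X))) \<Longrightarrow> g \<in> pts (fsp (CF X (b ` X))) \<Longrightarrow> 0 \<le> B \<Longrightarrow>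
      near (fsp (CF X (b ` X))) B f g \<Longrightarrow> A * B \<le> B' \<Longrightarrow> near (fsp (CF ?I {})) B' (h f) (h g)"
    by (rule lip_mapE[OF h]) (rule that)
  obtain C where C: "C > 0" "\<And>f g B B'. f \<in> pts (fsp (CF ?I {})) \<Longrightarrow> g \<in> pts (fsp (CF ?I {})) \<Longrightarrow> 0 \<le> B \<Longrightarrow>
      near (fsp (CF ?I {})) B f g \<Longrightarrow> C * B \<le> B' \<Longrightarrow> near (fsp (CF X (b ` X))) B' (k f) (k g)"
    by (rule lip_mapE[OF k]) (rule that)
  have h_in: "h f \<in> CF ?I {}" if "f \<in> CF X (b ` X)" for f using lip_map_pts[OF h] that by simp
  have k_in: "k f \<in> CF X (b ` X)" if "f \<in> CF ?I {}" for f using lip_map_pts[OF k] that by simp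
  interpret M: Metric_space ?G dist_c by (rule metric_dist_c)
  let ?d = "metric (?G, dist_c)"
  have ms: "mspace m = ?G" using m by (simp add: maximal_metric_def)
  obtain K1 L1 where 1: "K1 > 0" "L1 > 0" "\<And>u v. u \<in> ?G \<Longrightarrow> v \<in> ?G \<Longrightarrow> mdist m u v \<le> K1 * mdist ?d u v + L1"
    by (rule maximal_metric_comparison[OF m maximal_metric_dist_c]) (rule that)
  obtain K2 L2 where 2: "K2 > 0" "L2 > 0" "\<And>u v. u \<in> ?G \<Longrightarrow> v \<in> ?G \<Longrightarrow> mdist ?d u v \<le> K2 * mdist m u v + L2"
    by (rule maximal_metric_comparison[OF maximal_metric_dist_c m]) (rule that)
  define F where "F u = restrict (h (lift u)) ?I" for u
  have F_in: "F u \<in> mspace C01" if "u \<in> ?G" for u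
  proof -
    have "continuous_on ?I (h (lift u))" using h_in[OF lift_in[OF that]] by (simp add: CF_def)
    then have "continuous_on ?I (F u)" by (rule continuous_on_eq) (simp add: F_def)
    then show ?thesis unfolding mspace_C01 by (simp add: F_def)
  qed
  have F_le: "mdist C01 (F u) (F v) \<le> B \<longleftrightarrow> (\<forall>x. \<bar>h (lift u) x - h (lift v) x\<bar> \<le> B)"
    if u: "u \<in> ?G" and v: "v \<in> ?G" and B: "0 \<le> B" for u v B
  proof -
    have "\<bar>h (lift u) x - h (lift v) x\<bar> \<le> B" if "x \<notin> ?I" for x
      using h_in[OF lift_in[OF u]] h_in[OF lift_in[OF v]] that B by (simp add: CF_def)
    then show ?thesis unfolding mdist_C01_le_iff[OF F_in[OF u] F_in[OF v]] by (auto simp: F_def)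
  qed
  have up: "mdist C01 (F u) (F v) \<le> A * dist_c u v" if u: "u \<in> ?G" and v: "v \<in> ?G" for u v
  proof -
    let ?B = "norm (embed (lift u) - embed (lift v))"
    have "near (fsp (CF X (b ` X))) ?B (lift u) (lift v)"
      using norm_embed_diff_le_iff[OF lift_in[OF u] lift_in[OF v], of ?B] by simp
    then have "near (fsp (CF ?I {})) (A * ?B) (h (lift u)) (h (lift v))"
      using lift_in[OF u] lift_in[OF v] by (intro A(2)[of _ _ ?B]) auto
    then have "mdist C01 (F u) (F v) \<le> A * ?B" using F_le[OF u v] A(1) by simp
    also have "\<dots> \<le> A * dist_c u v" using A(1) by (simp add: dist_c_def)
    finally show ?thesis .
  qed
  have low: "dist_c u v \<le> C * mdist C01 (F u) (F v) + 2" if u: "u \<in> ?G" and v: "v \<in> ?G" for u v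
  proof -
    let ?B = "mdist C01 (F u) (F v)"
    have B: "0 \<le> ?B" by simp
    have "near (fsp (CF ?I {})) ?B (h (lift u)) (h (lift v))" using F_le[OF u v B] by simp
    then have "near (fsp (CF X (b ` X))) (C * ?B) (k (h (lift u))) (k (h (lift v)))"
      using h_in[OF lift_in[OF u]] h_in[OF lift_in[OF v]] B by (intro C(2)[of _ _ ?B]) auto
    then have "norm (embed (lift u) - embed (lift v)) \<le> C * ?B"
      using norm_embed_diff_le_iff[OF lift_in[OF u] lift_in[OF v], of "C * ?B"] kh lift_in[OF u] lift_in[OF v] B C(1) by simp
    moreover have "norm w = 1" if "w \<in> ?G" for w
      using norm_unitary_mult[OF component_unitary[OF that], of 1] by simp
    then have "norm (u - v) \<le> 2" using norm_triangle_ineq4[of u v] u v by simp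
    ultimately show ?thesis by (simp add: dist_c_def)
  qed
  have "quasi_isometry m C01 F"
  \<comment> \<open>Both inequalities must share constants, so those of the two directions are
    added.\<close>
  proof (rule quasi_isometryI[where K = "K1 * C + A * K2" and L = "2 * K1 + L1 + A * L2" and e = 1])
    fix u v assume "u \<in> mspace m" "v \<in> mspace m"
    then have u: "u \<in> ?G" and v: "v \<in> ?G" by (simp_all add: ms)
    have nn: "0 \<le> A * K2 * mdist C01 (F u) (F v)" "0 \<le> A * L2" "0 \<le> K1 * C * mdist m u v" "0 \<le> 2 * K1 + L1"
      using A(1) C(1) 1(1,2) 2(1,2) by simp_all
    have "mdist m u v \<le> K1 * (C * mdist C01 (F u) (F v) + 2) + L1"
    proof -
      have "mdist m u v \<le> K1 * dist_c u v + L1" using 1(3)[OF u v] by simp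
      moreover have "K1 * dist_c u v \<le> K1 * (C * mdist C01 (F u) (F v) + 2)"
        using low[OF u v] 1(1) by (intro mult_left_mono) auto
      ultimately show ?thesis by linarith
    qed
    then show "mdist m u v \<le> (K1 * C + A * K2) * mdist C01 (F u) (F v) + (2 * K1 + L1 + A * L2)"
      using nn by (simp add: algebra_simps)
    have "mdist C01 (F u) (F v) \<le> A * (K2 * mdist m u v + L2)"
    proof -
      have "dist_c u v \<le> K2 * mdist m u v + L2" using 2(3)[OF u v] by simp
      then have "A * dist_c u v \<le> A * (K2 * mdist m u v + L2)"
        using A(1) by (intro mult_left_mono) auto
      then show ?thesis using up[OF u v] by linarith
    qed
    then show "mdist C01 (F u) (F v) \<le> (K1 * C + A * K2) * mdist m u v + (2 * K1 + L1 + A * L2)"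
      using nn by (simp add: algebra_simps)
  next
    fix y assume y: "y \<in> mspace C01"
    \<comment> \<open>Translates from functions that are undefined off the interval to functions
      that vanish there.\<close>
    define g where "g x = (if x \<in> ?I then y x else 0)" for x
    have g: "g \<in> CF ?I {}"
    proof -
      have "continuous_on ?I y" using y unfolding mspace_C01 by simp
      then have "continuous_on ?I g" by (rule continuous_on_eq) (simp add: g_def)
      then show ?thesis by (simp add: CF_def g_def)
    qed
    have kc: "continuous_on X (k g)" using k_in[OF g] by (simp add: CF_def)
    have "lift (cexp (k g)) = k g" using lift_cexp[OF kc] reduced_id[OF k_in[OF g]] by simp
    then have "F (cexp (k g)) = restrict g ?I" using hk g by (simp add: F_def)
    also have "\<dots> = y" using y unfolding mspace_C01 by (auto simp: g_def extensional_def restrict_def fun_eq_iff)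
    finally have "mdist C01 y (F (cexp (k g))) \<le> 0" using mdist_C01_le_iff[OF y y, of 0] by simp
    then have "mdist C01 y (F (cexp (k g))) < 1" by linarith
    then show "\<exists>u\<in>mspace m. mdist C01 y (F u) < 1"
      using cexp_in_component[OF kc] ms by blast
  qed (use F_in ms A(1) C(1) 1(1,2) 2(1,2) in \<open>auto intro!: add_pos_pos\<close>)
  then show ?thesis unfolding quasi_isometric_def by blast
qed

end

lemma unitary_component_quasi_isometric_C01:
  assumes sep: "separable_space (euclidean :: 'a::unital_cstar_algebra topology)"
    and inf: "infinite_dimensional TYPE('a)"
    and comm: "\<forall>x y :: 'a. x * y = y * x"
    and fg: "finitely_generated_group (fundamental_group (unitary_identity_component :: 'a set) 1)"
  shows "group_quasi_isometric_to_space (unitary_identity_component :: 'a set) C01"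
proof -
  interpret commutative_cstar "TYPE('a)" by standard (use comm in blast)
  obtain X :: "(nat \<Rightarrow> complex) set" and \<gamma> :: "'a \<Rightarrow> (nat \<Rightarrow> complex) \<Rightarrow> complex" where "gelfand X \<gamma>"
    by (rule gelfand_exists[OF sep])
  then interpret gelfand X \<gamma> .
  obtain b d where bd: "d > 0" "\<And>x y. x \<in> X \<Longrightarrow> y \<in> X \<Longrightarrow> dist x y < d \<Longrightarrow> b x = b y"
    "\<And>x. x \<in> X \<Longrightarrow> b x \<in> X" "\<And>x. x \<in> X \<Longrightarrow> b (b x) = b x" "finite (b ` X)"
    "\<And>x. x \<in> X \<Longrightarrow> connected {y \<in> X. b y = b x}"
    by (rule base_points[OF fg]) (rule that)
  interpret based_gelfand X \<gamma> b d
    by unfold_locales (fact bd)+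
  obtain Q x0 where Q: "compact Q" "Q \<subseteq> X" "\<And>x. x \<in> Q \<Longrightarrow> x islimpt Q" "x0 \<in> Q" "x0 \<notin> b ` X"
    by (rule perfect_part[OF infinite_spectrum[OF inf]]) (rule that)
  have bX: "b ` X \<subseteq> X" using bd(3) by blast
  have 1: "lipeq (fsp (CF X (b ` X))) (gc0 (fsp (CF cantor {})))"
    by (rule lipeq_CF_milutin[OF X_compact finite_imp_closed[OF bd(5)] bX Q])
  have perfect: "x islimpt {0..1 :: real}" if "x \<in> {0..1}" for x
    using connected_imp_perfect[of "{0..1 :: real}" x] that by (metis atLeastAtMost_singleton_iff connected_Icc zero_neq_one)
  \<comment> \<open>The interval serves as its own perfect set, and there is nothing to
    avoid.\<close>
  have 2: "lipeq (fsp (CF {0..1 :: real} {})) (gc0 (fsp (CF cantor {})))"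
    by (rule lipeq_CF_milutin[OF compact_Icc closed_empty empty_subsetI compact_Icc subset_refl perfect, of 0]) auto
  have L: "lipeq (fsp (CF X (b ` X))) (fsp (CF {0..1 :: real} {}))"
    using lipeq_trans[OF 1 lipeq_sym[OF 2]] .
  show ?thesis
    unfolding group_quasi_isometric_to_space_def
    using maximal_metric_dist_c quasi_isometric_C01[OF L] by blast
qed

theorem theorem4p10:
  assumes "separable_space (euclidean :: 'a::unital_cstar_algebra topology)"
    and "infinite_dimensional TYPE('a)"
    and "\<forall>x y :: 'a. x * y = y * x"
    and "finitely_generated_group
           (fundamental_group (unitary_identity_component :: 'a set) 1)"
  shows "group_quasi_isometric_to_space (unitary_identity_component :: 'a set) C01 \<and>
    (separable_space (euclidean :: 'b::unital_cstar_algebra topology) \<and>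
     infinite_dimensional TYPE('b) \<and>
     (\<forall>x y :: 'b. x * y = y * x) \<and>
     finitely_generated_group
       (fundamental_group (unitary_identity_component :: 'b set) 1) \<longrightarrow>
     groups_quasi_isometric (unitary_identity_component :: 'a set)
       (unitary_identity_component :: 'b set))"
proof -
  have A: "group_quasi_isometric_to_space (unitary_identity_component :: 'a set) C01"
    by (rule unitary_component_quasi_isometric_C01[OF assms])
  \<comment> \<open>The two groups are compared through \<open>C01\<close>.\<close>
  moreover have "groups_quasi_isometric (unitary_identity_component :: 'a set) (unitary_identity_component :: 'b set)"
    if B: "group_quasi_isometric_to_space (unitary_identity_component :: 'b set) C01"
    using A B quasi_isometric_trans quasi_isometric_sym
    unfolding group_quasi_isometric_to_space_def groups_quasi_isometric_def by meson
  ultimately show ?thesis using unitary_component_quasi_isometric_C01 by blast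
qed

end
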